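(* The notion of $I$-partial $*$-algebraic quantum group of compact type coincides with the notion of $I$-partial compact quantum group: an $I$-partial multiplier Hopf $*$-algebra $(A,\Delta)$ is an $I$-partial $*$-algebraic quantum group of compact type if and only if it is an $I$-partial compact quantum group.
   Context: Conventions. Algebras are associative over $\mathbb C$, not necessarily unital; for subspaces, $VW$ is the span of products. $M(A)$ is the multiplier algebra of $A$: pairs $m=(\lambda,\rho)$ of linear maps on $A$, written $ma=\lambda(a)$, $am=\rho(a)$, with $a(mb)=(am)b$; strict convergence $m_\alpha\to m$ means that for each $a\in A$ eventually $m_\alpha a=ma$ and $am_\alpha=am$. An algebra $B$ is left (right) non-degenerate if $bB=0$ (resp. $Bb=0$) implies $b=0$, non-degenerate if both, and idempotent if $BB=B$. Partial algebras. For a set $J$, a $J$-partial algebra is an algebra $A=\bigoplus_{r,s\in J}A(r,s)$ with $A(r,s)A(s',t)=0$ for $s\neq s'$ and $A(r,s)A(s,t)\subseteq A(r,t)$. Its base units $\mathbf 1(r)\in M(A)$ are given by $\mathbf 1(r)a=\delta_{r,r'}a$, $a\mathbf 1(s)=\delta_{s,s'}a$ for $a\in A(r',s')$. It is non-degenerate if all algebras $A\mathbf 1(r)$ are left non-degenerate and all $\mathbf 1(r)A$ are right non-degenerate; idempotent if all $A\mathbf 1(r)$ and $\mathbf 1(r)A$ are idempotent. A morphism $A\to B$ of non-degenerate idempotent $J$-partial algebras is a homomorphism $f:A\to M(B)$ with $B\mathbf 1(r)\cdot f(A\mathbf 1(r))=B\mathbf 1(r)$ and $f(\mathbf 1(r)A)\cdot\mathbf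 1(r)B=\mathbf 1(r)B$ for all $r$; it extends uniquely to a unital homomorphism $M(A)\to M(B)$. Partial multiplier Hopf algebras. Fix a set $I$. In an $I^2$-partial algebra ($J=I\times I$, indices written as columns) the base units are $\mathbf 1\binom rt$ and the components are ${}^r_tA^s_u=\mathbf 1\binom rtA\mathbf 1\binom su$. Put $\mathbf 1^r=\sum_t\mathbf 1\binom rt$, $\mathbf 1_t=\sum_r\mathbf 1\binom rt$ (strict sums in $M(A)$). Omitted indices are summed over: $A^s=A\mathbf 1^s$, $A_u=A\mathbf 1_u$, ${}^rA=\mathbf 1^rA$, ${}_tA=\mathbf 1_tA$, $A^s_u=A\mathbf 1\binom su$, etc. $A\otimes^IB=\bigoplus\,{}^r_tA^s_u\otimes{}^t_vB^u_w\subseteq A\otimes B$ is an $I^2$-partial algebra with ${}^r_v(A\otimes^IB)^s_w=\bigoplus_{t,u}{}^r_tA^s_u\otimes{}^t_vB^u_w$; it equals $E(A\otimes B)E$ with $E=\sum_t\mathbf 1_t\otimes\mathbf 1^t$, and one identifies $M(A\otimes^IB)=E\,M(A\otimes B)E$. For a non-degenerate idempotent $I^2$-partial algebra $A$, a regular comultiplication is a morphism $\Delta$ from $A$ to $A\otimes^IA$ such that $\Delta(a)(b\otimes1),\Delta(a)(1\otimes b),(b\otimes1)\Delta(a),(1\otimes b)\Delta(a)\in A\otimes A$ for all $a,b\in A$ and $(\Delta\otimes\mathrm{id})\Delta=(\mathrm{id}\otimes\Delta)\Delta$. For a functional $\omega$, $(\mathrm{id}\otimes\omega)\Delta(a)\in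 M(A)$ is the multiplier $b\mapsto(\mathrm{id}\otimes\omega)(\Delta(a)(b\otimes1))$, $b\mapsto(\mathrm{id}\otimes\omega)((b\otimes1)\Delta(a))$; similarly $(\omega\otimes\mathrm{id})\Delta(a)$. $(A,\Delta)$ is a regular $I$-partial multiplier bialgebra if there is a (necessarily unique) functional $\varepsilon:A\to\mathbb C$ (counit) with: $\varepsilon({}^r_tA^s_u)=0$ if $r\ne t$ or $s\neq u$; $\varepsilon(A_r)\neq0\neq\varepsilon({}_rA)$ for all $r$; $\varepsilon(ab)=\varepsilon(a)\varepsilon(b)$ for $a\in A^s_t$, $b\in{}^s_tA$; $(\mathrm{id}\otimes\varepsilon)\Delta(a)=a=(\varepsilon\otimes\mathrm{id})\Delta(a)$. It is a regular $I$-partial multiplier Hopf algebra if the following maps are bijective, with $\Delta^{\mathrm{op}}$ the flipped coproduct: $\bigoplus_r A_r\otimes{}_rA\to\bigoplus_r{}_rA\otimes{}^rA$, $a\otimes b\mapsto\Delta(a)(1\otimes b)$; $\bigoplus_rA^r\otimes{}^rA\to\bigoplus_rA_r\otimes A^r$, $a\otimes b\mapsto(a\otimes1)\Delta(b)$; $\bigoplus_rA^r\otimes{}^rA\to\bigoplus_r{}^rA\otimes{}_rA$, $a\otimes b\mapsto\Delta^{\mathrm{op}}(a)(1\otimes b)$; $\bigoplus_rA_r\otimes{}_rA\to\bigoplus_rA^r\otimes A_r$, $a\otimes b\mapsto(a\otimes1)\Delta^{\mathrm{op}}(b)$. Invariant functionals. A functional $\varphi$ (resp. $\psi$) on $A$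 is left (resp. right) invariant if it vanishes on all components other than the ${}^r_sA^r_s$ and $(\mathrm{id}\otimes\varphi)\Delta(a)=\sum_r\varphi(\mathbf 1^ra)\mathbf 1^r$ (resp. $(\psi\otimes\mathrm{id})\Delta(a)=\sum_s\psi(\mathbf 1_sa)\mathbf 1_s$) for all $a$. A functional $\omega$ is faithful if $\omega(ab)=0$ for all $b$, or $\omega(ba)=0$ for all $b$, forces $a=0$; positive (on a $*$-algebra) if $\omega(a^*a)\ge0$ for all $a$. $*$-structures. An $I$-partial multiplier Hopf $*$-algebra is a regular $I$-partial multiplier Hopf algebra whose total algebra $A$ is a $*$-algebra with $({}^r_tA^s_u)^*={}^s_uA^r_t$ and for which $\Delta:A\to M(A\otimes A)$ is a $*$-homomorphism. It is a (regular) partial Hopf $*$-algebra if $\mathbf 1\binom rs\in A$ for all $r,s\in I$. An $I$-partial $*$-algebraic quantum group is an $I$-partial multiplier Hopf $*$-algebra possessing a positive faithful left invariant functional; it is of compact type if it is a partial Hopf $*$-algebra. An $I$-partial compact quantum group (De Commer–Timmermann) is an $I$-partial Hopf $*$-algebra possessing a positive functional $\varphi$ that is both left and right invariant and satisfies $\varphi(\mathbf 1\binom rr)=1$ for all $r\in I$. *)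

theory Defs
  imports Complex_Main "HOL-Library.Poly_Mapping"
begin

section \<open>Complex vector spaces and algebras\<close>

class scaleC =
  fixes scaleC :: "complex \<Rightarrow> 'a \<Rightarrow> 'a" (infixr \<open>*\<^sub>C\<close> 75)

class complex_vector = scaleC + ab_group_add +
  assumes scaleC_add_right: "a *\<^sub>C (x + y) = a *\<^sub>C x + a *\<^sub>C y"
    and scaleC_add_left: "(a + b) *\<^sub>C x = a *\<^sub>C x + b *\<^sub>C x"
    and scaleC_scaleC: "a *\<^sub>C b *\<^sub>C x = (a * b) *\<^sub>C x"
    and scaleC_one: "1 *\<^sub>C x = x"

text \<open>As for \<^class>\<open>real_algebra\<close>, algebras are associative but need not be unital.\<close>

class complex_algebra = complex_vector + ring +
  assumes mult_scaleC_left [simp]: "(c *\<^sub>C x) * y = c *\<^sub>C (x * y)"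
    and mult_scaleC_right [simp]: "x * (c *\<^sub>C y) = c *\<^sub>C (x * y)"

class complex_star_algebra = complex_algebra +
  fixes adj :: "'a \<Rightarrow> 'a"
  assumes adj_adj [simp]: "adj (adj x) = x"
    and adj_add: "adj (x + y) = adj x + adj y"
    and adj_scaleC: "adj (c *\<^sub>C x) = cnj c *\<^sub>C adj x"
    and adj_mult: "adj (x * y) = adj y * adj x"

global_interpretation cvec: vector_space "scaleC :: complex \<Rightarrow> 'a \<Rightarrow> 'a :: complex_vector"
  defines cspan = cvec.span
    and csubspace = cvec.subspace
  by unfold_locales (simp_all add: scaleC_add_right scaleC_add_left scaleC_scaleC scaleC_one)

abbreviation clinear :: "('a::complex_vector \<Rightarrow> 'b::complex_vector) \<Rightarrow> bool"
  where "clinear \<equiv> Vector_Spaces.linear scaleC scaleC"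

lemma clinearI:
  assumes "\<And>x y. f (x + y) = f x + f y" and "\<And>c x. f (c *\<^sub>C x) = c *\<^sub>C f x"
  shows "clinear f"
  using assms by unfold_locales (simp_all add: scaleC_add_right scaleC_add_left scaleC_scaleC scaleC_one)

lemma clinear_add: "clinear f \<Longrightarrow> f (x + y) = f x + f y"
  by (rule module_hom.add[OF Vector_Spaces.linear.axioms(3)])

lemma clinear_scaleC: "clinear f \<Longrightarrow> f (c *\<^sub>C x) = c *\<^sub>C f x"
  by (rule module_hom.scale[OF Vector_Spaces.linear.axioms(3)])

instantiation complex :: complex_star_algebra
begin

definition scaleC_complex :: "complex \<Rightarrow> complex \<Rightarrow> complex" where "scaleC_complex c x = c * x"
definition adj_complex :: "complex \<Rightarrow> complex" where "adj_complex = cnj"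

instance
  by standard (auto simp: scaleC_complex_def adj_complex_def algebra_simps)

end

instantiation poly_mapping :: (type, complex_vector) complex_vector
begin

lift_definition scaleC_poly_mapping :: "complex \<Rightarrow> ('a \<Rightarrow>\<^sub>0 'b) \<Rightarrow> ('a \<Rightarrow>\<^sub>0 'b)"
  is "\<lambda>c f k. c *\<^sub>C f k"
  by (rule finite_subset[rotated]) auto

instance
  by standard (transfer, simp add: fun_eq_iff scaleC_add_right scaleC_add_left scaleC_scaleC scaleC_one)+

end

definition mult_span :: "'a::complex_algebra set \<Rightarrow> 'a set \<Rightarrow> 'a set"
  where "mult_span V W = cspan {v * w |v w. v \<in> V \<and> w \<in> W}"

definition left_nondegenerate :: "'a::complex_algebra set \<Rightarrow> bool"
  where "left_nondegenerate B \<longleftrightarrow> (\<forall>b\<in>B. (\<forall>x\<in>B. b * x = 0) \<longrightarrow> b = 0)"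

definition right_nondegenerate :: "'a::complex_algebra set \<Rightarrow> bool"
  where "right_nondegenerate B \<longleftrightarrow> (\<forall>b\<in>B. (\<forall>x\<in>B. x * b = 0) \<longrightarrow> b = 0)"

definition idempotent_algebra :: "'a::complex_algebra set \<Rightarrow> bool"
  where "idempotent_algebra B \<longleftrightarrow> mult_span B B = B"


section \<open>The algebraic tensor product\<close>

definition tensor_relations :: "('a::complex_vector \<times> 'b::complex_vector \<Rightarrow>\<^sub>0 complex) set" where
  "tensor_relations = cspan
     ({Poly_Mapping.single (a + a', b) 1 - Poly_Mapping.single (a, b) 1
         - Poly_Mapping.single (a', b) 1 |a a' b. True}
    \<union> {Poly_Mapping.single (a, b + b') 1 - Poly_Mapping.single (a, b) 1
         - Poly_Mapping.single (a, b') 1 |a b b'. True}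
    \<union> {Poly_Mapping.single (c *\<^sub>C a, b) 1 - c *\<^sub>C Poly_Mapping.single (a, b) 1 |c a b. True}
    \<union> {Poly_Mapping.single (a, c *\<^sub>C b) 1 - c *\<^sub>C Poly_Mapping.single (a, b) 1 |c a b. True})"

lemma csubspace_tensor_relations: "csubspace tensor_relations"
  unfolding tensor_relations_def by (rule cvec.subspace_span)

lemmas tensor_relations_add = cvec.subspace_add[OF csubspace_tensor_relations]
  and tensor_relations_diff = cvec.subspace_diff[OF csubspace_tensor_relations]
  and tensor_relations_neg = cvec.subspace_neg[OF csubspace_tensor_relations]
  and tensor_relations_scale = cvec.subspace_scale[OF csubspace_tensor_relations]

lemma tensor_relations_refl: "x = y \<Longrightarrow> x - y \<in> tensor_relations"
  using cvec.subspace_0[OF csubspace_tensor_relations] by simp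

quotient_type (overloaded) ('a, 'b) tensor =
  "('a::complex_vector \<times> 'b::complex_vector) \<Rightarrow>\<^sub>0 complex"
  / "\<lambda>x y. x - y \<in> tensor_relations"
proof (rule equivpI)
  show "reflp (\<lambda>x y. x - y \<in> (tensor_relations :: ('a \<times> 'b \<Rightarrow>\<^sub>0 complex) set))"
    unfolding reflp_def by (intro allI tensor_relations_refl refl)
  show "symp (\<lambda>x y. x - y \<in> (tensor_relations :: ('a \<times> 'b \<Rightarrow>\<^sub>0 complex) set))"
    using tensor_relations_neg by (fastforce simp: symp_def)
  show "transp (\<lambda>x y. x - y \<in> (tensor_relations :: ('a \<times> 'b \<Rightarrow>\<^sub>0 complex) set))"
  proof (rule transpI)
    fix x y z :: "'a \<times> 'b \<Rightarrow>\<^sub>0 complex"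
    assume "x - y \<in> tensor_relations" "y - z \<in> tensor_relations"
    then have "(x - y) + (y - z) \<in> tensor_relations" by (rule tensor_relations_add)
    then show "x - z \<in> tensor_relations" by simp
  qed
qed

lift_definition tensor :: "'a::complex_vector \<Rightarrow> 'b::complex_vector \<Rightarrow> ('a, 'b) tensor"
  (infixr \<open>\<otimes>\<close> 72) is "\<lambda>a b. Poly_Mapping.single (a, b) 1" .

instantiation tensor :: (complex_vector, complex_vector) complex_vector
begin

lift_definition zero_tensor :: "('a, 'b) tensor" is 0 .

lift_definition plus_tensor :: "('a, 'b) tensor \<Rightarrow> ('a, 'b) tensor \<Rightarrow> ('a, 'b) tensor" is plus
  by (simp add: add_diff_add tensor_relations_add)

lift_definition uminus_tensor :: "('a, 'b) tensor \<Rightarrow> ('a, 'b) tensor" is uminus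
proof -
  fix x x' :: "'a \<times> 'b \<Rightarrow>\<^sub>0 complex"
  assume "x - x' \<in> tensor_relations"
  then have "- (x - x') \<in> tensor_relations" by (rule tensor_relations_neg)
  then show "- x - - x' \<in> tensor_relations" by simp
qed

lift_definition minus_tensor :: "('a, 'b) tensor \<Rightarrow> ('a, 'b) tensor \<Rightarrow> ('a, 'b) tensor" is minus
proof -
  fix x x' y y' :: "'a \<times> 'b \<Rightarrow>\<^sub>0 complex"
  assume "x - x' \<in> tensor_relations" "y - y' \<in> tensor_relations"
  moreover have "(x - y) - (x' - y') = (x - x') - (y - y')" by simp
  ultimately show "(x - y) - (x' - y') \<in> tensor_relations"
    by (metis tensor_relations_diff)
qed

lift_definition scaleC_tensor :: "complex \<Rightarrow> ('a, 'b) tensor \<Rightarrow> ('a, 'b) tensor" is scaleC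
  by (simp add: tensor_relations_scale flip: cvec.scale_right_diff_distrib)

instance
proof
  fix a b c :: "('a, 'b) tensor" and s t :: complex
  show "a + b + c = a + (b + c)" by transfer (rule tensor_relations_refl, rule add.assoc)
  show "a + b = b + a" by transfer (rule tensor_relations_refl, rule add.commute)
  show "0 + a = a" by transfer (rule tensor_relations_refl, rule add_0)
  show "- a + a = 0" by transfer (rule tensor_relations_refl, rule left_minus)
  show "a - b = a + - b" by transfer (rule tensor_relations_refl, rule diff_conv_add_uminus)
  show "s *\<^sub>C (a + b) = s *\<^sub>C a + s *\<^sub>C b" by transfer (rule tensor_relations_refl, rule scaleC_add_right)
  show "(s + t) *\<^sub>C a = s *\<^sub>C a + t *\<^sub>C a" by transfer (rule tensor_relations_refl, rule scaleC_add_left)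
  show "s *\<^sub>C t *\<^sub>C a = (s * t) *\<^sub>C a" by transfer (rule tensor_relations_refl, rule scaleC_scaleC)
  show "1 *\<^sub>C a = a" by transfer (rule tensor_relations_refl, rule scaleC_one)
qed

end

lemma tensor_add_left: "(a + a') \<otimes> b = a \<otimes> b + a' \<otimes> b"
proof transfer
  fix a a' :: 'a and b :: 'b
  have "Poly_Mapping.single (a + a', b) 1 - Poly_Mapping.single (a, b) 1 - Poly_Mapping.single (a', b) 1
      \<in> (tensor_relations :: ('a \<times> 'b \<Rightarrow>\<^sub>0 complex) set)"
    unfolding tensor_relations_def by (rule cvec.span_base) blast
  then show "Poly_Mapping.single (a + a', b) 1 - (Poly_Mapping.single (a, b) 1 + Poly_Mapping.single (a', b) 1)
      \<in> (tensor_relations :: ('a \<times> 'b \<Rightarrow>\<^sub>0 complex) set)"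
    by (simp only: diff_diff_eq)
qed

lemma tensor_add_right: "a \<otimes> (b + b') = a \<otimes> b + a \<otimes> b'"
proof transfer
  fix a :: 'a and b b' :: 'b
  have "Poly_Mapping.single (a, b + b') 1 - Poly_Mapping.single (a, b) 1 - Poly_Mapping.single (a, b') 1
      \<in> (tensor_relations :: ('a \<times> 'b \<Rightarrow>\<^sub>0 complex) set)"
    unfolding tensor_relations_def by (rule cvec.span_base) blast
  then show "Poly_Mapping.single (a, b + b') 1 - (Poly_Mapping.single (a, b) 1 + Poly_Mapping.single (a, b') 1)
      \<in> (tensor_relations :: ('a \<times> 'b \<Rightarrow>\<^sub>0 complex) set)"
    by (simp only: diff_diff_eq)
qed

lemma tensor_scaleC_left: "(c *\<^sub>C a) \<otimes> b = c *\<^sub>C (a \<otimes> b)"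
  by transfer (unfold tensor_relations_def, rule cvec.span_base, blast)

lemma tensor_scaleC_right: "a \<otimes> (c *\<^sub>C b) = c *\<^sub>C (a \<otimes> b)"
  by transfer (unfold tensor_relations_def, rule cvec.span_base, blast)

lemma tensor_induct [case_names zero tensor add]:
  assumes "P 0" and pure: "\<And>a b. P (a \<otimes> b)" and "\<And>x y. P x \<Longrightarrow> P y \<Longrightarrow> P (x + y)"
  shows "P x"
proof -
  have scaled: "P (abs_tensor (Poly_Mapping.single k c))" for k :: "'a \<times> 'b" and c
  proof -
    have "abs_tensor (Poly_Mapping.single k c) = abs_tensor (c *\<^sub>C Poly_Mapping.single (fst k, snd k) 1)"
      by (rule arg_cong[where f = abs_tensor])
        (rule poly_mapping_eqI, simp add: scaleC_poly_mapping.rep_eq lookup_single when_def scaleC_complex_def)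
    also have "\<dots> = (c *\<^sub>C fst k) \<otimes> snd k"
      by (simp only: scaleC_tensor.abs_eq[symmetric] tensor.abs_eq[symmetric] tensor_scaleC_left)
    finally show ?thesis by (simp only: pure)
  qed
  have sums: "P (abs_tensor f)" for f
  proof (induction f rule: update_induct)
    case const
    show ?case using assms(1) by (simp only: zero_tensor.abs_eq)
  next
    case (update f k v)
    then have "Poly_Mapping.update k v f = f + Poly_Mapping.single k v"
      by (intro poly_mapping_eqI) (auto simp: lookup_update lookup_add lookup_single when_def in_keys_iff)
    then show ?case using assms(3)[OF update.IH scaled[of k v]] by (simp only: plus_tensor.abs_eq)
  qed
  obtain f where "x = abs_tensor f"
    using Quotient_abs_rep[OF Quotient_tensor, of x] by metis
  then show ?thesis by (simp only: sums)
qed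

definition balanced :: "('a::complex_vector \<Rightarrow> 'b::complex_vector \<Rightarrow> 'c::ab_group_add) \<Rightarrow> bool" where
  "balanced f \<longleftrightarrow> (\<forall>a a' b. f (a + a') b = f a b + f a' b) \<and> (\<forall>a b b'. f a (b + b') = f a b + f a b')
     \<and> (\<forall>c a b. f (c *\<^sub>C a) b = f a (c *\<^sub>C b))"

text \<open>The additive map on the tensor product induced by a balanced biadditive map; it is linear or
  conjugate-linear whenever the given map is. Stating the universal property for balanced maps lets
  it also provide the involution of a tensor product.\<close>

definition tensor_lift ::
  "('a::complex_vector \<Rightarrow> 'b::complex_vector \<Rightarrow> 'c::ab_group_add) \<Rightarrow> ('a, 'b) tensor \<Rightarrow> 'c" where
  "tensor_lift f = (THE g. Modules.additive g \<and> (\<forall>a b. g (a \<otimes> b) = f a b))"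

lemma tensor_lift_ex1:
  fixes f :: "'a::complex_vector \<Rightarrow> 'b::complex_vector \<Rightarrow> 'c::ab_group_add"
  assumes "balanced f"
  shows "\<exists>!g. Modules.additive g \<and> (\<forall>a b. g (a \<otimes> b) = f a b)"
proof (rule ex_ex1I)
  have fl: "f (a + a') b = f a b + f a' b" and fr: "f a (b + b') = f a b + f a b'"
    and fs: "f (c *\<^sub>C a) b = f a (c *\<^sub>C b)" for a a' b b' c
    using assms by (auto simp: balanced_def)
  interpret fl: Modules.additive "\<lambda>a. f a b" for b by unfold_locales (rule fl)
  interpret fr: Modules.additive "f a" for a by unfold_locales (rule fr)
  define h where "h c k = f (c *\<^sub>C fst k) (snd k)" for c k
  have h_zero: "h 0 k = 0" for k by (simp add: h_def fl.zero)
  have h_add: "h (c + d) k = h c k + h d k" for c d k by (simp add: h_def scaleC_add_left fl)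
  define L where "L x = (\<Sum>k\<in>Poly_Mapping.keys x. h (Poly_Mapping.lookup x k) k)"
    for x :: "'a \<times> 'b \<Rightarrow>\<^sub>0 complex"
  have L_sup: "L x = (\<Sum>k\<in>S. h (Poly_Mapping.lookup x k) k)"
    if "finite S" "Poly_Mapping.keys x \<subseteq> S" for x S
    unfolding L_def by (rule sum.mono_neutral_left) (use that h_zero in \<open>auto simp: in_keys_iff\<close>)
  have L_add: "L (x + y) = L x + L y" for x y
  proof -
    define S where "S = Poly_Mapping.keys x \<union> Poly_Mapping.keys y"
    have "finite S" "Poly_Mapping.keys x \<subseteq> S" "Poly_Mapping.keys y \<subseteq> S" "Poly_Mapping.keys (x + y) \<subseteq> S"
      using Poly_Mapping.keys_add[of x y] by (auto simp: S_def)
    then show ?thesis by (simp add: L_sup lookup_add h_add sum.distrib)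
  qed
  interpret L: Modules.additive L by unfold_locales (rule L_add)
  have L_single: "L (Poly_Mapping.single k c) = h c k" for k c
    by (simp add: L_sup[of "{k}"])
  have single_scale: "d *\<^sub>C Poly_Mapping.single k c = Poly_Mapping.single k (d * c)" for d c :: complex and k :: "'a \<times> 'b"
    by (rule poly_mapping_eqI) (simp add: scaleC_poly_mapping.rep_eq lookup_single when_def scaleC_complex_def)
  have L_rel: "L r = 0" if "r \<in> tensor_relations" for r
    using that unfolding tensor_relations_def
  proof (induction rule: cvec.span_induct_alt)
    case base
    show ?case by (rule L.zero)
  next
    case (step c x y)
    then have "L (c *\<^sub>C x) = 0"
      by (auto simp: cvec.scale_right_diff_distrib single_scale L.diff L_single h_def
          scaleC_add_right scaleC_scaleC fl fr fs mult.commute)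
    with step show ?case by (simp add: L_add)
  qed
  define g where "g x = L (rep_tensor x)" for x
  have g_abs: "g (abs_tensor x) = L x" for x
    using L_rel[OF Quotient_rep_abs[OF Quotient_tensor tensor_relations_refl[OF refl]], of x]
    by (simp add: g_def L.diff)
  have "Modules.additive g"
  proof
    fix x y :: "('a, 'b) tensor"
    obtain x' y' where "x = abs_tensor x'" "y = abs_tensor y'"
      by (metis Quotient_abs_rep[OF Quotient_tensor])
    then show "g (x + y) = g x + g y"
      by (simp add: plus_tensor.abs_eq g_abs L_add)
  qed
  moreover have "g (a \<otimes> b) = f a b" for a b
    by (simp add: tensor.abs_eq g_abs L_single h_def scaleC_one)
  ultimately show "\<exists>g. Modules.additive g \<and> (\<forall>a b. g (a \<otimes> b) = f a b)" by blast
next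
  fix g g' :: "('a, 'b) tensor \<Rightarrow> 'c"
  assume *: "Modules.additive g \<and> (\<forall>a b. g (a \<otimes> b) = f a b)"
    "Modules.additive g' \<and> (\<forall>a b. g' (a \<otimes> b) = f a b)"
  show "g = g'"
  proof
    fix x show "g x = g' x"
      by (induction x rule: tensor_induct)
        (use * in \<open>auto simp: Modules.additive.zero Modules.additive.add\<close>)
  qed
qed

lemma tensor_lift_add:
  assumes "balanced f" shows "tensor_lift f (x + y) = tensor_lift f x + tensor_lift f y"
  using theI'[OF tensor_lift_ex1[OF assms]] unfolding tensor_lift_def by (simp add: Modules.additive.add)

lemma tensor_lift_tensor [simp]:
  assumes "balanced f" shows "tensor_lift f (a \<otimes> b) = f a b"
  using theI'[OF tensor_lift_ex1[OF assms]] unfolding tensor_lift_def by simp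

lemma tensor_lift_zero [simp]:
  assumes "balanced f" shows "tensor_lift f 0 = 0"
  using tensor_lift_add[OF assms, of 0 0] by simp

lemma tensor_lift_scaleC:
  fixes f :: "'a::complex_vector \<Rightarrow> 'b::complex_vector \<Rightarrow> 'c::complex_vector"
  assumes "balanced f" and "\<And>a b. f (c *\<^sub>C a) b = d *\<^sub>C f a b"
  shows "tensor_lift f (c *\<^sub>C x) = d *\<^sub>C tensor_lift f x"
  by (induction x rule: tensor_induct)
    (simp_all add: assms tensor_lift_add[OF assms(1)] scaleC_add_right flip: tensor_scaleC_left)

definition cbilinear :: "('a::complex_vector \<Rightarrow> 'b::complex_vector \<Rightarrow> 'c::complex_vector) \<Rightarrow> bool"
  where "cbilinear f \<longleftrightarrow> (\<forall>a. clinear (f a)) \<and> (\<forall>b. clinear (\<lambda>a. f a b))"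

lemma cbilinearI:
  assumes "\<And>a a' b. f (a + a') b = f a b + f a' b" "\<And>a b b'. f a (b + b') = f a b + f a b'"
    "\<And>c a b. f (c *\<^sub>C a) b = c *\<^sub>C f a b" "\<And>c a b. f a (c *\<^sub>C b) = c *\<^sub>C f a b"
  shows "cbilinear f"
  unfolding cbilinear_def by (intro conjI allI; rule clinearI; simp add: assms)

lemma cbilinear_balanced: "cbilinear f \<Longrightarrow> balanced f"
  unfolding cbilinear_def balanced_def by (simp add: clinear_add[of "\<lambda>a. f a _"] clinear_add[of "f _"]
      clinear_scaleC[of "\<lambda>a. f a _"] clinear_scaleC[of "f _"])

lemma clinear_tensor_lift:
  assumes "cbilinear f" shows "clinear (tensor_lift f)"
  using assms cbilinear_balanced[OF assms]
  by (intro clinearI tensor_lift_add tensor_lift_scaleC)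
    (auto simp: cbilinear_def clinear_scaleC[of "\<lambda>a. f a _"])

lemma tensor_clinear_ext:
  assumes "clinear f" "clinear g" "\<And>a b. f (a \<otimes> b) = g (a \<otimes> b)"
  shows "f x = g x"
proof (induction x rule: tensor_induct)
  case zero
  show ?case using assms(1,2)[THEN clinear_scaleC, of 0 0] by simp
qed (simp_all add: assms clinear_add)

lemma cbilinear_times_inner: "cbilinear (\<lambda>c d. (a * c) \<otimes> (b * d))"
  for a :: "'a::complex_algebra" and b :: "'b::complex_algebra"
  by (rule cbilinearI) (simp_all add: distrib_left tensor_add_left tensor_add_right
      tensor_scaleC_left tensor_scaleC_right)

lemma cbilinear_times_outer: "cbilinear (\<lambda>a b. tensor_lift (\<lambda>c d. (a * c) \<otimes> (b * d)) y)"
  for y :: "('a::complex_algebra, 'b::complex_algebra) tensor"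
proof -
  define M where "M a b = tensor_lift (\<lambda>c d. (a * c) \<otimes> (b * d))" for a :: 'a and b :: 'b
  have M: "M a b 0 = 0" "M a b (y + z) = M a b y + M a b z" "M a b (c \<otimes> d) = (a * c) \<otimes> (b * d)" for a b y z c d
    by (simp_all add: M_def tensor_lift_add cbilinear_balanced[OF cbilinear_times_inner])
  have "M (a + a') b y = M a b y + M a' b y" for a a' b
    by (induction y rule: tensor_induct) (simp_all add: M distrib_right tensor_add_left)
  moreover have "M a (b + b') y = M a b y + M a b' y" for a b b'
    by (induction y rule: tensor_induct) (simp_all add: M distrib_right tensor_add_right)
  moreover have "M (c *\<^sub>C a) b y = c *\<^sub>C M a b y" for a b c
    by (induction y rule: tensor_induct) (simp_all add: M scaleC_add_right tensor_scaleC_left)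
  moreover have "M a (c *\<^sub>C b) y = c *\<^sub>C M a b y" for a b c
    by (induction y rule: tensor_induct) (simp_all add: M scaleC_add_right tensor_scaleC_right)
  ultimately show ?thesis
    by (intro cbilinearI) (simp_all add: M_def)
qed

instantiation tensor :: (complex_algebra, complex_algebra) complex_algebra
begin

definition times_tensor :: "('a, 'b) tensor \<Rightarrow> ('a, 'b) tensor \<Rightarrow> ('a, 'b) tensor" where
  "x * y = tensor_lift (\<lambda>a b. tensor_lift (\<lambda>c d. (a * c) \<otimes> (b * d)) y) x"

instance proof -
  have inner: "tensor_lift (\<lambda>c d. (a * c) \<otimes> (b * d)) (y + z)
      = tensor_lift (\<lambda>c d. (a * c) \<otimes> (b * d)) y + tensor_lift (\<lambda>c d. (a * c) \<otimes> (b * d)) z"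
    for a :: 'a and b :: 'b and y z
    by (rule tensor_lift_add[OF cbilinear_balanced[OF cbilinear_times_inner]])
  have pure_left: "(a \<otimes> b) * y = tensor_lift (\<lambda>c d. (a * c) \<otimes> (b * d)) y" for a :: 'a and b :: 'b and y
    unfolding times_tensor_def by (rule tensor_lift_tensor[OF cbilinear_balanced[OF cbilinear_times_outer]])
  have pure: "(a \<otimes> b) * (c \<otimes> d) = (a * c) \<otimes> (b * d)" for a c :: 'a and b d :: 'b
    unfolding pure_left by (rule tensor_lift_tensor[OF cbilinear_balanced[OF cbilinear_times_inner]])
  have add_left: "(x + y) * z = x * z + y * z" for x y z :: "('a, 'b) tensor"
    unfolding times_tensor_def by (rule tensor_lift_add[OF cbilinear_balanced[OF cbilinear_times_outer]])
  have zero_left: "0 * x = 0" for x :: "('a, 'b) tensor"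
    using add_left[of 0 0 x] by simp
  have add_right: "x * (y + z) = x * y + x * z" for x y z :: "('a, 'b) tensor"
    by (induction x rule: tensor_induct) (simp_all add: zero_left pure_left inner add_left)
  have zero: "0 * x = 0" "x * 0 = 0" for x :: "('a, 'b) tensor"
    using zero_left add_right[of x 0 0] by simp_all
  have pure2: "(a \<otimes> b) * ((c \<otimes> d) * z) = ((a \<otimes> b) * (c \<otimes> d)) * z" for a c b d and z :: "('a, 'b) tensor"
    by (induction z rule: tensor_induct) (simp_all add: pure add_right zero mult.assoc)
  have pure1: "(a \<otimes> b) * (y * z) = ((a \<otimes> b) * y) * z" for a b and y z :: "('a, 'b) tensor"
    by (induction y rule: tensor_induct) (simp_all add: pure2 add_right add_left zero)
  have assoc: "(x * y) * z = x * (y * z)" for x y z :: "('a, 'b) tensor"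
    by (induction x rule: tensor_induct) (simp_all add: pure1 add_left zero)
  have scale_left: "(c *\<^sub>C x) * y = c *\<^sub>C (x * y)" for c and x y :: "('a, 'b) tensor"
    unfolding times_tensor_def by (rule clinear_scaleC[OF clinear_tensor_lift[OF cbilinear_times_outer]])
  have scale_pure: "(a \<otimes> b) * (c *\<^sub>C y) = c *\<^sub>C ((a \<otimes> b) * y)" for a b c and y :: "('a, 'b) tensor"
    by (induction y rule: tensor_induct)
      (simp_all add: add_right scaleC_add_right zero pure flip: tensor_scaleC_left)
  have scale_right: "x * (c *\<^sub>C y) = c *\<^sub>C (x * y)" for c and x y :: "('a, 'b) tensor"
    by (induction x rule: tensor_induct) (simp_all add: scale_pure add_left scaleC_add_right zero)
  show "OFCLASS(('a, 'b) tensor, complex_algebra_class)"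
    by standard (simp_all add: add_left add_right assoc scale_left scale_right)
qed

end

lemma tensor_lift_clinear_simps:
  assumes "cbilinear f"
  shows "tensor_lift f (x + y) = tensor_lift f x + tensor_lift f y"
    "tensor_lift f (c *\<^sub>C x) = c *\<^sub>C tensor_lift f x" "tensor_lift f (a \<otimes> b) = f a b" "tensor_lift f 0 = 0"
  using clinear_tensor_lift[OF assms] cbilinear_balanced[OF assms]
  by (simp_all add: clinear_add clinear_scaleC)

lemma tensor_mult: "(a \<otimes> b) * (c \<otimes> d) = (a * c) \<otimes> (b * d)"
  unfolding times_tensor_def tensor_lift_tensor[OF cbilinear_balanced[OF cbilinear_times_outer]]
  by (rule tensor_lift_tensor[OF cbilinear_balanced[OF cbilinear_times_inner]])

instantiation tensor :: (complex_star_algebra, complex_star_algebra) complex_star_algebra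
begin

definition adj_tensor :: "('a, 'b) tensor \<Rightarrow> ('a, 'b) tensor" where
  "adj x = tensor_lift (\<lambda>a b. adj a \<otimes> adj b) x"

instance proof -
  have bal: "balanced (\<lambda>(a::'a) (b::'b). adj a \<otimes> adj b)"
    by (simp add: balanced_def adj_add adj_scaleC tensor_add_left tensor_add_right
        tensor_scaleC_left tensor_scaleC_right)
  have add: "adj (x + y) = adj x + adj y" and zero: "adj 0 = (0 :: ('a, 'b) tensor)"
    and pure: "adj (a \<otimes> b) = adj a \<otimes> adj b" for x y :: "('a, 'b) tensor" and a b
    by (simp_all add: adj_tensor_def tensor_lift_add bal)
  have scale: "adj (c *\<^sub>C x) = cnj c *\<^sub>C adj x" for c and x :: "('a, 'b) tensor"
    unfolding adj_tensor_def using bal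
    by (rule tensor_lift_scaleC) (simp add: adj_scaleC tensor_scaleC_left)
  have invol: "adj (adj x) = x" for x :: "('a, 'b) tensor"
    by (induction x rule: tensor_induct) (simp_all add: add zero pure)
  have mult1: "adj ((a \<otimes> b) * y) = adj y * adj (a \<otimes> b)" for a b and y :: "('a, 'b) tensor"
    by (induction y rule: tensor_induct) (simp_all add: add zero pure tensor_mult adj_mult distrib_left distrib_right)
  have mult: "adj (x * y) = adj y * adj x" for x y :: "('a, 'b) tensor"
    by (induction x rule: tensor_induct) (simp_all add: add zero mult1 distrib_left distrib_right)
  show "OFCLASS(('a, 'b) tensor, complex_star_algebra_class)"
    by standard (simp_all add: add scale invol mult)
qed

end


section \<open>Multipliers\<close>

typedef (overloaded) 'a multiplier =
  "{(l :: 'a::complex_algebra \<Rightarrow> 'a, r :: 'a \<Rightarrow> 'a). clinear l \<and> clinear r \<and> (\<forall>a b. a * l b = r a * b)}"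
  by (rule exI[of _ "(\<lambda>_. 0, \<lambda>_. 0)"]) (simp add: clinearI)

setup_lifting type_definition_multiplier

lift_definition lact :: "'a::complex_algebra multiplier \<Rightarrow> 'a \<Rightarrow> 'a" (infixr \<open>\<rhd>\<close> 71) is fst .

lift_definition ract :: "'a::complex_algebra \<Rightarrow> 'a multiplier \<Rightarrow> 'a" (infixl \<open>\<lhd>\<close> 71) is "\<lambda>a m. snd m a" .

lemma clinear_lact: "clinear (lact m)"
  by transfer auto

lemma clinear_ract: "clinear (\<lambda>a. a \<lhd> m)"
  by transfer auto

lemma multiplier_compatible: "a * (m \<rhd> b) = (a \<lhd> m) * b"
  by transfer auto

lemma multiplier_eqI: "(\<And>a. m \<rhd> a = n \<rhd> a) \<Longrightarrow> (\<And>a. a \<lhd> m = a \<lhd> n) \<Longrightarrow> m = n"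
  by transfer auto

lemmas act_simps = clinear_add[OF clinear_lact] clinear_add[OF clinear_ract]
  clinear_scaleC[OF clinear_lact] clinear_scaleC[OF clinear_ract]

definition make_multiplier :: "('a::complex_algebra \<Rightarrow> 'a) \<Rightarrow> ('a \<Rightarrow> 'a) \<Rightarrow> 'a multiplier"
  where "make_multiplier l r = Abs_multiplier (l, r)"

lemma make_multiplier_act:
  assumes "clinear l" "clinear r" "\<And>a b. a * l b = r a * b"
  shows "make_multiplier l r \<rhd> a = l a" "a \<lhd> make_multiplier l r = r a"
  using assms by (simp_all add: make_multiplier_def lact.rep_eq ract.rep_eq Abs_multiplier_inverse)

instantiation multiplier :: (complex_algebra) "{complex_algebra, monoid_mult}"
begin

definition zero_multiplier :: "'a multiplier" where
  "0 = make_multiplier (\<lambda>_. 0) (\<lambda>_. 0)"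
definition one_multiplier :: "'a multiplier" where
  "1 = make_multiplier (\<lambda>a. a) (\<lambda>a. a)"
definition plus_multiplier :: "'a multiplier \<Rightarrow> 'a multiplier \<Rightarrow> 'a multiplier" where
  "m + n = make_multiplier (\<lambda>a. m \<rhd> a + n \<rhd> a) (\<lambda>a. a \<lhd> m + a \<lhd> n)"
definition uminus_multiplier :: "'a multiplier \<Rightarrow> 'a multiplier" where
  "- m = make_multiplier (\<lambda>a. - (m \<rhd> a)) (\<lambda>a. - (a \<lhd> m))"
definition minus_multiplier :: "'a multiplier \<Rightarrow> 'a multiplier \<Rightarrow> 'a multiplier" where
  "m - n = make_multiplier (\<lambda>a. m \<rhd> a - n \<rhd> a) (\<lambda>a. a \<lhd> m - a \<lhd> n)"
definition scaleC_multiplier :: "complex \<Rightarrow> 'a multiplier \<Rightarrow> 'a multiplier" where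
  "c *\<^sub>C m = make_multiplier (\<lambda>a. c *\<^sub>C (m \<rhd> a)) (\<lambda>a. c *\<^sub>C (a \<lhd> m))"
definition times_multiplier :: "'a multiplier \<Rightarrow> 'a multiplier \<Rightarrow> 'a multiplier" where
  "m * n = make_multiplier (\<lambda>a. m \<rhd> (n \<rhd> a)) (\<lambda>a. a \<lhd> m \<lhd> n)"

lemma zero_act: "0 \<rhd> a = 0" "a \<lhd> 0 = 0" for a :: 'a
  unfolding zero_multiplier_def by (subst make_multiplier_act; simp add: clinearI)+

lemma one_act: "1 \<rhd> a = a" "a \<lhd> 1 = a" for a :: 'a
  unfolding one_multiplier_def by (subst make_multiplier_act; simp add: clinearI)+

lemma plus_act: "(m + n) \<rhd> a = m \<rhd> a + n \<rhd> a" "a \<lhd> (m + n) = a \<lhd> m + a \<lhd> n" for a :: 'a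
  unfolding plus_multiplier_def
  by (subst make_multiplier_act; auto intro!: clinearI
      simp: act_simps distrib_left distrib_right multiplier_compatible scaleC_add_right)+

lemma uminus_act: "(- m) \<rhd> a = - (m \<rhd> a)" "a \<lhd> (- m) = - (a \<lhd> m)" for a :: 'a
  unfolding uminus_multiplier_def
  by (subst make_multiplier_act; auto intro!: clinearI simp: act_simps multiplier_compatible)+

lemma minus_act: "(m - n) \<rhd> a = m \<rhd> a - n \<rhd> a" "a \<lhd> (m - n) = a \<lhd> m - a \<lhd> n" for a :: 'a
  unfolding minus_multiplier_def
  by (subst make_multiplier_act; auto intro!: clinearI
      simp: act_simps right_diff_distrib left_diff_distrib multiplier_compatible cvec.scale_right_diff_distrib)+

lemma scaleC_act: "(c *\<^sub>C m) \<rhd> a = c *\<^sub>C (m \<rhd> a)" "a \<lhd> (c *\<^sub>C m) = c *\<^sub>C (a \<lhd> m)" for a :: 'a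
  unfolding scaleC_multiplier_def
  by (subst make_multiplier_act; auto intro!: clinearI
      simp: act_simps multiplier_compatible scaleC_add_right mult.commute)+

lemma times_act: "(m * n) \<rhd> a = m \<rhd> (n \<rhd> a)" "a \<lhd> (m * n) = a \<lhd> m \<lhd> n" for a :: 'a
  unfolding times_multiplier_def
  by (subst make_multiplier_act; auto intro!: clinearI simp: act_simps multiplier_compatible)+

instance
  by standard (rule multiplier_eqI; simp add: zero_act one_act plus_act uminus_act minus_act
      scaleC_act times_act act_simps scaleC_add_right scaleC_add_left ac_simps)+

end

lemmas multiplier_act [simp] = zero_act one_act plus_act uminus_act minus_act scaleC_act times_act

instantiation multiplier :: (complex_star_algebra) complex_star_algebra
begin

definition adj_multiplier :: "'a multiplier \<Rightarrow> 'a multiplier" where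
  "adj m = make_multiplier (\<lambda>a. adj (adj a \<lhd> m)) (\<lambda>a. adj (m \<rhd> adj a))"

lemma adj_act: "adj m \<rhd> a = adj (adj a \<lhd> m)" "a \<lhd> adj m = adj (m \<rhd> adj a)" for a :: 'a
proof -
  have "a * adj (adj b \<lhd> m) = adj (m \<rhd> adj a) * b" for a b :: 'a
    by (metis adj_adj adj_mult multiplier_compatible)
  then show "adj m \<rhd> a = adj (adj a \<lhd> m)" "a \<lhd> adj m = adj (m \<rhd> adj a)"
    unfolding adj_multiplier_def
    by (subst make_multiplier_act; auto intro!: clinearI simp: act_simps adj_add adj_scaleC)+
qed

instance
  by standard (rule multiplier_eqI; simp add: adj_act adj_add adj_scaleC)+

end

lemmas multiplier_adj_act [simp] = adj_act

definition mult_of :: "'a::complex_algebra \<Rightarrow> 'a multiplier" where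
  "mult_of a = make_multiplier (\<lambda>b. a * b) (\<lambda>b. b * a)"

lemma mult_of_act [simp]: "mult_of a \<rhd> b = a * b" "b \<lhd> mult_of a = b * a"
  unfolding mult_of_def
  by (subst make_multiplier_act; auto intro!: clinearI simp: distrib_left distrib_right mult.assoc)+

text \<open>The inverse of the embedding of \<open>A\<close> into \<open>M(A)\<close>, which is injective when \<open>A\<close> is
  non-degenerate.\<close>

definition elem_of :: "'a::complex_algebra multiplier \<Rightarrow> 'a" where
  "elem_of m = (THE a. mult_of a = m)"

definition tensor_map ::
  "('a::complex_vector \<Rightarrow> 'c::complex_vector) \<Rightarrow> ('b::complex_vector \<Rightarrow> 'd::complex_vector)
    \<Rightarrow> ('a, 'b) tensor \<Rightarrow> ('c, 'd) tensor" where
  "tensor_map f g = tensor_lift (\<lambda>a b. f a \<otimes> g b)"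

lemma cbilinear_tensor_map: "clinear f \<Longrightarrow> clinear g \<Longrightarrow> cbilinear (\<lambda>a b. f a \<otimes> g b)"
  by (rule cbilinearI) (simp_all add: clinear_add clinear_scaleC tensor_add_left tensor_add_right
      tensor_scaleC_left tensor_scaleC_right)

lemma clinear_tensor_map: "clinear f \<Longrightarrow> clinear g \<Longrightarrow> clinear (tensor_map f g)"
  unfolding tensor_map_def by (rule clinear_tensor_lift[OF cbilinear_tensor_map])

lemma tensor_map_tensor: "clinear f \<Longrightarrow> clinear g \<Longrightarrow> tensor_map f g (a \<otimes> b) = f a \<otimes> g b"
  unfolding tensor_map_def by (rule tensor_lift_tensor[OF cbilinear_balanced[OF cbilinear_tensor_map]])

definition mult_tensor ::
  "'a::complex_algebra multiplier \<Rightarrow> 'b::complex_algebra multiplier \<Rightarrow> ('a, 'b) tensor multiplier"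
  (infixr \<open>\<otimes>\<^sub>M\<close> 72) where
  "m \<otimes>\<^sub>M n = make_multiplier (tensor_map (lact m) (lact n)) (tensor_map (\<lambda>a. a \<lhd> m) (\<lambda>b. b \<lhd> n))"

lemma mult_tensor_act:
  "(m \<otimes>\<^sub>M n) \<rhd> x = tensor_map (lact m) (lact n) x"
  "x \<lhd> (m \<otimes>\<^sub>M n) = tensor_map (\<lambda>a. a \<lhd> m) (\<lambda>b. b \<lhd> n) x"
proof -
  let ?l = "tensor_map (lact m) (lact n)" and ?r = "tensor_map (\<lambda>a. a \<lhd> m) (\<lambda>b. b \<lhd> n)"
  have l: "clinear ?l" and r: "clinear ?r"
    by (simp_all add: clinear_tensor_map clinear_lact clinear_ract)
  note simps = clinear_add[OF l] clinear_add[OF r] clinear_scaleC[OF l, of 0 0, simplified]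
    clinear_scaleC[OF r, of 0 0, simplified] tensor_map_tensor clinear_lact clinear_ract
  have pure: "(a \<otimes> b) * ?l y = ?r (a \<otimes> b) * y" for a b y
    by (induction y rule: tensor_induct)
      (simp_all add: simps tensor_mult multiplier_compatible distrib_left)
  have "x * ?l y = ?r x * y" for x y
    by (induction x rule: tensor_induct) (simp_all add: pure simps distrib_right)
  then show "(m \<otimes>\<^sub>M n) \<rhd> x = ?l x" "x \<lhd> (m \<otimes>\<^sub>M n) = ?r x"
    unfolding mult_tensor_def by (simp_all add: make_multiplier_act l r)
qed

lemma mult_tensor_act_tensor [simp]:
  "(m \<otimes>\<^sub>M n) \<rhd> (a \<otimes> b) = (m \<rhd> a) \<otimes> (n \<rhd> b)"
  "(a \<otimes> b) \<lhd> (m \<otimes>\<^sub>M n) = (a \<lhd> m) \<otimes> (b \<lhd> n)"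
  by (simp_all add: mult_tensor_act tensor_map_tensor clinear_lact clinear_ract)

text \<open>Transport of multipliers along an algebra isomorphism \<open>f\<close> with inverse \<open>g\<close>.\<close>

definition mult_transport ::
  "('a::complex_algebra \<Rightarrow> 'b::complex_algebra) \<Rightarrow> ('b \<Rightarrow> 'a) \<Rightarrow> 'a multiplier \<Rightarrow> 'b multiplier" where
  "mult_transport f g m = make_multiplier (\<lambda>b. f (m \<rhd> g b)) (\<lambda>b. f (g b \<lhd> m))"

lemma mult_transport_act:
  assumes "clinear f" "clinear g" "\<And>x. g (f x) = x" "\<And>y. f (g y) = y" "\<And>x y. f (x * y) = f x * f y"
  shows "mult_transport f g m \<rhd> b = f (m \<rhd> g b)" "b \<lhd> mult_transport f g m = f (g b \<lhd> m)"
proof -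
  have "a * f (m \<rhd> g b) = f (g a \<lhd> m) * b" for a b
    by (metis assms(4,5) multiplier_compatible)
  then show "mult_transport f g m \<rhd> b = f (m \<rhd> g b)" "b \<lhd> mult_transport f g m = f (g b \<lhd> m)"
    unfolding mult_transport_def using assms(1,2)
    by (subst make_multiplier_act; auto intro!: clinearI simp: act_simps clinear_add clinear_scaleC)+
qed

definition tensor_flip :: "('a::complex_vector, 'b::complex_vector) tensor \<Rightarrow> ('b, 'a) tensor" where
  "tensor_flip = tensor_lift (\<lambda>a b. b \<otimes> a)"

definition tensor_assoc ::
  "(('a::complex_vector, 'b::complex_vector) tensor, 'c::complex_vector) tensor \<Rightarrow> ('a, ('b, 'c) tensor) tensor" where
  "tensor_assoc = tensor_lift (\<lambda>x c. tensor_lift (\<lambda>a b. a \<otimes> (b \<otimes> c)) x)"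

definition tensor_unassoc ::
  "('a::complex_vector, ('b::complex_vector, 'c::complex_vector) tensor) tensor \<Rightarrow> (('a, 'b) tensor, 'c) tensor" where
  "tensor_unassoc = tensor_lift (\<lambda>a y. tensor_lift (\<lambda>b c. (a \<otimes> b) \<otimes> c) y)"

lemma tensor_flip_simps:
  "tensor_flip (x + y) = tensor_flip x + tensor_flip y" "tensor_flip (c *\<^sub>C x) = c *\<^sub>C tensor_flip x"
  "tensor_flip (a \<otimes> b) = b \<otimes> a" "tensor_flip 0 = 0"
proof -
  have "cbilinear (\<lambda>a b. b \<otimes> a)"
    by (rule cbilinearI) (simp_all add: tensor_add_left tensor_add_right tensor_scaleC_left tensor_scaleC_right)
  from tensor_lift_clinear_simps[OF this] show
    "tensor_flip (x + y) = tensor_flip x + tensor_flip y" "tensor_flip (c *\<^sub>C x) = c *\<^sub>C tensor_flip x"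
    "tensor_flip (a \<otimes> b) = b \<otimes> a" "tensor_flip 0 = 0"
    unfolding tensor_flip_def by blast+
qed

lemma tensor_assoc_aux:
  defines "M \<equiv> \<lambda>c. tensor_lift (\<lambda>a b. a \<otimes> (b \<otimes> c))"
  shows "M c (x + y) = M c x + M c y" "M c (d *\<^sub>C x) = d *\<^sub>C M c x" "M c (a \<otimes> b) = a \<otimes> (b \<otimes> c)" "M c 0 = 0"
    "cbilinear (\<lambda>x c. M c x)"
proof -
  have "cbilinear (\<lambda>a b. a \<otimes> (b \<otimes> c))" for c :: 'a
    by (rule cbilinearI) (simp_all add: tensor_add_left tensor_add_right tensor_scaleC_left tensor_scaleC_right)
  from tensor_lift_clinear_simps[OF this]
  show M: "M c (x + y) = M c x + M c y" "M c (d *\<^sub>C x) = d *\<^sub>C M c x" "M c (a \<otimes> b) = a \<otimes> (b \<otimes> c)" "M c 0 = 0"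
    for x y d a b c unfolding M_def by blast+
  have "M (c + c') x = M c x + M c' x" for c c' x
    by (induction x rule: tensor_induct) (simp_all add: M tensor_add_right)
  moreover have "M (d *\<^sub>C c) x = d *\<^sub>C M c x" for d c x
    by (induction x rule: tensor_induct) (simp_all add: M tensor_scaleC_right scaleC_add_right)
  ultimately show "cbilinear (\<lambda>x c. M c x)" by (intro cbilinearI) (simp_all add: M)
qed

lemma tensor_assoc_simps:
  "tensor_assoc (x + y) = tensor_assoc x + tensor_assoc y" "tensor_assoc (c *\<^sub>C x) = c *\<^sub>C tensor_assoc x"
  "tensor_assoc ((a \<otimes> b) \<otimes> d) = a \<otimes> (b \<otimes> d)" "tensor_assoc 0 = 0"
  unfolding tensor_assoc_def tensor_lift_clinear_simps[OF tensor_assoc_aux(5)] tensor_assoc_aux by (rule refl)+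

lemma tensor_unassoc_aux:
  defines "M \<equiv> \<lambda>a. tensor_lift (\<lambda>b c. (a \<otimes> b) \<otimes> c)"
  shows "M a (x + y) = M a x + M a y" "M a (d *\<^sub>C x) = d *\<^sub>C M a x" "M a (b \<otimes> c) = (a \<otimes> b) \<otimes> c" "M a 0 = 0"
    "cbilinear (\<lambda>a x. M a x)"
proof -
  have "cbilinear (\<lambda>b c. (a \<otimes> b) \<otimes> c)" for a :: 'a
    by (rule cbilinearI) (simp_all add: tensor_add_left tensor_add_right tensor_scaleC_left tensor_scaleC_right)
  from tensor_lift_clinear_simps[OF this]
  show M: "M a (x + y) = M a x + M a y" "M a (d *\<^sub>C x) = d *\<^sub>C M a x" "M a (b \<otimes> c) = (a \<otimes> b) \<otimes> c" "M a 0 = 0"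
    for x y d a b c unfolding M_def by blast+
  have "M (a + a') x = M a x + M a' x" for a a' x
    by (induction x rule: tensor_induct) (simp_all add: M tensor_add_left)
  moreover have "M (d *\<^sub>C a) x = d *\<^sub>C M a x" for d a x
    by (induction x rule: tensor_induct) (simp_all add: M tensor_scaleC_left scaleC_add_right)
  ultimately show "cbilinear (\<lambda>a x. M a x)" by (intro cbilinearI) (simp_all add: M)
qed

lemma tensor_unassoc_simps:
  "tensor_unassoc (x + y) = tensor_unassoc x + tensor_unassoc y"
  "tensor_unassoc (c *\<^sub>C x) = c *\<^sub>C tensor_unassoc x"
  "tensor_unassoc (a \<otimes> (b \<otimes> d)) = (a \<otimes> b) \<otimes> d" "tensor_unassoc 0 = 0"
  unfolding tensor_unassoc_def tensor_lift_clinear_simps[OF tensor_unassoc_aux(5)] tensor_unassoc_aux by (rule refl)+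

lemma tensor_induct_left [case_names zero tensor add]:
  assumes "P 0" and pure: "\<And>a b c. P ((a \<otimes> b) \<otimes> c)" and add: "\<And>x y. P x \<Longrightarrow> P y \<Longrightarrow> P (x + y)"
  shows "P x"
proof -
  have zero: "0 \<otimes> c = 0" for c :: 'c
    using tensor_add_left[of 0 0 c] by simp
  have "P (y \<otimes> c)" for y c
    by (induction y rule: tensor_induct) (simp_all only: zero assms tensor_add_left)
  then show ?thesis by (induction x rule: tensor_induct) (simp_all only: assms)
qed

lemma tensor_induct_right [case_names zero tensor add]:
  assumes "P 0" and pure: "\<And>a b c. P (a \<otimes> (b \<otimes> c))" and add: "\<And>x y. P x \<Longrightarrow> P y \<Longrightarrow> P (x + y)"
  shows "P x"
proof -
  have zero: "a \<otimes> 0 = 0" for a :: 'a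
    using tensor_add_right[of a 0 0] by simp
  have "P (a \<otimes> y)" for y a
    by (induction y rule: tensor_induct) (simp_all only: zero assms tensor_add_right)
  then show ?thesis by (induction x rule: tensor_induct) (simp_all only: assms)
qed

lemma tensor_flip_flip: "tensor_flip (tensor_flip x) = x"
  by (induction x rule: tensor_induct) (simp_all add: tensor_flip_simps)

lemma tensor_assoc_unassoc: "tensor_assoc (tensor_unassoc x) = x"
  by (induction x rule: tensor_induct_right) (simp_all add: tensor_assoc_simps tensor_unassoc_simps)

lemma tensor_unassoc_assoc: "tensor_unassoc (tensor_assoc x) = x"
  by (induction x rule: tensor_induct_left) (simp_all add: tensor_assoc_simps tensor_unassoc_simps)

lemma tensor_flip_mult: "tensor_flip (x * y) = tensor_flip x * tensor_flip y"
proof -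
  have pure: "tensor_flip ((a \<otimes> b) * y) = (b \<otimes> a) * tensor_flip y" for a b y
    by (induction y rule: tensor_induct) (simp_all add: tensor_flip_simps tensor_mult distrib_left)
  show ?thesis
    by (induction x rule: tensor_induct) (simp_all add: tensor_flip_simps pure distrib_right)
qed

lemma tensor_unassoc_mult: "tensor_unassoc (x * y) = tensor_unassoc x * tensor_unassoc y"
proof -
  have pure: "tensor_unassoc ((a \<otimes> b \<otimes> c) * y) = ((a \<otimes> b) \<otimes> c) * tensor_unassoc y" for a b c y
    by (induction y rule: tensor_induct_right) (simp_all add: tensor_unassoc_simps tensor_mult distrib_left)
  show ?thesis
    by (induction x rule: tensor_induct_right) (simp_all add: tensor_unassoc_simps pure distrib_right)
qed

definition mult_flip :: "('a::complex_algebra, 'b::complex_algebra) tensor multiplier \<Rightarrow> ('b, 'a) tensor multiplier" where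
  "mult_flip = mult_transport tensor_flip tensor_flip"

definition mult_unassoc ::
  "('a::complex_algebra, ('b::complex_algebra, 'c::complex_algebra) tensor) tensor multiplier
    \<Rightarrow> (('a, 'b) tensor, 'c) tensor multiplier" where
  "mult_unassoc = mult_transport tensor_unassoc tensor_assoc"

lemma mult_flip_act:
  "mult_flip m \<rhd> x = tensor_flip (m \<rhd> tensor_flip x)" "x \<lhd> mult_flip m = tensor_flip (tensor_flip x \<lhd> m)"
  unfolding mult_flip_def
  by (rule mult_transport_act; simp add: clinearI tensor_flip_simps tensor_flip_flip tensor_flip_mult)+

lemma mult_unassoc_act:
  "mult_unassoc m \<rhd> x = tensor_unassoc (m \<rhd> tensor_assoc x)"
  "x \<lhd> mult_unassoc m = tensor_unassoc (tensor_assoc x \<lhd> m)"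
  unfolding mult_unassoc_def
  by (rule mult_transport_act; simp add: clinearI tensor_assoc_simps tensor_unassoc_simps
      tensor_assoc_unassoc tensor_unassoc_assoc tensor_unassoc_mult)+

text \<open>Strict convergence, and unconditional strict sums. Strict limits are unique.\<close>

definition strict_limit :: "('x \<Rightarrow> 'a::complex_algebra multiplier) \<Rightarrow> 'a multiplier \<Rightarrow> 'x filter \<Rightarrow> bool" where
  "strict_limit f m F \<longleftrightarrow> (\<forall>a. \<forall>\<^sub>F x in F. f x \<rhd> a = m \<rhd> a \<and> a \<lhd> f x = a \<lhd> m)"

definition strict_sum :: "('k \<Rightarrow> 'a::complex_algebra multiplier) \<Rightarrow> 'a multiplier" where
  "strict_sum f = (THE m. strict_limit (sum f) m (finite_subsets_at_top UNIV))"

lemma strict_limit_unique: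
  assumes "F \<noteq> bot" "strict_limit f m F" "strict_limit f n F"
  shows "m = n"
proof (rule multiplier_eqI)
  fix a
  have "\<forall>\<^sub>F x in F. f x \<rhd> a = m \<rhd> a \<and> a \<lhd> f x = a \<lhd> m"
    "\<forall>\<^sub>F x in F. f x \<rhd> a = n \<rhd> a \<and> a \<lhd> f x = a \<lhd> n"
    using assms(2,3) by (simp_all add: strict_limit_def)
  then have "\<forall>\<^sub>F x in F. m \<rhd> a = n \<rhd> a \<and> a \<lhd> m = a \<lhd> n"
    by eventually_elim metis
  then show "m \<rhd> a = n \<rhd> a" "a \<lhd> m = a \<lhd> n" using assms(1) by simp_all
qed

lemma strict_sum_eqI: "strict_limit (sum f) m (finite_subsets_at_top UNIV) \<Longrightarrow> strict_sum f = m"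
  unfolding strict_sum_def
  by (rule the_equality) (auto intro: strict_limit_unique[OF finite_subsets_at_top_neq_bot])


section \<open>Partial algebras\<close>

text \<open>A family \<open>A r s\<close> of subspaces of the type \<^typ>\<open>'a\<close> is the grading of a partial algebra.
  In \<open>partial_algebra\<close> the total algebra is the whole type; \<open>partial_total\<close>, \<open>partial_col\<close> (\<open>A \<one>(r)\<close>)
  and \<open>partial_row\<close> (\<open>\<one>(r) A\<close>) also apply to a grading of a subalgebra of the type.\<close>

definition direct_sum_decomposition :: "('k \<Rightarrow> 'a::complex_vector set) \<Rightarrow> bool" where
  "direct_sum_decomposition V \<longleftrightarrow> (\<forall>k. csubspace (V k)) \<and>
     (\<forall>a. \<exists>!x. finite {k. x k \<noteq> 0} \<and> (\<forall>k. x k \<in> V k) \<and> a = (\<Sum>k | x k \<noteq> 0. x k))"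

definition partial_algebra :: "('j \<Rightarrow> 'j \<Rightarrow> 'a::complex_algebra set) \<Rightarrow> bool" where
  "partial_algebra A \<longleftrightarrow> direct_sum_decomposition (\<lambda>(r, s). A r s) \<and>
     (\<forall>r s s' t. \<forall>a\<in>A r s. \<forall>b\<in>A s' t. if s = s' then a * b \<in> A r t else a * b = 0)"

definition partial_total :: "('j \<Rightarrow> 'j \<Rightarrow> 'a::complex_algebra set) \<Rightarrow> 'a set" where
  "partial_total A = cspan (\<Union>r s. A r s)"

definition partial_col :: "('j \<Rightarrow> 'j \<Rightarrow> 'a::complex_algebra set) \<Rightarrow> 'j \<Rightarrow> 'a set" where
  "partial_col A s = cspan (\<Union>r. A r s)"

definition partial_row :: "('j \<Rightarrow> 'j \<Rightarrow> 'a::complex_algebra set) \<Rightarrow> 'j \<Rightarrow> 'a set" where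
  "partial_row A r = cspan (\<Union>s. A r s)"

definition base_unit :: "('j \<Rightarrow> 'j \<Rightarrow> 'a::complex_algebra set) \<Rightarrow> 'j \<Rightarrow> 'a multiplier" where
  "base_unit A r = (THE m. \<forall>r' s. \<forall>a\<in>A r' s.
     m \<rhd> a = (if r = r' then a else 0) \<and> a \<lhd> m = (if r = s then a else 0))"

lemma direct_sum_induct [consumes 1, case_names zero summand add]:
  assumes "direct_sum_decomposition V" "P 0" "\<And>k a. a \<in> V k \<Longrightarrow> P a" "\<And>a b. P a \<Longrightarrow> P b \<Longrightarrow> P (a + b)"
  shows "P a"
proof -
  obtain x where x: "finite {k. x k \<noteq> 0}" "\<forall>k. x k \<in> V k" "a = (\<Sum>k | x k \<noteq> 0. x k)"
    using assms(1) unfolding direct_sum_decomposition_def by metis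
  have "P (\<Sum>k\<in>S. x k)" if "finite S" for S
    using that
  proof induction
    case (insert k S)
    then show ?case using assms(3)[OF x(2)[rule_format]] assms(4) by simp
  qed (simp add: assms(2))
  then show ?thesis using x(1,3) by simp
qed

lemma direct_sum_component:
  fixes V :: "'k \<Rightarrow> 'a::complex_vector set"
  assumes V: "direct_sum_decomposition V"
  obtains p :: "'k \<Rightarrow> 'a \<Rightarrow> 'a" where "\<And>k. clinear (p k)" "\<And>k l a. a \<in> V l \<Longrightarrow> p k a = (if k = l then a else 0)"
    "\<And>a. finite {k. p k a \<noteq> 0}"
proof -
  let ?dec = "\<lambda>a x. finite {k. x k \<noteq> 0} \<and> (\<forall>k. x k \<in> V k) \<and> a = (\<Sum>k | x k \<noteq> 0. x k)"
  have sub: "csubspace (V k)" for k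
    using V by (simp add: direct_sum_decomposition_def)
  have ex1: "\<exists>!x. ?dec a x" for a
    using V by (simp add: direct_sum_decomposition_def)
  define q where "q a = (THE x. ?dec a x)" for a
  have q: "?dec a (q a)" for a unfolding q_def by (rule theI'[OF ex1])
  have uniq: "q a = x" if "finite S" "{k. x k \<noteq> 0} \<subseteq> S" "\<And>k. x k \<in> V k" "a = (\<Sum>k\<in>S. x k)" for a x S
  proof -
    have "finite {k. x k \<noteq> 0}" using that finite_subset by blast
    moreover have "a = (\<Sum>k | x k \<noteq> 0. x k)"
      unfolding that(4) by (rule sum.mono_neutral_right) (use that in auto)
    ultimately show ?thesis using ex1[of a] q[of a] that(3) by blast
  qed
  have sup: "a = (\<Sum>k\<in>S. q a k)" if "finite S" "{k. q a k \<noteq> 0} \<subseteq> S" for a S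
    using q[of a] sum.mono_neutral_left[OF that, of "q a"] by auto
  have add: "q (a + b) = (\<lambda>k. q a k + q b k)" for a b
  proof (rule uniq[of "{k. q a k \<noteq> 0} \<union> {k. q b k \<noteq> 0}"])
    show "a + b = (\<Sum>k\<in>{k. q a k \<noteq> 0} \<union> {k. q b k \<noteq> 0}. q a k + q b k)"
      unfolding sum.distrib using sup[of _ a] sup[of _ b] q[of a] q[of b] by (metis (no_types, lifting) finite_Un sup_ge1 sup_ge2)
  qed (use q sub in \<open>auto intro: cvec.subspace_add\<close>)
  have scale: "q (c *\<^sub>C a) = (\<lambda>k. c *\<^sub>C q a k)" for c a
    by (rule uniq[of "{k. q a k \<noteq> 0}"])
      (use q[of a] sub in \<open>auto intro: cvec.subspace_scale simp flip: cvec.scale_sum_right\<close>)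
  have single: "q a = (\<lambda>k. if k = l then a else 0)" if "a \<in> V l" for a l
    by (rule uniq[of "{l}"]) (use that sub cvec.subspace_0 in auto)
  show ?thesis
  proof (rule that[of "\<lambda>k a. q a k"])
    show "clinear (\<lambda>a. q a k)" for k by (rule clinearI) (simp_all add: add scale)
  qed (use q single in auto)
qed

lemma base_unit_ex1:
  fixes A :: "'j \<Rightarrow> 'j \<Rightarrow> 'a::complex_algebra set"
  assumes "partial_algebra A"
  shows "\<exists>!m. \<forall>r' s. \<forall>a\<in>A r' s. m \<rhd> a = (if r = r' then a else 0) \<and> a \<lhd> m = (if r = s then a else 0)"
proof -
  have V: "direct_sum_decomposition (\<lambda>(r, s). A r s)"
    and mult: "\<And>r s s' t a b. a \<in> A r s \<Longrightarrow> b \<in> A s' t \<Longrightarrow> s \<noteq> s' \<Longrightarrow> a * b = 0"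
    using assms by (auto simp: partial_algebra_def split: if_splits)
  obtain p where p: "\<And>k. clinear (p k)" "\<And>k l a. a \<in> (case l of (r, s) \<Rightarrow> A r s) \<Longrightarrow> p k a = (if k = l then a else 0)"
    and fin: "\<And>a. finite {k. p k a \<noteq> 0}"
    using direct_sum_component[OF V] by metis
  define h where "h S a = (\<Sum>k | k \<in> S \<and> p k a \<noteq> 0. p k a)" for S a
  have h: "h S a = (\<Sum>k | k \<in> S \<and> k \<in> T. p k a)" if "finite T" "{k. p k a \<noteq> 0} \<subseteq> T" for S T a
    unfolding h_def by (rule sum.mono_neutral_left) (use that in auto)
  have lin: "clinear (h S)" for S
  proof (rule clinearI)
    fix a b :: 'a and c
    define T where "T = {k. p k a \<noteq> 0} \<union> {k. p k b \<noteq> 0} \<union> {k. p k (a + b) \<noteq> 0}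
      \<union> {k. p k (c *\<^sub>C a) \<noteq> 0}"
    have T: "finite T" using fin by (simp add: T_def)
    have hT: "h S a = (\<Sum>k | k \<in> S \<and> k \<in> T. p k a)" "h S b = (\<Sum>k | k \<in> S \<and> k \<in> T. p k b)"
      "h S (a + b) = (\<Sum>k | k \<in> S \<and> k \<in> T. p k (a + b))"
      "h S (c *\<^sub>C a) = (\<Sum>k | k \<in> S \<and> k \<in> T. p k (c *\<^sub>C a))"
      by (rule h[OF T]; auto simp: T_def)+
    show "h S (a + b) = h S a + h S b"
      unfolding hT by (simp add: clinear_add[OF p(1)] sum.distrib)
    show "h S (c *\<^sub>C a) = c *\<^sub>C h S a"
      unfolding hT by (simp add: clinear_scaleC[OF p(1)] cvec.scale_sum_right)
  qed
  have comp: "h S a = (if (u, v) \<in> S then a else 0)" if "a \<in> A u v" for S a u v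
  proof -
    have "p k a = (if k = (u, v) then a else 0)" for k using p(2)[of a "(u, v)" k] that by simp
    then show ?thesis using h[of "{(u, v)}" a S] by (auto simp: Collect_conv_if)
  qed
  define l where "l = h {k. fst k = r}"
  define rr where "rr = h {k. snd k = r}"
  have compatible: "a * l b = rr a * b" for a b
    using V
  proof (induction a rule: direct_sum_induct)
    case (summand k a)
    then obtain u v where uv: "a \<in> A u v" by (auto split: prod.splits)
    show ?case using V
    proof (induction b rule: direct_sum_induct)
      case (summand k b)
      then obtain u' v' where uv': "b \<in> A u' v'" by (auto split: prod.splits)
      show ?case using mult[OF uv uv'] by (auto simp: l_def rr_def comp[OF uv] comp[OF uv'])
    qed (use lin clinear_scaleC[OF lin, of _ 0 0] in \<open>auto simp: l_def clinear_add distrib_left\<close>)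
  qed (use lin clinear_scaleC[OF lin, of _ 0 0] in \<open>auto simp: rr_def clinear_add distrib_right\<close>)
  have lr_comp: "l a = (if r = u then a else 0)" "rr a = (if r = v then a else 0)" if "a \<in> A u v" for a u v
    by (auto simp: l_def rr_def comp[OF that])
  have act: "make_multiplier l rr \<rhd> a = l a" "a \<lhd> make_multiplier l rr = rr a" for a
    using lin compatible by (auto simp: l_def rr_def make_multiplier_act)
  show ?thesis
  proof (rule ex1I[of _ "make_multiplier l rr"])
    show "\<forall>r' s. \<forall>a\<in>A r' s. make_multiplier l rr \<rhd> a = (if r = r' then a else 0)
        \<and> a \<lhd> make_multiplier l rr = (if r = s then a else 0)"
      using lr_comp by (simp add: act)
  next
    fix m
    assume m: "\<forall>r' s. \<forall>a\<in>A r' s. m \<rhd> a = (if r = r' then a else 0) \<and> a \<lhd> m = (if r = s then a else 0)"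
    have "m \<rhd> a = l a \<and> a \<lhd> m = rr a" for a
      using V
    proof (induction a rule: direct_sum_induct)
      case (summand k a)
      then obtain u v where "a \<in> A u v" by (auto split: prod.splits)
      then show ?case using m lr_comp by simp
    qed (use lin clinear_scaleC[OF lin, of _ 0 0] clinear_scaleC[OF clinear_lact[of m], of 0 0]
        clinear_scaleC[OF clinear_ract[of m], of 0 0] in \<open>auto simp: l_def rr_def clinear_add act_simps\<close>)
    then show "m = make_multiplier l rr" by (intro multiplier_eqI) (simp_all add: act)
  qed
qed

lemma base_unit_act:
  assumes "partial_algebra A" "a \<in> A r' s"
  shows "base_unit A r \<rhd> a = (if r = r' then a else 0)" "a \<lhd> base_unit A r = (if r = s then a else 0)"
  using theI'[OF base_unit_ex1[OF assms(1)]] assms(2) unfolding base_unit_def by blast+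

definition partial_nondegenerate :: "('j \<Rightarrow> 'j \<Rightarrow> 'a::complex_algebra set) \<Rightarrow> bool" where
  "partial_nondegenerate A \<longleftrightarrow>
     (\<forall>r. left_nondegenerate (partial_col A r) \<and> right_nondegenerate (partial_row A r))"

definition partial_idempotent :: "('j \<Rightarrow> 'j \<Rightarrow> 'a::complex_algebra set) \<Rightarrow> bool" where
  "partial_idempotent A \<longleftrightarrow>
     (\<forall>r. idempotent_algebra (partial_col A r) \<and> idempotent_algebra (partial_row A r))"

text \<open>For a subalgebra \<open>B = eCe\<close> of \<open>C\<close> with \<open>e\<close> an idempotent multiplier, \<open>M(B)\<close> is identified
  with \<open>e M(C) e\<close>, whose unit is \<open>e\<close>.\<close>

definition corner :: "'c::complex_algebra multiplier \<Rightarrow> 'c multiplier set" where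
  "corner e = {e * m * e |m. True}"

text \<open>A morphism from \<open>A\<close>, graded on a whole type, to \<open>B\<close>, graded on \<open>eCe\<close>.\<close>

definition partial_morphism ::
  "('j \<Rightarrow> 'j \<Rightarrow> 'a::complex_algebra set) \<Rightarrow> ('j \<Rightarrow> 'j \<Rightarrow> 'c::complex_algebra set) \<Rightarrow> 'c multiplier
    \<Rightarrow> ('a \<Rightarrow> 'c multiplier) \<Rightarrow> bool" where
  "partial_morphism A B e f \<longleftrightarrow>
     clinear f \<and> (\<forall>a b. f (a * b) = f a * f b) \<and> (\<forall>a. f a \<in> corner e) \<and>
     (\<forall>r. cspan {b \<lhd> f a |a b. a \<in> partial_col A r \<and> b \<in> partial_col B r} = partial_col B r \<and>
          cspan {f a \<rhd> b |a b. a \<in> partial_row A r \<and> b \<in> partial_row B r} = partial_row B r)"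

text \<open>\<open>F\<close> is a unital homomorphism \<open>M(B) \<rightarrow> M(B')\<close> extending \<open>f\<close> on \<open>B\<close>, where \<open>M(B)\<close> and \<open>M(B')\<close>
  are the corners of \<open>e\<close> and \<open>e'\<close>.\<close>

definition unital_extension ::
  "'b::complex_algebra set \<Rightarrow> 'b multiplier \<Rightarrow> 'c::complex_algebra multiplier
    \<Rightarrow> ('b \<Rightarrow> 'c multiplier) \<Rightarrow> ('b multiplier \<Rightarrow> 'c multiplier) \<Rightarrow> bool" where
  "unital_extension B e e' f F \<longleftrightarrow>
     (\<forall>m\<in>corner e. F m \<in> corner e') \<and>
     (\<forall>m\<in>corner e. \<forall>n\<in>corner e. F (m + n) = F m + F n \<and> F (m * n) = F m * F n) \<and>
     (\<forall>c. \<forall>m\<in>corner e. F (c *\<^sub>C m) = c *\<^sub>C F m) \<and>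
     F e = e' \<and> (\<forall>b\<in>B. F (mult_of b) = f b)"


section \<open>Regular partial multiplier Hopf algebras\<close>

text \<open>An \<open>I\<^sup>2\<close>-partial algebra has \<open>A (r, t) (s, u)\<close> for the component with upper indices
  \<open>r\<close>, \<open>s\<close> and lower indices \<open>t\<close>, \<open>u\<close>, the indices \<open>r\<close>, \<open>t\<close> being on the left.\<close>

type_synonym ('i, 'a) bigrading = "'i \<times> 'i \<Rightarrow> 'i \<times> 'i \<Rightarrow> 'a set"

definition upper_unit :: "('i, 'a::complex_algebra) bigrading \<Rightarrow> 'i \<Rightarrow> 'a multiplier" where
  "upper_unit A r = strict_sum (\<lambda>t. base_unit A (r, t))"

definition lower_unit :: "('i, 'a::complex_algebra) bigrading \<Rightarrow> 'i \<Rightarrow> 'a multiplier" where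
  "lower_unit A t = strict_sum (\<lambda>r. base_unit A (r, t))"

text \<open>The subspaces \<open>\<one>\<^sup>rA\<close>, \<open>\<one>\<^sub>tA\<close>, \<open>A\<one>\<^sup>s\<close> and \<open>A\<one>\<^sub>u\<close>.\<close>

definition left_upper :: "('i, 'a::complex_algebra) bigrading \<Rightarrow> 'i \<Rightarrow> 'a set" where
  "left_upper A r = {upper_unit A r \<rhd> a |a. True}"

definition left_lower :: "('i, 'a::complex_algebra) bigrading \<Rightarrow> 'i \<Rightarrow> 'a set" where
  "left_lower A t = {lower_unit A t \<rhd> a |a. True}"

definition right_upper :: "('i, 'a::complex_algebra) bigrading \<Rightarrow> 'i \<Rightarrow> 'a set" where
  "right_upper A s = {a \<lhd> upper_unit A s |a. True}"

definition right_lower :: "('i, 'a::complex_algebra) bigrading \<Rightarrow> 'i \<Rightarrow> 'a set" where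
  "right_lower A u = {a \<lhd> lower_unit A u |a. True}"

definition partial_tensor ::
  "('i, 'a::complex_algebra) bigrading \<Rightarrow> ('i, 'b::complex_algebra) bigrading \<Rightarrow> ('i, ('a, 'b) tensor) bigrading" where
  "partial_tensor A B = (\<lambda>(r, v) (s, w).
     cspan {a \<otimes> b |a b t u. a \<in> A (r, t) (s, u) \<and> b \<in> B (t, v) (u, w)})"

definition tensor_unit ::
  "('i, 'a::complex_algebra) bigrading \<Rightarrow> ('i, 'b::complex_algebra) bigrading \<Rightarrow> ('a, 'b) tensor multiplier" where
  "tensor_unit A B = strict_sum (\<lambda>t. lower_unit A t \<otimes>\<^sub>M upper_unit B t)"

text \<open>The unit \<open>(E \<otimes> 1)(1 \<otimes> E)\<close> of the multiplier algebra of the threefold product over \<open>I\<close>.\<close>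

definition tensor3_unit ::
  "('i, 'a::complex_algebra) bigrading \<Rightarrow> (('a, 'a) tensor, 'a) tensor multiplier" where
  "tensor3_unit A = (tensor_unit A A \<otimes>\<^sub>M 1) * mult_unassoc (1 \<otimes>\<^sub>M tensor_unit A A)"

text \<open>\<open>F\<close> and \<open>G\<close> are the extensions of \<open>\<Delta> \<otimes> id\<close> and \<open>id \<otimes> \<Delta>\<close> to the multiplier algebra of the
  twofold product over \<open>I\<close>. Since \<open>\<Delta>\<close> is a morphism, these extensions exist and are unique; they
  take values in multipliers of the left-nested threefold tensor product.\<close>

definition coassociative ::
  "('i, 'a::complex_algebra) bigrading \<Rightarrow> ('a \<Rightarrow> ('a, 'a) tensor multiplier) \<Rightarrow> bool" where
  "coassociative A \<Delta> \<longleftrightarrow> (\<exists>F G.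
     unital_extension (partial_total (partial_tensor A A)) (tensor_unit A A) (tensor3_unit A)
       (tensor_lift (\<lambda>a b. \<Delta> a \<otimes>\<^sub>M mult_of b)) F \<and>
     unital_extension (partial_total (partial_tensor A A)) (tensor_unit A A) (tensor3_unit A)
       (tensor_lift (\<lambda>a b. mult_unassoc (mult_of a \<otimes>\<^sub>M \<Delta> b))) G \<and>
     (\<forall>a. F (\<Delta> a) = G (\<Delta> a)))"

definition regular_comultiplication ::
  "('i, 'a::complex_algebra) bigrading \<Rightarrow> ('a \<Rightarrow> ('a, 'a) tensor multiplier) \<Rightarrow> bool" where
  "regular_comultiplication A \<Delta> \<longleftrightarrow>
     partial_morphism A (partial_tensor A A) (tensor_unit A A) \<Delta> \<and>
     (\<forall>a b. \<Delta> a * (mult_of b \<otimes>\<^sub>M 1) \<in> range mult_of \<and> \<Delta> a * (1 \<otimes>\<^sub>M mult_of b) \<in> range mult_of \<and>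
            (mult_of b \<otimes>\<^sub>M 1) * \<Delta> a \<in> range mult_of \<and> (1 \<otimes>\<^sub>M mult_of b) * \<Delta> a \<in> range mult_of) \<and>
     coassociative A \<Delta>"

text \<open>The multipliers \<open>(id \<otimes> \<omega>)(m)\<close> and \<open>(\<omega> \<otimes> id)(m)\<close>, for \<open>m\<close> such that \<open>m(b \<otimes> 1)\<close> and
  \<open>(b \<otimes> 1)m\<close>, respectively \<open>m(1 \<otimes> b)\<close> and \<open>(1 \<otimes> b)m\<close>, lie in \<open>A \<otimes> A\<close>.\<close>

definition slice_snd ::
  "('b::complex_algebra \<Rightarrow> complex) \<Rightarrow> ('a::complex_algebra, 'b) tensor multiplier \<Rightarrow> 'a multiplier" where
  "slice_snd \<omega> m = make_multiplier
     (\<lambda>b. tensor_lift (\<lambda>x y. \<omega> y *\<^sub>C x) (elem_of (m * (mult_of b \<otimes>\<^sub>M 1))))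
     (\<lambda>b. tensor_lift (\<lambda>x y. \<omega> y *\<^sub>C x) (elem_of ((mult_of b \<otimes>\<^sub>M 1) * m)))"

definition slice_fst ::
  "('a::complex_algebra \<Rightarrow> complex) \<Rightarrow> ('a, 'b::complex_algebra) tensor multiplier \<Rightarrow> 'b multiplier" where
  "slice_fst \<omega> m = make_multiplier
     (\<lambda>b. tensor_lift (\<lambda>x y. \<omega> x *\<^sub>C y) (elem_of (m * (1 \<otimes>\<^sub>M mult_of b))))
     (\<lambda>b. tensor_lift (\<lambda>x y. \<omega> x *\<^sub>C y) (elem_of ((1 \<otimes>\<^sub>M mult_of b) * m)))"

definition counit ::
  "('i, 'a::complex_algebra) bigrading \<Rightarrow> ('a \<Rightarrow> ('a, 'a) tensor multiplier) \<Rightarrow> ('a \<Rightarrow> complex) \<Rightarrow> bool" where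
  "counit A \<Delta> \<epsilon> \<longleftrightarrow> clinear \<epsilon> \<and>
     (\<forall>r t s u. r \<noteq> t \<or> s \<noteq> u \<longrightarrow> (\<forall>a\<in>A (r, t) (s, u). \<epsilon> a = 0)) \<and>
     (\<forall>r. (\<exists>a\<in>right_lower A r. \<epsilon> a \<noteq> 0) \<and> (\<exists>a\<in>left_lower A r. \<epsilon> a \<noteq> 0)) \<and>
     (\<forall>s t. \<forall>a\<in>partial_col A (s, t). \<forall>b\<in>partial_row A (s, t). \<epsilon> (a * b) = \<epsilon> a * \<epsilon> b) \<and>
     (\<forall>a. slice_snd \<epsilon> (\<Delta> a) = mult_of a \<and> slice_fst \<epsilon> (\<Delta> a) = mult_of a)"

definition regular_partial_multiplier_bialgebra ::
  "('i, 'a::complex_algebra) bigrading \<Rightarrow> ('a \<Rightarrow> ('a, 'a) tensor multiplier) \<Rightarrow> bool" where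
  "regular_partial_multiplier_bialgebra A \<Delta> \<longleftrightarrow>
     partial_algebra A \<and> partial_nondegenerate A \<and> partial_idempotent A \<and>
     regular_comultiplication A \<Delta> \<and> (\<exists>\<epsilon>. counit A \<Delta> \<epsilon>)"

text \<open>The subspace \<open>\<Oplus>\<^sub>r V\<^sub>r \<otimes> W\<^sub>r\<close>, for \<open>V\<close> and \<open>W\<close> the summands of two direct sum decompositions.\<close>

definition tensor_sum ::
  "('i \<Rightarrow> 'a::complex_vector set) \<Rightarrow> ('i \<Rightarrow> 'b::complex_vector set) \<Rightarrow> ('a, 'b) tensor set" where
  "tensor_sum V W = cspan {a \<otimes> b |a b r. a \<in> V r \<and> b \<in> W r}"

definition regular_partial_multiplier_Hopf_algebra ::
  "('i, 'a::complex_algebra) bigrading \<Rightarrow> ('a \<Rightarrow> ('a, 'a) tensor multiplier) \<Rightarrow> bool" where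
  "regular_partial_multiplier_Hopf_algebra A \<Delta> \<longleftrightarrow>
     regular_partial_multiplier_bialgebra A \<Delta> \<and>
     bij_betw (tensor_lift (\<lambda>a b. elem_of (\<Delta> a * (1 \<otimes>\<^sub>M mult_of b))))
       (tensor_sum (right_lower A) (left_lower A)) (tensor_sum (left_lower A) (left_upper A)) \<and>
     bij_betw (tensor_lift (\<lambda>a b. elem_of ((mult_of a \<otimes>\<^sub>M 1) * \<Delta> b)))
       (tensor_sum (right_upper A) (left_upper A)) (tensor_sum (right_lower A) (right_upper A)) \<and>
     bij_betw (tensor_lift (\<lambda>a b. elem_of (mult_flip (\<Delta> a) * (1 \<otimes>\<^sub>M mult_of b))))
       (tensor_sum (right_upper A) (left_upper A)) (tensor_sum (left_upper A) (left_lower A)) \<and>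
     bij_betw (tensor_lift (\<lambda>a b. elem_of ((mult_of a \<otimes>\<^sub>M 1) * mult_flip (\<Delta> b))))
       (tensor_sum (right_lower A) (left_lower A)) (tensor_sum (right_upper A) (right_lower A))"


section \<open>Invariant functionals\<close>

definition left_invariant ::
  "('i, 'a::complex_algebra) bigrading \<Rightarrow> ('a \<Rightarrow> ('a, 'a) tensor multiplier) \<Rightarrow> ('a \<Rightarrow> complex) \<Rightarrow> bool" where
  "left_invariant A \<Delta> \<phi> \<longleftrightarrow> clinear \<phi> \<and>
     (\<forall>r s r' s'. (r', s') \<noteq> (r, s) \<longrightarrow> (\<forall>a\<in>A (r, s) (r', s'). \<phi> a = 0)) \<and>
     (\<forall>a. slice_snd \<phi> (\<Delta> a) = strict_sum (\<lambda>r. \<phi> (upper_unit A r \<rhd> a) *\<^sub>C upper_unit A r))"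

definition right_invariant ::
  "('i, 'a::complex_algebra) bigrading \<Rightarrow> ('a \<Rightarrow> ('a, 'a) tensor multiplier) \<Rightarrow> ('a \<Rightarrow> complex) \<Rightarrow> bool" where
  "right_invariant A \<Delta> \<psi> \<longleftrightarrow> clinear \<psi> \<and>
     (\<forall>r s r' s'. (r', s') \<noteq> (r, s) \<longrightarrow> (\<forall>a\<in>A (r, s) (r', s'). \<psi> a = 0)) \<and>
     (\<forall>a. slice_fst \<psi> (\<Delta> a) = strict_sum (\<lambda>s. \<psi> (lower_unit A s \<rhd> a) *\<^sub>C lower_unit A s))"

definition faithful_functional :: "('a::complex_algebra \<Rightarrow> complex) \<Rightarrow> bool" where
  "faithful_functional \<omega> \<longleftrightarrow> (\<forall>a. (\<forall>b. \<omega> (a * b) = 0) \<or> (\<forall>b. \<omega> (b * a) = 0) \<longrightarrow> a = 0)"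

definition positive_functional :: "('a::complex_star_algebra \<Rightarrow> complex) \<Rightarrow> bool" where
  "positive_functional \<omega> \<longleftrightarrow> clinear \<omega> \<and> (\<forall>a. \<omega> (adj a * a) \<in> \<real> \<and> 0 \<le> Re (\<omega> (adj a * a)))"


section \<open>Partial multiplier Hopf \<open>*\<close>-algebras and quantum groups\<close>

definition partial_multiplier_Hopf_star_algebra ::
  "('i, 'a::complex_star_algebra) bigrading \<Rightarrow> ('a \<Rightarrow> ('a, 'a) tensor multiplier) \<Rightarrow> bool" where
  "partial_multiplier_Hopf_star_algebra A \<Delta> \<longleftrightarrow>
     regular_partial_multiplier_Hopf_algebra A \<Delta> \<and>
     (\<forall>r t s u. adj ` A (r, t) (s, u) = A (s, u) (r, t)) \<and>
     (\<forall>a. \<Delta> (adj a) = adj (\<Delta> a))"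

definition partial_Hopf_star_algebra ::
  "('i, 'a::complex_star_algebra) bigrading \<Rightarrow> ('a \<Rightarrow> ('a, 'a) tensor multiplier) \<Rightarrow> bool" where
  "partial_Hopf_star_algebra A \<Delta> \<longleftrightarrow>
     partial_multiplier_Hopf_star_algebra A \<Delta> \<and> (\<forall>r s. base_unit A (r, s) \<in> range mult_of)"

definition partial_star_algebraic_quantum_group ::
  "('i, 'a::complex_star_algebra) bigrading \<Rightarrow> ('a \<Rightarrow> ('a, 'a) tensor multiplier) \<Rightarrow> bool" where
  "partial_star_algebraic_quantum_group A \<Delta> \<longleftrightarrow>
     partial_multiplier_Hopf_star_algebra A \<Delta> \<and>
     (\<exists>\<phi>. positive_functional \<phi> \<and> faithful_functional \<phi> \<and> left_invariant A \<Delta> \<phi>)"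

definition partial_star_algebraic_quantum_group_of_compact_type ::
  "('i, 'a::complex_star_algebra) bigrading \<Rightarrow> ('a \<Rightarrow> ('a, 'a) tensor multiplier) \<Rightarrow> bool" where
  "partial_star_algebraic_quantum_group_of_compact_type A \<Delta> \<longleftrightarrow>
     partial_star_algebraic_quantum_group A \<Delta> \<and> partial_Hopf_star_algebra A \<Delta>"

definition partial_compact_quantum_group ::
  "('i, 'a::complex_star_algebra) bigrading \<Rightarrow> ('a \<Rightarrow> ('a, 'a) tensor multiplier) \<Rightarrow> bool" where
  "partial_compact_quantum_group A \<Delta> \<longleftrightarrow>
     partial_Hopf_star_algebra A \<Delta> \<and>
     (\<exists>\<phi>. positive_functional \<phi> \<and> left_invariant A \<Delta> \<phi> \<and> right_invariant A \<Delta> \<phi> \<and>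
          (\<forall>r. \<phi> (elem_of (base_unit A (r, r))) = 1))"

end

theory Submission
  imports Defs
begin

text \<open>
  Let \<open>T(p \<otimes> q) = (p \<otimes> 1)\<Delta>(q)\<close> be the canonical map, a bijection from \<open>\<Oplus>\<^sub>r A\<^sup>r \<otimes> \<^sup>rA\<close> to \<open>\<Oplus>\<^sub>r A\<^sub>r \<otimes> A\<^sup>r\<close>. Both
  notions require the base units \<open>\<one>(r,t)\<close> to lie in \<open>A\<close>, so \<open>A\<close> has local units, and what has to be compared
  are the functionals: faithful, positive and left invariant ones on one side, normalized, positive and
  biinvariant ones on the other. The antipode is not used; bijectivity of \<open>T\<close>, the counit and
  coassociativity suffice.

  A normalized positive left invariant functional \<open>\<phi>\<close> is faithful. By hermitian symmetry it is enough to
  show that \<open>N = {n. \<phi>(bn) = 0 for all b}\<close> is zero. Left invariance and surjectivity of \<open>T\<close> give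
  \<open>(id \<otimes> \<phi>)((1 \<otimes> b)\<Delta>(n)) = 0\<close> for \<open>n\<close> in \<open>N\<close> (\<open>conv_null\<close>). By coassociativity \<open>T\<close> commutes with \<open>id \<otimes> R\<close>, where
  \<open>R(q) = (id \<otimes> \<phi>)((1 \<otimes> b)\<Delta>(q))\<close> (\<open>lcop_conv\<close>); hence if \<open>T(z) = x \<otimes> n\<close>, injectivity of \<open>T\<close> shows
  \<open>(id \<otimes> R)(z) = 0\<close>, and applying the counit one finds that \<open>z\<close> lies in \<open>A \<otimes> N\<close> (\<open>canonical_preimage_null\<close>).
  The multiplication map sends \<open>z\<close> to \<open>\<epsilon>(n)x\<close>, so \<open>\<epsilon>(n)\<phi>(x) = 0\<close>. As \<open>\<phi>(\<one>(t,t)) = 1\<close>, the counit vanishes on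
  \<open>N\<close> (\<open>counit_null\<close>), and since \<open>N\<close> is a left coideal, \<open>N = 0\<close>.

  Conversely, let \<open>\<phi>\<close> be faithful, positive and left invariant. Then \<open>\<phi>(\<one>(t,t)) > 0\<close>, and
  \<open>h(a) = \<Sum>\<^sub>t \<phi>(\<one>(t,t))\<^sup>-\<^sup>1 \<phi>(\<one>\<^sub>ta)\<close> is again positive and left invariant, and normalized
  (\<open>normalize_left_invariant\<close>); so it is faithful by the first part. For \<open>b\<close> in \<open>A\<close> the functional
  \<open>\<psi>(a) = (h \<otimes> h)((1 \<otimes> b)\<Delta>(a))\<close> is left invariant, because \<open>h\<close> is. By faithfulness \<open>\<psi>\<close> is a
  multiple of \<open>h\<close> on each \<open>A\<one>\<^sub>n\<close> (\<open>convolution_eq_scaled\<close>), and evaluation at base units gives \<open>\<psi>(a) = h(b)h(\<one>\<^sub>va)\<close> for \<open>b\<close> in \<open>A\<one>\<^sub>v\<close>. Since \<open>h\<close> is faithful, this is right invariance of \<open>h\<close>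
  (\<open>normalized_faithful_left_invariant_imp_right_invariant\<close>).
\<close>

section \<open>Linear maps and slices of tensors\<close>

lemma clinear_zero: "clinear f \<Longrightarrow> f 0 = 0"
  using clinear_scaleC[of f 0 0] by simp

lemma clinear_diff: "clinear f \<Longrightarrow> f (x - y) = f x - f y"
  by (metis clinear_add diff_add_cancel add_diff_cancel_right')

lemma clinear_compose: "clinear f \<Longrightarrow> clinear g \<Longrightarrow> clinear (\<lambda>x. f (g x))"
  by (intro clinearI) (simp_all add: clinear_add clinear_scaleC)

lemma clinear_sum: "clinear f \<Longrightarrow> f (\<Sum>i\<in>S. g i) = (\<Sum>i\<in>S. f (g i))"
  by (induction S rule: infinite_finite_induct) (simp_all add: clinear_zero clinear_add)

lemma clinear_times_left: "clinear (\<lambda>x. a * x)" for a :: "'a::complex_algebra"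
  by (intro clinearI) (simp_all add: distrib_left)

lemma clinear_times_right: "clinear (\<lambda>x. x * a)" for a :: "'a::complex_algebra"
  by (intro clinearI) (simp_all add: distrib_right)

lemma clinear_fun_add: "clinear f \<Longrightarrow> clinear g \<Longrightarrow> clinear (\<lambda>x. f x + g x)"
  by (intro clinearI) (simp_all add: clinear_add clinear_scaleC scaleC_add_right)

lemma clinear_const_zero: "clinear (\<lambda>_. 0)"
  by (rule clinearI) simp_all

lemma clinear_fun_diff: "clinear f \<Longrightarrow> clinear g \<Longrightarrow> clinear (\<lambda>x. f x - g x)"
  by (intro clinearI) (simp_all add: clinear_add clinear_scaleC cvec.scale_right_diff_distrib)

lemma clinear_tensor_left: "clinear (\<lambda>x. x \<otimes> b)"
  by (intro clinearI) (simp_all add: tensor_add_left tensor_scaleC_left)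

lemma clinear_tensor_right: "clinear (\<lambda>y. a \<otimes> y)"
  by (intro clinearI) (simp_all add: tensor_add_right tensor_scaleC_right)

lemma tensor_zero [simp]: "0 \<otimes> b = 0" "a \<otimes> 0 = 0"
  by (rule clinear_zero[OF clinear_tensor_left], rule clinear_zero[OF clinear_tensor_right])

lemma csubspace_eq_zero: "clinear f \<Longrightarrow> csubspace {x. f x = 0}"
  by (simp add: cvec.subspace_def clinear_add clinear_scaleC clinear_zero)

lemma cspan_eq_zero:
  assumes "x \<in> cspan S" "clinear f" "\<And>s. s \<in> S \<Longrightarrow> f s = 0"
  shows "f x = 0"
  using cvec.span_induct[OF assms(1), of "\<lambda>x. f x = 0"] csubspace_eq_zero[OF assms(2)] assms(3)
  by blast

lemma cspan_clinear_eq: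
  assumes "x \<in> cspan S" "clinear f" "clinear g" "\<And>s. s \<in> S \<Longrightarrow> f s = g s"
  shows "f x = g x"
  using cspan_eq_zero[OF assms(1) clinear_fun_diff[OF assms(2,3)]] assms(4) by simp

text \<open>The slice maps \<open>id \<otimes> \<omega>\<close> and \<open>\<omega> \<otimes> id\<close> on a tensor product.\<close>

definition slice_right :: "('b::complex_vector \<Rightarrow> complex) \<Rightarrow> ('a::complex_vector, 'b) tensor \<Rightarrow> 'a" where
  "slice_right \<omega> = tensor_lift (\<lambda>x y. \<omega> y *\<^sub>C x)"

definition slice_left :: "('a::complex_vector \<Rightarrow> complex) \<Rightarrow> ('a, 'b::complex_vector) tensor \<Rightarrow> 'b" where
  "slice_left \<omega> = tensor_lift (\<lambda>x y. \<omega> x *\<^sub>C y)"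

lemma cbilinear_slice:
  assumes "clinear (\<omega> :: 'b::complex_vector \<Rightarrow> complex)"
  shows "cbilinear (\<lambda>(x::'a::complex_vector) y. \<omega> y *\<^sub>C x)" "cbilinear (\<lambda>y (x::'a). \<omega> y *\<^sub>C x)"
  by (rule cbilinearI; simp add: assms clinear_add clinear_scaleC scaleC_add_right scaleC_add_left
      scaleC_scaleC scaleC_complex_def mult.commute)+

lemma slice_right_tensor: "clinear \<omega> \<Longrightarrow> slice_right \<omega> (x \<otimes> y) = \<omega> y *\<^sub>C x"
  unfolding slice_right_def by (simp add: tensor_lift_clinear_simps cbilinear_slice)

lemma slice_left_tensor: "clinear \<omega> \<Longrightarrow> slice_left \<omega> (x \<otimes> y) = \<omega> x *\<^sub>C y"
  unfolding slice_left_def by (simp add: tensor_lift_clinear_simps cbilinear_slice)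

lemma clinear_slice_right: "clinear \<omega> \<Longrightarrow> clinear (slice_right \<omega>)"
  unfolding slice_right_def by (simp add: clinear_tensor_lift cbilinear_slice)

lemma clinear_slice_left: "clinear \<omega> \<Longrightarrow> clinear (slice_left \<omega>)"
  unfolding slice_left_def by (simp add: clinear_tensor_lift cbilinear_slice)

lemma slice_left_slice_right:
  assumes "clinear \<omega>" "clinear \<eta>"
  shows "\<omega> (slice_right \<eta> z) = \<eta> (slice_left \<omega> z)"
  by (rule tensor_clinear_ext)
    (simp_all add: assms clinear_compose clinear_slice_right clinear_slice_left slice_right_tensor
      slice_left_tensor clinear_scaleC scaleC_complex_def mult.commute)

lemma slice_right_map:
  assumes "clinear \<omega>" "clinear f" "clinear g"
  shows "slice_right \<omega> (tensor_map f g z) = f (slice_right (\<lambda>y. \<omega> (g y)) z)"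
  by (rule tensor_clinear_ext)
    (simp_all add: assms clinear_compose clinear_slice_right clinear_tensor_map tensor_map_tensor
      slice_right_tensor clinear_scaleC)

lemma slice_left_map:
  assumes "clinear \<omega>" "clinear f" "clinear g"
  shows "slice_left \<omega> (tensor_map f g z) = g (slice_left (\<lambda>x. \<omega> (f x)) z)"
  by (rule tensor_clinear_ext)
    (simp_all add: assms clinear_compose clinear_slice_left clinear_tensor_map tensor_map_tensor
      slice_left_tensor clinear_scaleC)

lemma clinear_ident: "clinear (\<lambda>x. x)"
  by (rule clinearI) simp_all

lemma tensor_basis_expansion:
  fixes z :: "('a::complex_vector, 'b::complex_vector) tensor"
  obtains F :: "'a set" and g where "finite F" "cvec.independent F" "z = (\<Sum>v\<in>F. v \<otimes> g v)"
proof -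
  obtain B :: "'a set" where B: "cvec.independent B" "cspan B = UNIV"
    by (rule cvec.maximal_independent_subset[of UNIV]) auto
  have "\<exists>F g. finite F \<and> F \<subseteq> B \<and> z = (\<Sum>v\<in>F. v \<otimes> g v)"
  proof (induction z rule: tensor_induct)
    case zero
    show ?case by (rule exI[of _ "{}"]) simp
  next
    case (tensor a b)
    have "a \<in> cspan B" using B by simp
    then obtain F r where "finite F" "F \<subseteq> B" and a: "a = (\<Sum>v\<in>F. r v *\<^sub>C v)"
      by (auto simp: cvec.span_explicit)
    moreover have "a \<otimes> b = (\<Sum>v\<in>F. v \<otimes> (r v *\<^sub>C b))"
      unfolding a by (simp add: clinear_sum[OF clinear_tensor_left] tensor_scaleC_left tensor_scaleC_right)
    ultimately show ?case by (intro exI[of _ F] exI[of _ "\<lambda>v. r v *\<^sub>C b"] conjI)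
  next
    case (add x y)
    then obtain F g G h where F: "finite F" "F \<subseteq> B" "x = (\<Sum>v\<in>F. v \<otimes> g v)"
      and G: "finite G" "G \<subseteq> B" "y = (\<Sum>v\<in>G. v \<otimes> h v)" by blast
    have x: "x = (\<Sum>v\<in>F \<union> G. v \<otimes> (if v \<in> F then g v else 0))"
      unfolding F(3) by (rule sum.mono_neutral_cong_left) (use F(1) G(1) in auto)
    have y: "y = (\<Sum>v\<in>F \<union> G. v \<otimes> (if v \<in> G then h v else 0))"
      unfolding G(3) by (rule sum.mono_neutral_cong_left) (use F(1) G(1) in auto)
    have "x + y = (\<Sum>v\<in>F \<union> G. v \<otimes> ((if v \<in> F then g v else 0) + (if v \<in> G then h v else 0)))"
      unfolding tensor_add_right sum.distrib by (subst x, subst y) (rule refl)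
    then show ?case using F(1,2) G(1,2)
      by (intro exI[of _ "F \<union> G"] exI[of _ "\<lambda>v. (if v \<in> F then g v else 0) + (if v \<in> G then h v else 0)"]) simp
  qed
  then obtain F g where "finite F" "F \<subseteq> B" "z = (\<Sum>v\<in>F. v \<otimes> g v)" by blast
  then show ?thesis using that cvec.independent_mono[OF B(1)] by blast
qed

text \<open>A tensor killed by \<open>id \<otimes> \<omega>\<close> for every \<open>\<omega>\<close> in a family of functionals lies in \<open>A \<otimes> N\<close>, where \<open>N\<close>
  is the joint kernel of the family.\<close>

lemma slices_zero_imp_in_span:
  assumes lin: "\<And>i. clinear (\<omega> i)" and zero: "\<And>i. slice_right (\<omega> i) z = 0"
  shows "z \<in> cspan {x \<otimes> y |x y. \<forall>i. \<omega> i y = 0}"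
proof -
  obtain F g where F: "finite F" "cvec.independent F" and z: "z = (\<Sum>v\<in>F. v \<otimes> g v)"
    by (rule tensor_basis_expansion)
  have "\<omega> i (g v) = 0" if "v \<in> F" for i v
  proof (rule cvec.independentD[OF F(2,1) _ _ that])
    show "(\<Sum>v\<in>F. \<omega> i (g v) *\<^sub>C v) = 0"
      using zero[of i] by (simp add: z clinear_sum clinear_slice_right lin slice_right_tensor)
  qed simp
  then show ?thesis
    unfolding z by (intro cvec.span_sum cvec.span_base) blast
qed

lemma act_zero [simp]: "m \<rhd> 0 = 0" "0 \<lhd> m = 0"
  by (rule clinear_zero[OF clinear_lact], rule clinear_zero[OF clinear_ract])

lemma clinear_ract_compose: "clinear f \<Longrightarrow> clinear (\<lambda>x. f x \<lhd> m)"
  by (intro clinearI) (simp_all add: clinear_add clinear_scaleC act_simps)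

lemma clinear_lact_compose: "clinear f \<Longrightarrow> clinear (\<lambda>x. m \<rhd> f x)"
  by (intro clinearI) (simp_all add: clinear_add clinear_scaleC act_simps)

section \<open>Multipliers of non-degenerate algebras\<close>

text \<open>Non-degeneracy makes the left and right actions of multipliers commute with each other and with
  multiplication, and makes a multiplier determined by its right action alone. Identities for the
  comultiplication are therefore checked on right actions only.\<close>

context
  fixes dummy :: "'a::complex_algebra itself"
  assumes left_nd: "left_nondegenerate (UNIV :: 'a set)"
    and right_nd: "right_nondegenerate (UNIV :: 'a set)"
begin

lemma nondegenerate_eq_left: "(\<And>x. b * x = b' * x) \<Longrightarrow> b = b'" for b :: 'a
  using left_nd unfolding left_nondegenerate_def
  by (metis UNIV_I eq_iff_diff_eq_0 left_diff_distrib)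

lemma nondegenerate_eq_right: "(\<And>x. x * b = x * b') \<Longrightarrow> b = b'" for b :: 'a
  using right_nd unfolding right_nondegenerate_def
  by (metis UNIV_I eq_iff_diff_eq_0 right_diff_distrib)

lemma lact_mult: "m \<rhd> (a * b) = (m \<rhd> a) * b" for a :: 'a
  by (rule nondegenerate_eq_right) (simp add: multiplier_compatible flip: mult.assoc)

lemma ract_mult: "(a * b) \<lhd> m = a * (b \<lhd> m)" for a :: 'a
  by (rule nondegenerate_eq_left) (simp add: mult.assoc flip: multiplier_compatible)

lemma lact_ract: "(m \<rhd> a) \<lhd> n = m \<rhd> (a \<lhd> n)" for a :: 'a
  by (rule nondegenerate_eq_left) (simp flip: multiplier_compatible lact_mult)

lemma mult_of_times: "mult_of a * m = mult_of (a \<lhd> m)" "m * mult_of a = mult_of (m \<rhd> a)" for a :: 'a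
  by (rule multiplier_eqI; simp add: multiplier_compatible ract_mult lact_mult)+

lemma multiplier_eq_ract: "(\<And>a. a \<lhd> m = a \<lhd> n) \<Longrightarrow> m = n" for m :: "'a multiplier"
  by (rule multiplier_eqI, rule nondegenerate_eq_right) (simp_all add: multiplier_compatible)

lemma inj_mult_of: "inj (mult_of :: 'a \<Rightarrow> _)"
  by (rule injI, rule nondegenerate_eq_left) (metis mult_of_act(1))

lemma elem_of_mult_of: "elem_of (mult_of a) = a" for a :: 'a
  unfolding elem_of_def by (rule the_equality) (auto dest: injD[OF inj_mult_of])

lemma mult_of_elem_of: "m \<in> range mult_of \<Longrightarrow> mult_of (elem_of m) = m" for m :: "'a multiplier"
  using elem_of_mult_of by auto

end

lemma mult_of_add: "mult_of (a + b) = mult_of a + mult_of b"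
  and mult_of_scaleC: "mult_of (c *\<^sub>C a) = c *\<^sub>C mult_of a"
  and mult_of_mult: "mult_of (a * b) = mult_of a * mult_of b"
  by (rule multiplier_eqI; simp add: distrib_left distrib_right mult.assoc)+

lemma lact_one_fun: "(\<rhd>) 1 = (\<lambda>a. a)"
  by (rule ext) simp

lemma tensor_map_zero:
  assumes "clinear f"
  shows "tensor_map (\<lambda>_. 0) f z = 0" "tensor_map f (\<lambda>_. 0) z = 0"
proof -
  note zero_f = clinear_tensor_map[OF clinear_const_zero assms] and f_zero = clinear_tensor_map[OF assms clinear_const_zero]
  show "tensor_map (\<lambda>_. 0) f z = 0"
    by (rule tensor_clinear_ext[OF zero_f clinear_const_zero]) (simp add: tensor_map_tensor clinear_const_zero assms)
  show "tensor_map f (\<lambda>_. 0) z = 0"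
    by (rule tensor_clinear_ext[OF f_zero clinear_const_zero]) (simp add: tensor_map_tensor clinear_const_zero assms)
qed

lemma tensor_map_lact:
  assumes f: "clinear f" and g: "clinear g"
  shows "tensor_map f g ((m \<otimes>\<^sub>M n) \<rhd> z) = tensor_map (\<lambda>a. f (m \<rhd> a)) (\<lambda>b. g (n \<rhd> b)) z"
proof -
  note fm = clinear_compose[OF f clinear_lact[of m]] and gn = clinear_compose[OF g clinear_lact[of n]]
  show ?thesis
    by (rule tensor_clinear_ext[OF clinear_compose[OF clinear_tensor_map[OF f g] clinear_lact] clinear_tensor_map[OF fm gn]])
      (simp add: tensor_map_tensor f g fm gn)
qed

lemma mult_tensor_eqI:
  assumes "\<And>a b. m \<rhd> (a \<otimes> b) = n \<rhd> (a \<otimes> b)" "\<And>a b. (a \<otimes> b) \<lhd> m = (a \<otimes> b) \<lhd> n"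
  shows "m = n"
  by (rule multiplier_eqI; rule tensor_clinear_ext) (auto simp: assms clinear_lact clinear_ract)

lemma mult_tensor_mult: "(m \<otimes>\<^sub>M n) * (m' \<otimes>\<^sub>M n') = (m * m') \<otimes>\<^sub>M (n * n')"
  by (rule mult_tensor_eqI) simp_all

lemma mult_of_tensor: "mult_of (a \<otimes> b) = mult_of a \<otimes>\<^sub>M mult_of b"
  by (rule mult_tensor_eqI) (simp_all add: tensor_mult)

text \<open>A family of multipliers of which only finitely many act nontrivially on each element has a strict
  sum.\<close>

lemma strict_sum_act:
  assumes "\<And>a. finite {k. f k \<rhd> a \<noteq> 0}" "\<And>a. finite {k. a \<lhd> f k \<noteq> 0}"
  shows "strict_sum f \<rhd> a = (\<Sum>k | f k \<rhd> a \<noteq> 0. f k \<rhd> a)"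
    "a \<lhd> strict_sum f = (\<Sum>k | a \<lhd> f k \<noteq> 0. a \<lhd> f k)"
proof -
  define l where "l a = (\<Sum>k | f k \<rhd> a \<noteq> 0. f k \<rhd> a)" for a
  define r where "r a = (\<Sum>k | a \<lhd> f k \<noteq> 0. a \<lhd> f k)" for a
  have l: "l a = (\<Sum>k\<in>S. f k \<rhd> a)" if "finite S" "{k. f k \<rhd> a \<noteq> 0} \<subseteq> S" for S a
    unfolding l_def by (rule sum.mono_neutral_left) (use that in auto)
  have r: "r a = (\<Sum>k\<in>S. a \<lhd> f k)" if "finite S" "{k. a \<lhd> f k \<noteq> 0} \<subseteq> S" for S a
    unfolding r_def by (rule sum.mono_neutral_left) (use that in auto)
  have lin_l: "clinear l"
  proof (rule clinearI)
    fix x y and c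
    define S where "S = {k. f k \<rhd> x \<noteq> 0} \<union> {k. f k \<rhd> y \<noteq> 0}"
    have "l x = (\<Sum>k\<in>S. f k \<rhd> x)" "l y = (\<Sum>k\<in>S. f k \<rhd> y)" "l (x + y) = (\<Sum>k\<in>S. f k \<rhd> (x + y))"
      "l (c *\<^sub>C x) = (\<Sum>k\<in>S. f k \<rhd> (c *\<^sub>C x))"
      by (rule l; auto simp: S_def assms act_simps)+
    then show "l (x + y) = l x + l y" "l (c *\<^sub>C x) = c *\<^sub>C l x"
      by (simp_all add: act_simps sum.distrib cvec.scale_sum_right)
  qed
  have lin_r: "clinear r"
  proof (rule clinearI)
    fix x y and c
    define S where "S = {k. x \<lhd> f k \<noteq> 0} \<union> {k. y \<lhd> f k \<noteq> 0}"
    have "r x = (\<Sum>k\<in>S. x \<lhd> f k)" "r y = (\<Sum>k\<in>S. y \<lhd> f k)" "r (x + y) = (\<Sum>k\<in>S. (x + y) \<lhd> f k)"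
      "r (c *\<^sub>C x) = (\<Sum>k\<in>S. (c *\<^sub>C x) \<lhd> f k)"
      by (rule r; auto simp: S_def assms act_simps)+
    then show "r (x + y) = r x + r y" "r (c *\<^sub>C x) = c *\<^sub>C r x"
      by (simp_all add: act_simps sum.distrib cvec.scale_sum_right)
  qed
  have compat: "x * l y = r x * y" for x y
  proof -
    define S where "S = {k. x \<lhd> f k \<noteq> 0} \<union> {k. f k \<rhd> y \<noteq> 0}"
    have "l y = (\<Sum>k\<in>S. f k \<rhd> y)" "r x = (\<Sum>k\<in>S. x \<lhd> f k)"
      by (rule l r; auto simp: S_def assms)+
    then show ?thesis by (simp add: sum_distrib_left sum_distrib_right multiplier_compatible)
  qed
  note act = make_multiplier_act[OF lin_l lin_r compat]
  have sum_act: "sum f S \<rhd> a = (\<Sum>k\<in>S. f k \<rhd> a)" "a \<lhd> sum f S = (\<Sum>k\<in>S. a \<lhd> f k)" for S and a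
    by (induction S rule: infinite_finite_induct) simp_all
  have "strict_limit (sum f) (make_multiplier l r) (finite_subsets_at_top UNIV)"
    unfolding strict_limit_def
  proof
    fix a
    have "\<forall>\<^sub>F S in finite_subsets_at_top UNIV. finite S \<and> {k. f k \<rhd> a \<noteq> 0} \<union> {k. a \<lhd> f k \<noteq> 0} \<subseteq> S"
      unfolding eventually_finite_subsets_at_top
      by (rule exI[of _ "{k. f k \<rhd> a \<noteq> 0} \<union> {k. a \<lhd> f k \<noteq> 0}"]) (use assms in auto)
    then show "\<forall>\<^sub>F S in finite_subsets_at_top UNIV. sum f S \<rhd> a = make_multiplier l r \<rhd> a \<and> a \<lhd> sum f S = a \<lhd> make_multiplier l r"
      by eventually_elim (auto simp: act sum_act intro!: l[symmetric] r[symmetric])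
  qed
  then have "strict_sum f = make_multiplier l r" by (rule strict_sum_eqI)
  then show "strict_sum f \<rhd> a = (\<Sum>k | f k \<rhd> a \<noteq> 0. f k \<rhd> a)" "a \<lhd> strict_sum f = (\<Sum>k | a \<lhd> f k \<noteq> 0. a \<lhd> f k)"
    by (simp_all add: act) (simp_all add: l_def r_def)
qed

text \<open>Strict sums in which at most one term acts nontrivially on a given element.\<close>

lemma strict_sum_act_single:
  assumes "\<And>a. finite {k. f k \<rhd> a \<noteq> 0}" "\<And>a. finite {k. a \<lhd> f k \<noteq> 0}"
  shows "(\<And>k. f k \<rhd> a = (if k = j then b else 0)) \<Longrightarrow> strict_sum f \<rhd> a = b"
    "(\<And>k. a \<lhd> f k = (if k = j then b else 0)) \<Longrightarrow> a \<lhd> strict_sum f = b"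
proof -
  assume *: "\<And>k. f k \<rhd> a = (if k = j then b else 0)"
  then have "{k. f k \<rhd> a \<noteq> 0} = (if b = 0 then {} else {j})" by auto
  then show "strict_sum f \<rhd> a = b" by (simp only: strict_sum_act[OF assms]) (simp add: *)
next
  assume *: "\<And>k. a \<lhd> f k = (if k = j then b else 0)"
  then have "{k. a \<lhd> f k \<noteq> 0} = (if b = 0 then {} else {j})" by auto
  then show "a \<lhd> strict_sum f = b" by (simp only: strict_sum_act[OF assms]) (simp add: *)
qed

section \<open>Partial Hopf algebras\<close>

text \<open>A regular partial multiplier Hopf algebra is a regular partial Hopf algebra if its base units lie
  in the algebra itself.\<close>

locale partial_Hopf_algebra =
  fixes A :: "('i, 'a::complex_algebra) bigrading" and \<Delta> :: "'a \<Rightarrow> ('a, 'a) tensor multiplier"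
  assumes Hopf: "regular_partial_multiplier_Hopf_algebra A \<Delta>"
    and base_unit_in_range: "\<And>k. base_unit A k \<in> range mult_of"
begin

lemma bialgebra: "regular_partial_multiplier_bialgebra A \<Delta>"
  using Hopf by (simp add: regular_partial_multiplier_Hopf_algebra_def)

lemma partial_algebra: "partial_algebra A"
  and comultiplication: "regular_comultiplication A \<Delta>"
  using bialgebra by (simp_all add: regular_partial_multiplier_bialgebra_def)

lemma decomposition: "direct_sum_decomposition (\<lambda>(k, l). A k l)"
  using partial_algebra by (simp add: partial_algebra_def)

lemma csubspace_component: "csubspace (A k l)"
  using decomposition unfolding direct_sum_decomposition_def by (metis case_prod_conv)

lemma component_induct [case_names zero component add]:
  assumes "P 0" "\<And>k l a. a \<in> A k l \<Longrightarrow> P a" "\<And>a b. P a \<Longrightarrow> P b \<Longrightarrow> P (a + b)"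
  shows "P a"
  using decomposition by (induction a rule: direct_sum_induct) (use assms in \<open>auto split: prod.splits\<close>)

lemma component_eqI:
  assumes "clinear f" "clinear g" "\<And>k l a. a \<in> A k l \<Longrightarrow> f a = g a"
  shows "f a = g a"
  by (induction a rule: component_induct) (simp_all add: assms clinear_zero clinear_add)

lemma tensor_component_eqI:
  assumes "clinear f" "clinear g"
    "\<And>k l k' l' x y. x \<in> A k l \<Longrightarrow> y \<in> A k' l' \<Longrightarrow> f (x \<otimes> y) = g (x \<otimes> y)"
  shows "f z = g z"
proof (rule tensor_clinear_ext[OF assms(1,2)])
  fix x y
  show "f (x \<otimes> y) = g (x \<otimes> y)"
  proof (rule component_eqI[where f = "\<lambda>x. f (x \<otimes> y)" and g = "\<lambda>x. g (x \<otimes> y)"])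
    show "clinear (\<lambda>x. f (x \<otimes> y))" "clinear (\<lambda>x. g (x \<otimes> y))"
      by (rule clinear_compose[OF assms(1) clinear_tensor_left] clinear_compose[OF assms(2) clinear_tensor_left])+
    fix k l x assume x: "x \<in> A k l"
    show "f (x \<otimes> y) = g (x \<otimes> y)"
    proof (rule component_eqI[where f = "\<lambda>y. f (x \<otimes> y)" and g = "\<lambda>y. g (x \<otimes> y)"])
      show "clinear (\<lambda>y. f (x \<otimes> y))" "clinear (\<lambda>y. g (x \<otimes> y))"
        by (rule clinear_compose[OF assms(1) clinear_tensor_right] clinear_compose[OF assms(2) clinear_tensor_right])+
    qed (rule assms(3)[OF x])
  qed
qed

text \<open>A multiplier \<open>D\<close> is diagonal if it is a formal combination of base units, \<open>c k\<close> being the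
  coefficient of the base unit \<open>\<one>(k)\<close>.\<close>

definition diagonal :: "'a multiplier \<Rightarrow> ('i \<times> 'i \<Rightarrow> complex) \<Rightarrow> bool" where
  "diagonal D c \<longleftrightarrow> (\<forall>k l. \<forall>a\<in>A k l. D \<rhd> a = c k *\<^sub>C a \<and> a \<lhd> D = c l *\<^sub>C a)"

lemma diagonal_act: "diagonal D c \<Longrightarrow> a \<in> A k l \<Longrightarrow> D \<rhd> a = c k *\<^sub>C a"
  "diagonal D c \<Longrightarrow> a \<in> A k l \<Longrightarrow> a \<lhd> D = c l *\<^sub>C a"
  unfolding diagonal_def by blast+

lemma diagonal_base_unit: "diagonal (base_unit A k) (\<lambda>l. if l = k then 1 else 0)"
  by (auto simp: diagonal_def base_unit_act[OF partial_algebra] scaleC_one)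

lemma component_multiplier_eqI:
  assumes "\<And>k l a. a \<in> A k l \<Longrightarrow> m \<rhd> a = n \<rhd> a" "\<And>k l a. a \<in> A k l \<Longrightarrow> a \<lhd> m = a \<lhd> n"
  shows "m = n"
  by (rule multiplier_eqI; rule component_eqI) (auto simp: assms clinear_lact clinear_ract)

lemma diagonal_commute:
  assumes "diagonal D c" "diagonal D' c'"
  shows "D * D' = D' * D"
  by (rule component_multiplier_eqI)
    (simp_all add: act_simps diagonal_act[OF assms(1)] diagonal_act[OF assms(2)] scaleC_scaleC mult.commute)

lemma diagonal_finite:
  assumes "\<And>t. diagonal (D t) (c t)" "\<And>k. finite {t. c t k \<noteq> 0}"
  shows "finite {t. D t \<rhd> a \<noteq> 0}" "finite {t. a \<lhd> D t \<noteq> 0}"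
proof (induction a rule: component_induct)
  case zero
  { case 1 show ?case by simp }
  { case 2 show ?case by simp }
next
  case (component k l a)
  { case 1 show ?case by (rule finite_subset[OF _ assms(2)[of k]]) (auto simp: diagonal_act[OF assms(1) component]) }
  { case 2 show ?case by (rule finite_subset[OF _ assms(2)[of l]]) (auto simp: diagonal_act[OF assms(1) component]) }
next
  case (add a b)
  { case 1 show ?case
      by (rule finite_subset[of _ "{t. D t \<rhd> a \<noteq> 0} \<union> {t. D t \<rhd> b \<noteq> 0}"]) (use add in \<open>auto simp: act_simps\<close>) }
  { case 2 show ?case
      by (rule finite_subset[of _ "{t. a \<lhd> D t \<noteq> 0} \<union> {t. b \<lhd> D t \<noteq> 0}"]) (use add in \<open>auto simp: act_simps\<close>) }
qed

lemma diagonal_strict_sum: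
  assumes "\<And>t. diagonal (D t) (c t)" "\<And>k. finite {t. c t k \<noteq> 0}"
  shows "diagonal (strict_sum D) (\<lambda>k. \<Sum>t | c t k \<noteq> 0. c t k)"
  unfolding diagonal_def
proof (intro allI ballI conjI)
  fix k l a assume a: "a \<in> A k l"
  note act = strict_sum_act[OF diagonal_finite[OF assms]]
  show "strict_sum D \<rhd> a = (\<Sum>t | c t k \<noteq> 0. c t k) *\<^sub>C a"
    unfolding act cvec.scale_sum_left
    by (rule sum.mono_neutral_cong_left) (auto simp: diagonal_act[OF assms(1) a] assms(2))
  show "a \<lhd> strict_sum D = (\<Sum>t | c t l \<noteq> 0. c t l) *\<^sub>C a"
    unfolding act cvec.scale_sum_left
    by (rule sum.mono_neutral_cong_left) (auto simp: diagonal_act[OF assms(1) a] assms(2))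
qed

text \<open>The multipliers \<open>\<one>\<^sup>r\<close> and \<open>\<one>\<^sub>t\<close>.\<close>

abbreviation up :: "'i \<Rightarrow> 'a multiplier" where "up \<equiv> upper_unit A"
abbreviation lo :: "'i \<Rightarrow> 'a multiplier" where "lo \<equiv> lower_unit A"

lemma diagonal_up: "diagonal (up r) (\<lambda>k. if fst k = r then 1 else 0)"
proof -
  have "{t. (if k = (r, t) then 1 else 0::complex) \<noteq> 0} = (if fst k = r then {snd k} else {})" for k :: "'i \<times> 'i"
    by (cases k) auto
  from diagonal_strict_sum[of "\<lambda>t. base_unit A (r, t)", OF diagonal_base_unit, unfolded this]
  show ?thesis by (simp add: upper_unit_def diagonal_def)
qed

lemma diagonal_lo: "diagonal (lo t) (\<lambda>k. if snd k = t then 1 else 0)"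
proof -
  have "{r. (if k = (r, t) then 1 else 0::complex) \<noteq> 0} = (if snd k = t then {fst k} else {})" for k :: "'i \<times> 'i"
    by (cases k) auto
  from diagonal_strict_sum[of "\<lambda>r. base_unit A (r, t)", OF diagonal_base_unit, unfolded this]
  show ?thesis by (simp add: lower_unit_def diagonal_def)
qed

lemma up_act: "a \<in> A k l \<Longrightarrow> up r \<rhd> a = (if fst k = r then a else 0)"
  "a \<in> A k l \<Longrightarrow> a \<lhd> up r = (if fst l = r then a else 0)"
  using diagonal_act[OF diagonal_up] by (simp_all add: scaleC_one)

lemma lo_act: "a \<in> A k l \<Longrightarrow> lo t \<rhd> a = (if snd k = t then a else 0)"
  "a \<in> A k l \<Longrightarrow> a \<lhd> lo t = (if snd l = t then a else 0)"
  using diagonal_act[OF diagonal_lo] by (simp_all add: scaleC_one)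

lemma finite_lo: "finite {t. lo t \<rhd> a \<noteq> 0}" "finite {t. a \<lhd> lo t \<noteq> 0}"
  by (rule diagonal_finite[OF diagonal_lo]; simp)+

lemma diagonal_idempotent:
  assumes "diagonal D c" "\<And>k. c k * c k = c k"
  shows "D * D = D"
  by (rule component_multiplier_eqI) (simp_all add: act_simps diagonal_act[OF assms(1)] scaleC_scaleC assms(2))

lemma up_idem: "up r * up r = up r"
  and lo_idem: "lo r * lo r = lo r"
  by (rule diagonal_idempotent[OF diagonal_up] diagonal_idempotent[OF diagonal_lo]; simp)+

lemma act_up_idem [simp]: "up r \<rhd> up r \<rhd> a = up r \<rhd> a" "a \<lhd> up r \<lhd> up r = a \<lhd> up r"
  and act_lo_idem [simp]: "lo r \<rhd> lo r \<rhd> a = lo r \<rhd> a" "a \<lhd> lo r \<lhd> lo r = a \<lhd> lo r"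
  by (simp_all add: up_idem lo_idem flip: times_act)

text \<open>Finite sums of base units are local units. As they lie in \<open>A\<close>, both \<open>A\<close> and \<open>A \<otimes> A\<close> are
  non-degenerate algebras.\<close>

lemma local_units:
  "\<exists>S. finite S \<and> (\<forall>T. finite T \<longrightarrow> S \<subseteq> T \<longrightarrow>
     (\<Sum>k\<in>T. base_unit A k) \<rhd> a = a \<and> a \<lhd> (\<Sum>k\<in>T. base_unit A k) = a)"
proof (induction a rule: component_induct)
  case zero
  show ?case by (intro exI[of _ "{}"]) simp
next
  case (component k l a)
  have sum_act: "sum f T \<rhd> a = (\<Sum>k\<in>T. f k \<rhd> a)" "a \<lhd> sum f T = (\<Sum>k\<in>T. a \<lhd> f k)" for f :: "'i \<times> 'i \<Rightarrow> 'a multiplier" and T and a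
    by (induction T rule: infinite_finite_induct) simp_all
  show ?case
    by (intro exI[of _ "{k, l}"]) (auto simp: sum_act base_unit_act[OF partial_algebra component])
next
  case (add a b)
  then obtain S S' where "finite S" "finite S'"
    "\<forall>T. finite T \<longrightarrow> S \<subseteq> T \<longrightarrow> (\<Sum>k\<in>T. base_unit A k) \<rhd> a = a \<and> a \<lhd> (\<Sum>k\<in>T. base_unit A k) = a"
    "\<forall>T. finite T \<longrightarrow> S' \<subseteq> T \<longrightarrow> (\<Sum>k\<in>T. base_unit A k) \<rhd> b = b \<and> b \<lhd> (\<Sum>k\<in>T. base_unit A k) = b"
    by blast
  then show ?case by (intro exI[of _ "S \<union> S'"]) (simp add: act_simps)
qed

lemma tensor_local_units:
  "\<exists>S. finite S \<and> (\<forall>T. finite T \<longrightarrow> S \<subseteq> T \<longrightarrow>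
     ((\<Sum>k\<in>T. base_unit A k) \<otimes>\<^sub>M (\<Sum>k\<in>T. base_unit A k)) \<rhd> z = z \<and>
     z \<lhd> ((\<Sum>k\<in>T. base_unit A k) \<otimes>\<^sub>M (\<Sum>k\<in>T. base_unit A k)) = z)"
proof (induction z rule: tensor_induct)
  case zero
  show ?case by (intro exI[of _ "{}"]) simp
next
  case (tensor a b)
  from local_units[of a] local_units[of b] obtain S S' where "finite S" "finite S'"
    "\<forall>T. finite T \<longrightarrow> S \<subseteq> T \<longrightarrow> (\<Sum>k\<in>T. base_unit A k) \<rhd> a = a \<and> a \<lhd> (\<Sum>k\<in>T. base_unit A k) = a"
    "\<forall>T. finite T \<longrightarrow> S' \<subseteq> T \<longrightarrow> (\<Sum>k\<in>T. base_unit A k) \<rhd> b = b \<and> b \<lhd> (\<Sum>k\<in>T. base_unit A k) = b"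
    by blast
  then show ?case by (intro exI[of _ "S \<union> S'"]) simp
next
  case (add a b)
  let ?m = "\<lambda>T. (\<Sum>k\<in>T. base_unit A k) \<otimes>\<^sub>M (\<Sum>k\<in>T. base_unit A k)"
  from add obtain S S' where "finite S" "finite S'"
    "\<forall>T. finite T \<longrightarrow> S \<subseteq> T \<longrightarrow> ?m T \<rhd> a = a \<and> a \<lhd> ?m T = a"
    "\<forall>T. finite T \<longrightarrow> S' \<subseteq> T \<longrightarrow> ?m T \<rhd> b = b \<and> b \<lhd> ?m T = b"
    by blast
  then show ?case by (intro exI[of _ "S \<union> S'"]) (simp add: act_simps)
qed

lemma sum_base_unit_in_range: "\<exists>u. (\<Sum>k\<in>T. base_unit A k) = mult_of u"
proof -
  have "\<forall>k. \<exists>u. base_unit A k = mult_of u" using base_unit_in_range by blast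
  then obtain u where u: "\<And>k. base_unit A k = mult_of (u k)" by metis
  have "(\<Sum>k\<in>T. mult_of (u k)) = mult_of (\<Sum>k\<in>T. u k)"
    by (rule clinear_sum[symmetric]) (simp add: clinearI mult_of_add mult_of_scaleC)
  then show ?thesis by (auto simp: u)
qed

lemma nondegenerate:
  "left_nondegenerate (UNIV :: 'a set)" "right_nondegenerate (UNIV :: 'a set)"
proof -
  have "\<exists>u. u * a = a \<and> a * u = a" for a :: 'a
    using local_units[of a] sum_base_unit_in_range by (metis mult_of_act order.refl)
  then show "left_nondegenerate (UNIV :: 'a set)" "right_nondegenerate (UNIV :: 'a set)"
    unfolding left_nondegenerate_def right_nondegenerate_def by (metis UNIV_I)+
qed

lemma tensor_nondegenerate:
  "left_nondegenerate (UNIV :: ('a, 'a) tensor set)" "right_nondegenerate (UNIV :: ('a, 'a) tensor set)"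
proof -
  have "\<exists>u. u * z = z \<and> z * u = z" for z :: "('a, 'a) tensor"
    using tensor_local_units[of z] sum_base_unit_in_range
    by (metis mult_of_act mult_of_tensor order.refl)
  then show "left_nondegenerate (UNIV :: ('a, 'a) tensor set)" "right_nondegenerate (UNIV :: ('a, 'a) tensor set)"
    unfolding left_nondegenerate_def right_nondegenerate_def by (metis UNIV_I)+
qed

lemmas A_lact_mult = lact_mult[OF nondegenerate]
  and A_ract_mult = ract_mult[OF nondegenerate]
  and A_mult_of_times = mult_of_times[OF nondegenerate]
  and A_eq_right = nondegenerate_eq_right[OF nondegenerate]
  and A_mult_of_elem_of = mult_of_elem_of[OF nondegenerate]
  and A_mult_of_eqD = injD[OF inj_mult_of[OF nondegenerate]]
  and A_multiplier_eqI = multiplier_eq_ract[OF nondegenerate]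
  and T_lact_ract = lact_ract[OF tensor_nondegenerate]
  and T_ract_mult = ract_mult[OF tensor_nondegenerate]
  and T_mult_of_times = mult_of_times[OF tensor_nondegenerate]
  and T_mult_of_elem_of = mult_of_elem_of[OF tensor_nondegenerate]
  and T_mult_of_eqD = injD[OF inj_mult_of[OF tensor_nondegenerate]]
  and T_multiplier_eqI = multiplier_eq_ract[OF tensor_nondegenerate]
  and T_eq_right = nondegenerate_eq_right[OF tensor_nondegenerate]

text \<open>The base unit \<open>\<one>(k)\<close> as an element of \<open>A\<close>.\<close>

definition e :: "'i \<times> 'i \<Rightarrow> 'a" where
  "e k = elem_of (base_unit A k)"

lemma mult_of_e: "mult_of (e k) = base_unit A k"
  unfolding e_def by (rule A_mult_of_elem_of[OF base_unit_in_range])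

lemma e_mult: "a \<in> A k' l \<Longrightarrow> e k * a = (if k = k' then a else 0)"
  "a \<in> A k l' \<Longrightarrow> a * e l = (if l = l' then a else 0)"
  using base_unit_act[OF partial_algebra, of a, folded mult_of_e] by simp_all

lemma e_mult_e_in_component: "e k * a * e l \<in> A k l"
  by (induction a rule: component_induct)
    (auto simp: e_mult distrib_left distrib_right cvec.subspace_0[OF csubspace_component]
      intro: cvec.subspace_add[OF csubspace_component])

lemma e_idem: "e k * e k = e k"
proof (rule A_mult_of_eqD)
  show "mult_of (e k * e k) = mult_of (e k)"
    unfolding mult_of_mult mult_of_e by (rule diagonal_idempotent[OF diagonal_base_unit]) simp
qed

lemma e_in_component: "e k \<in> A k k"
  using e_mult_e_in_component[of k "e k" k] by (simp add: e_idem)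

lemma component_iff: "a \<in> A k l \<longleftrightarrow> e k * a = a \<and> a * e l = a"
  using e_mult_e_in_component[of k a l] by (auto simp: e_mult)

lemma up_mult_lo: "up r * lo t = mult_of (e (r, t))"
  by (rule component_multiplier_eqI; auto simp: up_act lo_act e_mult)

lemma up_lo_act: "up r \<rhd> lo t \<rhd> a = e (r, t) * a"
  by (simp add: up_mult_lo flip: times_act)

section \<open>The comultiplication of a partial Hopf algebra\<close>

text \<open>The unit \<open>E = \<Sum>\<^sub>t \<one>\<^sub>t \<otimes> \<one>\<^sup>t\<close> of the multiplier algebra of the product of \<open>A\<close> with itself over \<open>I\<close>.\<close>

abbreviation E :: "('a, 'a) tensor multiplier" where "E \<equiv> tensor_unit A A"

lemma clinear_\<Delta>: "clinear \<Delta>"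
  and \<Delta>_mult: "\<Delta> (a * b) = \<Delta> a * \<Delta> b"
  and \<Delta>_corner: "\<Delta> a \<in> corner E"
  and \<Delta>_col: "cspan {b \<lhd> \<Delta> a |a b. a \<in> partial_col A k \<and> b \<in> partial_col (partial_tensor A A) k}
      = partial_col (partial_tensor A A) k"
  using comultiplication unfolding regular_comultiplication_def partial_morphism_def by blast+

lemma E_finite: "finite {t. (lo t \<otimes>\<^sub>M up t) \<rhd> z \<noteq> 0}" "finite {t. z \<lhd> (lo t \<otimes>\<^sub>M up t) \<noteq> 0}"
proof (induction z rule: tensor_induct)
  case zero
  { case 1 show ?case by simp }
  { case 2 show ?case by simp }
next
  case (tensor a b)
  { case 1 show ?case by (rule finite_subset[OF _ finite_lo(1)[of a]]) auto }
  { case 2 show ?case by (rule finite_subset[OF _ finite_lo(2)[of a]]) auto }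
next
  case (add x y)
  { case 1 show ?case
      by (rule finite_subset[of _ "{t. (lo t \<otimes>\<^sub>M up t) \<rhd> x \<noteq> 0} \<union> {t. (lo t \<otimes>\<^sub>M up t) \<rhd> y \<noteq> 0}"])
        (use add in \<open>auto simp: act_simps\<close>) }
  { case 2 show ?case
      by (rule finite_subset[of _ "{t. x \<lhd> (lo t \<otimes>\<^sub>M up t) \<noteq> 0} \<union> {t. y \<lhd> (lo t \<otimes>\<^sub>M up t) \<noteq> 0}"])
        (use add in \<open>auto simp: act_simps\<close>) }
qed

lemma E_act:
  "x \<in> A (r, t) l \<Longrightarrow> y \<in> A (t', v) m \<Longrightarrow> E \<rhd> (x \<otimes> y) = (if t = t' then x \<otimes> y else 0)"
  "x \<in> A l (r, t) \<Longrightarrow> y \<in> A m (t', v) \<Longrightarrow> (x \<otimes> y) \<lhd> E = (if t = t' then x \<otimes> y else 0)"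
  unfolding tensor_unit_def
  by (rule strict_sum_act_single[OF E_finite, where j = t]; auto simp: up_act lo_act)+

lemma E_idem: "E * E = E"
proof (rule T_multiplier_eqI)
  fix z show "z \<lhd> (E * E) = z \<lhd> E"
  proof (rule tensor_component_eqI[where f = "\<lambda>z. z \<lhd> (E * E)"])
    fix k l k' l' x y assume "x \<in> A k l" "y \<in> A k' l'"
    then show "(x \<otimes> y) \<lhd> (E * E) = (x \<otimes> y) \<lhd> E"
      by (cases l, cases l') (auto simp: E_act(2))
  qed (rule clinear_ract)+
qed

lemma ract_\<Delta>_E: "z \<lhd> E \<lhd> \<Delta> a = z \<lhd> \<Delta> a" "z \<lhd> \<Delta> a \<lhd> E = z \<lhd> \<Delta> a"
proof -
  obtain m where "\<Delta> a = E * m * E" using \<Delta>_corner by (auto simp: corner_def)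
  then have "E * \<Delta> a = \<Delta> a" "\<Delta> a * E = \<Delta> a"
    by (simp_all add: mult.assoc E_idem) (simp add: E_idem flip: mult.assoc)
  then show "z \<lhd> E \<lhd> \<Delta> a = z \<lhd> \<Delta> a" "z \<lhd> \<Delta> a \<lhd> E = z \<lhd> \<Delta> a"
    by (simp_all flip: times_act)
qed

text \<open>The multiplier \<open>\<Delta>(\<one>(r,t))\<close> acts from the right as \<open>E(\<one>\<^sup>r \<otimes> \<one>\<^sub>t)\<close>. This uses that \<open>\<Delta>\<close> is a morphism of
  partial algebras, so that each column of the product over \<open>I\<close> is spanned by elements \<open>b\<Delta>(a)\<close>.\<close>

lemma ract_\<Delta>_e:
  assumes "x \<in> A j (s, u)" "y \<in> A j' (u', w)"
  shows "(x \<otimes> y) \<lhd> \<Delta> (e k) = (if u = u' \<and> k = (s, w) then x \<otimes> y else 0)"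
proof (cases "u = u'")
  case False
  then have "(x \<otimes> y) \<lhd> E = 0" using E_act(2)[OF assms] by simp
  then show ?thesis using False ract_\<Delta>_E(1)[of "x \<otimes> y" "e k"] by simp
next
  case True
  have col: "c \<lhd> \<Delta> (e k) = (if k = k' then c else 0)" if "c \<in> partial_col (partial_tensor A A) k'" for c k'
  proof (rule cspan_clinear_eq[where g = "\<lambda>c. if k = k' then c else 0"])
    show "c \<in> cspan {b \<lhd> \<Delta> a |a b. a \<in> partial_col A k' \<and> b \<in> partial_col (partial_tensor A A) k'}"
      using that by (simp only: \<Delta>_col)
    show "clinear (\<lambda>c::('a, 'a) tensor. if k = k' then c else 0)" by (rule clinearI) auto
    fix c assume "c \<in> {b \<lhd> \<Delta> a |a b. a \<in> partial_col A k' \<and> b \<in> partial_col (partial_tensor A A) k'}"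
    then obtain a b where c: "c = b \<lhd> \<Delta> a" and a: "a \<in> partial_col A k'" by auto
    have "a * e k = (if k = k' then a else 0)"
      by (rule cspan_clinear_eq[where g = "\<lambda>a. if k = k' then a else 0", OF a[unfolded partial_col_def] clinear_times_right])
        (auto intro: clinearI simp: e_mult)
    then show "c \<lhd> \<Delta> (e k) = (if k = k' then c else 0)"
      unfolding c by (simp add: clinear_zero[OF clinear_\<Delta>] flip: times_act \<Delta>_mult split: if_splits)
  qed (rule clinear_ract)
  have "e (s, u) \<otimes> e (u, w) \<in> partial_tensor A A (s, w) (s, w)"
    unfolding partial_tensor_def by (auto intro!: cvec.span_base e_in_component)
  then have "e (s, u) \<otimes> e (u, w) \<in> partial_col (partial_tensor A A) (s, w)"
    unfolding partial_col_def by (intro cvec.span_base) blast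
  then have "(x \<otimes> y) * ((e (s, u) \<otimes> e (u, w)) \<lhd> \<Delta> (e k)) = (if k = (s, w) then (x \<otimes> y) * (e (s, u) \<otimes> e (u, w)) else 0)"
    using col by simp
  moreover have "(x \<otimes> y) * (e (s, u) \<otimes> e (u, w)) = x \<otimes> y"
    using assms True by (simp add: tensor_mult e_mult)
  ultimately show ?thesis using True by (simp flip: T_ract_mult)
qed

lemma ract_\<Delta>_zero:
  assumes "x \<in> A j (s, u)" "y \<in> A j' (u', w)" "a \<in> A k l" "u \<noteq> u' \<or> k \<noteq> (s, w)"
  shows "(x \<otimes> y) \<lhd> \<Delta> a = 0"
proof -
  have "\<Delta> (e k) * \<Delta> a = \<Delta> a" using assms(3) by (simp add: e_mult flip: \<Delta>_mult)
  then have "(x \<otimes> y) \<lhd> \<Delta> a = (x \<otimes> y) \<lhd> \<Delta> (e k) \<lhd> \<Delta> a" by (simp flip: times_act)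
  also have "(x \<otimes> y) \<lhd> \<Delta> (e k) = 0" using ract_\<Delta>_e[OF assms(1,2), of k] assms(4) by auto
  finally show ?thesis by simp
qed

lemma clinear_ract_\<Delta>: "clinear (\<lambda>a. z \<lhd> \<Delta> a)"
  by (intro clinearI) (simp_all add: clinear_add[OF clinear_\<Delta>] clinear_scaleC[OF clinear_\<Delta>])

lemma ract_\<Delta>_mismatch:
  assumes "x \<in> A j (s, u)" "y \<in> A j' (u', w)" "u \<noteq> u'"
  shows "(x \<otimes> y) \<lhd> \<Delta> a = 0"
  by (rule component_eqI[where f = "\<lambda>a. (x \<otimes> y) \<lhd> \<Delta> a" and g = "\<lambda>_. 0"])
    (auto simp: clinear_ract_\<Delta> ract_\<Delta>_zero[OF assms(1,2) _ disjI1[OF assms(3)]] intro: clinearI)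

text \<open>The comultiplication carries the left upper index of \<open>a\<close> to its first leg, the left lower index to its
  second leg, and matches the two inner indices.\<close>

lemma \<Delta>_upper:
  assumes D: "diagonal D (\<lambda>k. g (fst k))"
  shows "\<Delta> (D \<rhd> a) = (D \<otimes>\<^sub>M 1) * \<Delta> a"
proof (rule T_multiplier_eqI)
  fix z show "z \<lhd> \<Delta> (D \<rhd> a) = z \<lhd> ((D \<otimes>\<^sub>M 1) * \<Delta> a)"
  proof (rule tensor_component_eqI[where f = "\<lambda>z. z \<lhd> \<Delta> (D \<rhd> a)"])
    fix k l k' l' x y assume x: "x \<in> A k l" and y: "y \<in> A k' l'"
    have zero: "(x \<otimes> y) \<lhd> \<Delta> a = 0" if "a \<in> A m n" "fst l \<noteq> fst m" for a m n
      using ract_\<Delta>_zero[of x k "fst l" "snd l" y k' "fst l'" "snd l'" a m n] x y that by (cases m) auto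
    show "(x \<otimes> y) \<lhd> \<Delta> (D \<rhd> a) = (x \<otimes> y) \<lhd> ((D \<otimes>\<^sub>M 1) * \<Delta> a)"
    proof (rule component_eqI[where f = "\<lambda>a. (x \<otimes> y) \<lhd> \<Delta> (D \<rhd> a)"])
      fix m n a assume a: "a \<in> A m n"
      show "(x \<otimes> y) \<lhd> \<Delta> (D \<rhd> a) = (x \<otimes> y) \<lhd> ((D \<otimes>\<^sub>M 1) * \<Delta> a)"
        using zero[OF a] x y a
        by (cases "fst l = fst m") (auto simp: diagonal_act[OF D] tensor_scaleC_left act_simps clinear_scaleC[OF clinear_\<Delta>])
    qed (simp_all add: clinear_ract_\<Delta> clinear_compose[OF clinear_ract_\<Delta> clinear_lact])
  qed (simp_all add: clinear_ract clinear_ract_compose del: times_act)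
qed

lemma \<Delta>_lower:
  assumes D: "diagonal D (\<lambda>k. g (snd k))"
  shows "\<Delta> (D \<rhd> a) = (1 \<otimes>\<^sub>M D) * \<Delta> a"
proof (rule T_multiplier_eqI)
  fix z show "z \<lhd> \<Delta> (D \<rhd> a) = z \<lhd> ((1 \<otimes>\<^sub>M D) * \<Delta> a)"
  proof (rule tensor_component_eqI[where f = "\<lambda>z. z \<lhd> \<Delta> (D \<rhd> a)"])
    fix k l k' l' x y assume x: "x \<in> A k l" and y: "y \<in> A k' l'"
    have zero: "(x \<otimes> y) \<lhd> \<Delta> a = 0" if "a \<in> A m n" "snd l' \<noteq> snd m" for a m n
      using ract_\<Delta>_zero[of x k "fst l" "snd l" y k' "fst l'" "snd l'" a m n] x y that by (cases m) auto
    show "(x \<otimes> y) \<lhd> \<Delta> (D \<rhd> a) = (x \<otimes> y) \<lhd> ((1 \<otimes>\<^sub>M D) * \<Delta> a)"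
    proof (rule component_eqI[where f = "\<lambda>a. (x \<otimes> y) \<lhd> \<Delta> (D \<rhd> a)"])
      fix m n a assume a: "a \<in> A m n"
      show "(x \<otimes> y) \<lhd> \<Delta> (D \<rhd> a) = (x \<otimes> y) \<lhd> ((1 \<otimes>\<^sub>M D) * \<Delta> a)"
        using zero[OF a] x y a
        by (cases "snd l' = snd m") (auto simp: diagonal_act[OF D] tensor_scaleC_right act_simps clinear_scaleC[OF clinear_\<Delta>])
    qed (simp_all add: clinear_ract_\<Delta> clinear_compose[OF clinear_ract_\<Delta> clinear_lact])
  qed (simp_all add: clinear_ract clinear_ract_compose del: times_act)
qed

lemma \<Delta>_middle: "(lo t \<otimes>\<^sub>M 1) * \<Delta> a = (1 \<otimes>\<^sub>M up t) * \<Delta> a"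
proof (rule T_multiplier_eqI)
  fix z show "z \<lhd> ((lo t \<otimes>\<^sub>M 1) * \<Delta> a) = z \<lhd> ((1 \<otimes>\<^sub>M up t) * \<Delta> a)"
  proof (rule tensor_component_eqI[where f = "\<lambda>z. z \<lhd> ((lo t \<otimes>\<^sub>M 1) * \<Delta> a)"])
    fix k l k' l' x y assume x: "x \<in> A k l" and y: "y \<in> A k' l'"
    show "(x \<otimes> y) \<lhd> ((lo t \<otimes>\<^sub>M 1) * \<Delta> a) = (x \<otimes> y) \<lhd> ((1 \<otimes>\<^sub>M up t) * \<Delta> a)"
      using ract_\<Delta>_mismatch[of x k "fst l" "snd l" y k' "fst l'" "snd l'" a] x y
      by (auto simp: up_act lo_act)
  qed (simp_all add: clinear_ract clinear_ract_compose del: times_act)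
qed

text \<open>The elements \<open>(p \<otimes> 1)\<Delta>(q)\<close> and \<open>(1 \<otimes> b)\<Delta>(q)\<close> of \<open>A \<otimes> A\<close>.\<close>

definition lcop :: "'a \<Rightarrow> 'a \<Rightarrow> ('a, 'a) tensor" where
  "lcop p q = elem_of ((mult_of p \<otimes>\<^sub>M 1) * \<Delta> q)"

definition rcop :: "'a \<Rightarrow> 'a \<Rightarrow> ('a, 'a) tensor" where
  "rcop b q = elem_of ((1 \<otimes>\<^sub>M mult_of b) * \<Delta> q)"

lemma mult_of_lcop: "mult_of (lcop p q) = (mult_of p \<otimes>\<^sub>M 1) * \<Delta> q"
  and mult_of_rcop: "mult_of (rcop p q) = (1 \<otimes>\<^sub>M mult_of p) * \<Delta> q"
  using comultiplication unfolding regular_comultiplication_def lcop_def rcop_def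
  by (simp_all add: T_mult_of_elem_of)

lemma lcop_eqI: "mult_of z = (mult_of p \<otimes>\<^sub>M 1) * \<Delta> q \<Longrightarrow> lcop p q = z"
  and rcop_eqI: "mult_of z = (1 \<otimes>\<^sub>M mult_of p) * \<Delta> q \<Longrightarrow> rcop p q = z"
  by (rule T_mult_of_eqD; simp add: mult_of_lcop mult_of_rcop)+

lemma mult_tensor_bilinear:
  "(m + m') \<otimes>\<^sub>M n = m \<otimes>\<^sub>M n + m' \<otimes>\<^sub>M n" "m \<otimes>\<^sub>M (n + n') = m \<otimes>\<^sub>M n + m \<otimes>\<^sub>M n'"
  "(c *\<^sub>C m) \<otimes>\<^sub>M n = c *\<^sub>C (m \<otimes>\<^sub>M n)" "m \<otimes>\<^sub>M (c *\<^sub>C n) = c *\<^sub>C (m \<otimes>\<^sub>M n)"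
  by (rule mult_tensor_eqI; simp add: tensor_add_left tensor_add_right tensor_scaleC_left tensor_scaleC_right)+

lemma cbilinear_lcop: "cbilinear lcop"
  by (rule cbilinearI; rule lcop_eqI)
    (simp_all add: mult_of_add mult_of_scaleC mult_of_lcop mult_tensor_bilinear distrib_left distrib_right
      clinear_add[OF clinear_\<Delta>] clinear_scaleC[OF clinear_\<Delta>])

lemma cbilinear_rcop: "cbilinear rcop"
  by (rule cbilinearI; rule rcop_eqI)
    (simp_all add: mult_of_add mult_of_scaleC mult_of_rcop mult_tensor_bilinear distrib_left distrib_right
      clinear_add[OF clinear_\<Delta>] clinear_scaleC[OF clinear_\<Delta>])

lemma clinear_lcop: "clinear (lcop p)" "clinear (\<lambda>p. lcop p q)"
  using cbilinear_lcop by (simp_all add: cbilinear_def)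

lemma clinear_rcop: "clinear (rcop p)" "clinear (\<lambda>p. rcop p q)"
  using cbilinear_rcop by (simp_all add: cbilinear_def)

lemma lcop_ract_\<Delta>: "lcop p q \<lhd> \<Delta> a = lcop p (q * a)"
  by (rule sym, rule lcop_eqI) (simp add: \<Delta>_mult mult.assoc[symmetric] mult_of_lcop[symmetric] T_mult_of_times)

lemma lact_rcop: "(1 \<otimes>\<^sub>M m) \<rhd> rcop p q = rcop (m \<rhd> p) q"
  by (rule sym, rule rcop_eqI)
    (simp add: mult_of_rcop mult_tensor_mult A_mult_of_times mult.assoc[symmetric] flip: T_mult_of_times)

lemma tensor_ract_\<Delta>:
  "(x \<otimes> y) \<lhd> \<Delta> a = (1 \<otimes>\<^sub>M mult_of y) \<rhd> lcop x a"
  "(x \<otimes> y) \<lhd> \<Delta> a = (mult_of x \<otimes>\<^sub>M 1) \<rhd> rcop y a"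
  by (rule T_mult_of_eqD; simp add: mult_of_tensor mult_of_lcop mult_of_rcop mult_tensor_mult
      mult.assoc[symmetric] flip: T_mult_of_times)+

lemma rcop_upper: "diagonal D (\<lambda>k. g (fst k)) \<Longrightarrow> rcop p (D \<rhd> q) = (D \<otimes>\<^sub>M 1) \<rhd> rcop p q"
  by (rule rcop_eqI)
    (simp add: \<Delta>_upper mult_of_rcop mult_tensor_mult mult.assoc[symmetric] flip: T_mult_of_times)

lemma lcop_lower: "diagonal D (\<lambda>k. g (snd k)) \<Longrightarrow> lcop p (D \<rhd> q) = (1 \<otimes>\<^sub>M D) \<rhd> lcop p q"
  and rcop_lower: "diagonal D (\<lambda>k. g (snd k)) \<Longrightarrow> rcop p (D \<rhd> q) = rcop (p \<lhd> D) q"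
  by ((rule lcop_eqI | rule rcop_eqI); simp add: \<Delta>_lower mult_of_lcop mult_of_rcop mult_tensor_mult
      A_mult_of_times mult.assoc[symmetric] flip: T_mult_of_times)+

text \<open>Inner indices: a factor \<open>\<one>\<^sub>t\<close> in front of the first leg of \<open>\<Delta>(q)\<close> may be replaced by a factor \<open>\<one>\<^sup>t\<close> in
  front of the second.\<close>

lemma lcop_middle: "lcop (p \<lhd> lo t) q = (1 \<otimes>\<^sub>M up t) \<rhd> lcop p q"
proof (rule lcop_eqI)
  have "mult_of ((1 \<otimes>\<^sub>M up t) \<rhd> lcop p q) = (mult_of p \<otimes>\<^sub>M 1) * ((1 \<otimes>\<^sub>M up t) * \<Delta> q)"
    by (simp add: mult_of_lcop mult_tensor_mult mult.assoc[symmetric] flip: T_mult_of_times)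
  also have "\<dots> = (mult_of (p \<lhd> lo t) \<otimes>\<^sub>M 1) * \<Delta> q"
    by (simp add: mult_tensor_mult mult.assoc[symmetric] A_mult_of_times flip: \<Delta>_middle)
  finally show "mult_of ((1 \<otimes>\<^sub>M up t) \<rhd> lcop p q) = (mult_of (p \<lhd> lo t) \<otimes>\<^sub>M 1) * \<Delta> q" .
qed

lemma rcop_middle: "rcop (p \<lhd> up t) q = (lo t \<otimes>\<^sub>M 1) \<rhd> rcop p q"
proof (rule rcop_eqI)
  have "mult_of ((lo t \<otimes>\<^sub>M 1) \<rhd> rcop p q) = (1 \<otimes>\<^sub>M mult_of p) * ((lo t \<otimes>\<^sub>M 1) * \<Delta> q)"
    by (simp add: mult_of_rcop mult_tensor_mult mult.assoc[symmetric] flip: T_mult_of_times)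
  also have "\<dots> = (1 \<otimes>\<^sub>M mult_of (p \<lhd> up t)) * \<Delta> q"
    by (simp add: mult_tensor_mult mult.assoc[symmetric] A_mult_of_times \<Delta>_middle)
  finally show "mult_of ((lo t \<otimes>\<^sub>M 1) \<rhd> rcop p q) = (1 \<otimes>\<^sub>M mult_of (p \<lhd> up t)) * \<Delta> q" .
qed


section \<open>Coassociativity\<close>

lemma E_compression_in_total: "E \<rhd> (z \<lhd> E) \<in> partial_total (partial_tensor A A)"
  (is "_ \<in> ?B")
proof -
  have sub: "csubspace ?B" unfolding partial_total_def by (rule cvec.subspace_span)
  note sub_simps = cvec.subspace_0[OF sub] cvec.subspace_add[OF sub]
  show ?thesis
  proof (induction z rule: tensor_induct)
    case (tensor a b)
    show ?case
    proof (induction a rule: component_induct)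
      case (component k l a)
      show ?case
      proof (induction b rule: component_induct)
        case b: (component k' l' b)
        obtain r t s u t' v u' w where idx: "k = (r, t)" "l = (s, u)" "k' = (t', v)" "l' = (u', w)"
          by (cases k, cases l, cases k', cases l')
        have "a \<otimes> b \<in> ?B" if "t = t'" "u = u'"
        proof -
          have "a \<otimes> b \<in> partial_tensor A A (r, v) (s, w)"
            unfolding partial_tensor_def using component b that by (auto simp: idx intro!: cvec.span_base)
          then show ?thesis unfolding partial_total_def by (intro cvec.span_base) blast
        qed
        moreover note E_act(1)[OF component[unfolded idx(1)] b[unfolded idx(3)]]
          E_act(2)[OF component[unfolded idx(2)] b[unfolded idx(4)]]
        ultimately show ?case using sub_simps(1) by simp
      qed (auto simp: sub_simps tensor_add_right act_simps)
    qed (auto simp: sub_simps tensor_add_left act_simps)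
  qed (auto simp: sub_simps act_simps)
qed

text \<open>The extension of a homomorphism \<open>f\<close> to multipliers is computed on \<open>\<Delta>(q)\<close> by compressing with an
  element \<open>\<beta> = \<one>(k,t) \<otimes> \<one>(t,l)\<close>, since \<open>\<beta>\<Delta>(q)\<close> lies in the domain of \<open>f\<close>.\<close>

lemma extension_ract_\<Delta>:
  assumes ext: "unital_extension (partial_total (partial_tensor A A)) E e' f F"
  shows "f (e (k, t) \<otimes> e (t, l)) * F (\<Delta> q) = f ((e (k, t) \<otimes> e (t, l)) \<lhd> \<Delta> q)"
proof -
  define \<beta> where "\<beta> = e (k, t) \<otimes> e (t, l)"
  have \<beta>: "E \<rhd> \<beta> = \<beta>" "\<beta> \<lhd> E = \<beta>"
    unfolding \<beta>_def by (simp_all add: E_act[OF e_in_component e_in_component])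
  have f: "F (mult_of z) = f z" "mult_of z \<in> corner E" if z: "E \<rhd> z = z" "z \<lhd> E = z" for z
  proof -
    have "z \<in> partial_total (partial_tensor A A)" using E_compression_in_total[of z] z by simp
    then show "F (mult_of z) = f z" using ext by (simp add: unital_extension_def)
    have "mult_of z = E * mult_of z * E" by (simp add: T_mult_of_times z)
    then show "mult_of z \<in> corner E" unfolding corner_def by blast
  qed
  have "E \<rhd> (\<beta> \<lhd> \<Delta> q) = \<beta> \<lhd> \<Delta> q" using \<beta> by (simp flip: T_lact_ract)
  then have "F (mult_of (\<beta> \<lhd> \<Delta> q)) = f (\<beta> \<lhd> \<Delta> q)" by (rule f(1)) (rule ract_\<Delta>_E)
  moreover have "F (mult_of \<beta> * \<Delta> q) = F (mult_of \<beta>) * F (\<Delta> q)"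
    using ext f(2)[OF \<beta>] \<Delta>_corner by (simp add: unital_extension_def)
  ultimately show ?thesis by (simp add: T_mult_of_times f(1)[OF \<beta>] flip: \<beta>_def)
qed

lemma cbilinear_\<Delta>_id: "cbilinear (\<lambda>a b. \<Delta> a \<otimes>\<^sub>M mult_of b)"
  by (rule cbilinearI) (simp_all add: clinear_add[OF clinear_\<Delta>] clinear_scaleC[OF clinear_\<Delta>]
      mult_tensor_bilinear mult_of_add mult_of_scaleC)

lemma mult_unassoc_linear:
  "mult_unassoc (m + n) = mult_unassoc m + mult_unassoc n" "mult_unassoc (c *\<^sub>C m) = c *\<^sub>C mult_unassoc m"
  by (rule multiplier_eqI; simp add: mult_unassoc_act tensor_unassoc_simps)+

lemma cbilinear_id_\<Delta>: "cbilinear (\<lambda>a b. mult_unassoc (mult_of a \<otimes>\<^sub>M \<Delta> b))"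
  by (rule cbilinearI) (simp_all add: clinear_add[OF clinear_\<Delta>] clinear_scaleC[OF clinear_\<Delta>]
      mult_tensor_bilinear mult_of_add mult_of_scaleC mult_unassoc_linear)

text \<open>The right actions of \<open>(\<Delta> \<otimes> id)(z)\<close> and \<open>(id \<otimes> \<Delta>)(z)\<close> on elementary tensors.\<close>

lemma ract_\<Delta>_id:
  "(X \<otimes> w) \<lhd> tensor_lift (\<lambda>a b. \<Delta> a \<otimes>\<^sub>M mult_of b) z
    = tensor_map (\<lambda>a. X \<lhd> \<Delta> a) (\<lambda>b. b) ((1 \<otimes>\<^sub>M mult_of w) \<rhd> z)"
proof (rule tensor_clinear_ext[where x = z])
  show "clinear (\<lambda>z. (X \<otimes> w) \<lhd> tensor_lift (\<lambda>a b. \<Delta> a \<otimes>\<^sub>M mult_of b) z)"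
    by (rule clinearI) (simp_all add: tensor_lift_clinear_simps[OF cbilinear_\<Delta>_id])
  show "clinear (\<lambda>z. tensor_map (\<lambda>a. X \<lhd> \<Delta> a) (\<lambda>b. b) ((1 \<otimes>\<^sub>M mult_of w) \<rhd> z))"
    by (rule clinear_compose[OF clinear_tensor_map[OF clinear_ract_\<Delta> clinear_ident] clinear_lact])
qed (simp add: tensor_lift_clinear_simps[OF cbilinear_\<Delta>_id] tensor_map_tensor clinear_ract_\<Delta> clinear_ident)

lemma ract_id_\<Delta>:
  fixes x :: 'a
  shows "((x \<otimes> y) \<otimes> w) \<lhd> tensor_lift (\<lambda>a b. mult_unassoc (mult_of a \<otimes>\<^sub>M \<Delta> b)) z
    = tensor_unassoc (tensor_map (\<lambda>a. a) (\<lambda>b. (y \<otimes> w) \<lhd> \<Delta> b) ((mult_of x \<otimes>\<^sub>M 1) \<rhd> z))"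
proof (rule tensor_clinear_ext[where x = z])
  show "clinear (\<lambda>z. ((x \<otimes> y) \<otimes> w) \<lhd> tensor_lift (\<lambda>a b. mult_unassoc (mult_of a \<otimes>\<^sub>M \<Delta> b)) z)"
    by (rule clinearI) (simp_all add: tensor_lift_clinear_simps[OF cbilinear_id_\<Delta>])
  have un: "clinear (tensor_unassoc :: ('a, ('a, 'a) tensor) tensor \<Rightarrow> _)"
    by (rule clinearI) (simp_all add: tensor_unassoc_simps)
  show "clinear (\<lambda>z. tensor_unassoc (tensor_map (\<lambda>a. a) (\<lambda>b. (y \<otimes> w) \<lhd> \<Delta> b) ((mult_of x \<otimes>\<^sub>M 1) \<rhd> z)))"
    by (rule clinear_compose[OF un clinear_compose[OF clinear_tensor_map[OF clinear_ident clinear_ract_\<Delta>] clinear_lact]])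
  show "((x \<otimes> y) \<otimes> w) \<lhd> tensor_lift (\<lambda>a b. mult_unassoc (mult_of a \<otimes>\<^sub>M \<Delta> b)) (a \<otimes> b)
      = tensor_unassoc (tensor_map (\<lambda>a. a) (\<lambda>b. (y \<otimes> w) \<lhd> \<Delta> b) ((mult_of x \<otimes>\<^sub>M 1) \<rhd> (a \<otimes> b)))" for a b
    unfolding tensor_lift_clinear_simps(3)[OF cbilinear_id_\<Delta>] mult_tensor_act_tensor mult_unassoc_act(2)
      tensor_assoc_simps(3) tensor_map_tensor[OF clinear_ident clinear_ract_\<Delta>]
    by simp
qed

text \<open>Coassociativity in \<open>A \<otimes> A \<otimes> A\<close>:
  \<open>(x \<otimes> y \<otimes> 1)(\<Delta> \<otimes> id)((1 \<otimes> w)\<Delta>(q)) = (1 \<otimes> y \<otimes> w)(id \<otimes> \<Delta>)((x \<otimes> 1)\<Delta>(q))\<close>. When the middle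
  indices of \<open>x\<close>, \<open>y\<close>, \<open>w\<close> do not match, both sides vanish.\<close>

lemma coassociativity_component:
  assumes x: "x \<in> A j (k, u)" and y: "y \<in> A j' (u', t)" and w: "w \<in> A j'' (t', l)"
  shows "tensor_map (\<lambda>a. (x \<otimes> y) \<lhd> \<Delta> a) (\<lambda>b. b) (rcop w q)
    = tensor_unassoc (tensor_map (\<lambda>a. a) (\<lambda>b. (y \<otimes> w) \<lhd> \<Delta> b) (lcop x q))"
    (is "?\<Phi> (rcop w q) = tensor_unassoc (?\<Psi> (lcop x q))")
proof -
  show ?thesis
  proof (cases "u = u'")
    case False
    have "?\<Phi> (rcop w q) = 0"
      using ract_\<Delta>_mismatch[OF x y False] by (simp add: tensor_map_zero clinear_ident)
    moreover have "?\<Psi> (lcop x q) = 0"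
    proof -
      have "y \<lhd> up u = 0" using False y by (simp add: up_act)
      then have "(y \<otimes> w) \<lhd> \<Delta> (up u \<rhd> b) = 0" for b
        by (simp add: \<Delta>_upper[OF diagonal_up])
      moreover have "lcop x q = (1 \<otimes>\<^sub>M up u) \<rhd> lcop x q"
        using lcop_middle[of x u q] x by (simp add: lo_act)
      ultimately show ?thesis
        using tensor_map_lact[OF clinear_ident clinear_ract_\<Delta>, of "y \<otimes> w" 1 "up u" "lcop x q"]
        by (simp add: tensor_map_zero clinear_ident)
    qed
    ultimately show ?thesis by (simp add: tensor_unassoc_simps)
  next
    case u: True
    show ?thesis
    proof (cases "t = t'")
      case False
      have "?\<Psi> (lcop x q) = 0"
        using ract_\<Delta>_mismatch[OF y w False] by (simp add: tensor_map_zero clinear_ident)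
      moreover have "?\<Phi> (rcop w q) = 0"
      proof -
        have "y \<lhd> lo t' = 0" using False y by (simp add: lo_act)
        then have "(x \<otimes> y) \<lhd> \<Delta> (lo t' \<rhd> b) = 0" for b
          by (simp add: \<Delta>_lower[OF diagonal_lo])
        moreover have "rcop w q = (lo t' \<otimes>\<^sub>M 1) \<rhd> rcop w q"
          using rcop_middle[of w t' q] w by (simp add: up_act)
        ultimately show ?thesis
          using tensor_map_lact[OF clinear_ract_\<Delta> clinear_ident, of "x \<otimes> y" "lo t'" 1 "rcop w q"]
          by (simp add: tensor_map_zero clinear_ident)
      qed
      ultimately show ?thesis by (simp add: tensor_unassoc_simps)
    next
      case t: True
      obtain F G where F: "unital_extension (partial_total (partial_tensor A A)) E (tensor3_unit A)
          (tensor_lift (\<lambda>a b. \<Delta> a \<otimes>\<^sub>M mult_of b)) F"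
        and G: "unital_extension (partial_total (partial_tensor A A)) E (tensor3_unit A)
          (tensor_lift (\<lambda>a b. mult_unassoc (mult_of a \<otimes>\<^sub>M \<Delta> b))) G"
        and FG: "F (\<Delta> q) = G (\<Delta> q)"
        using comultiplication unfolding regular_comultiplication_def coassociative_def by blast
      let ?c = "(x \<otimes> y) \<otimes> w"
      have xy: "(x \<otimes> y) \<lhd> \<Delta> (e (k, t)) = x \<otimes> y" and yw: "(y \<otimes> w) \<lhd> \<Delta> (e (u, l)) = y \<otimes> w"
        using ract_\<Delta>_e[OF x y] ract_\<Delta>_e[OF y w] u t by simp_all
      have we: "w * e (t, l) = w" and xe: "x * e (k, u) = x"
        using x w t by (simp_all add: e_mult)
      \<comment> \<open>The triple \<open>c\<close> is fixed by \<open>(\<Delta> \<otimes> id)(\<one>(k,t) \<otimes> \<one>(t,l))\<close> and by \<open>(id \<otimes> \<Delta>)(\<one>(k,u) \<otimes> \<one>(u,l))\<close>, so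
        these may be inserted in front of the two expressions for the iterated coproduct.\<close>
      have "?c \<lhd> F (\<Delta> q) = ?c \<lhd> tensor_lift (\<lambda>a b. \<Delta> a \<otimes>\<^sub>M mult_of b) (e (k, t) \<otimes> e (t, l)) \<lhd> F (\<Delta> q)"
        by (simp add: tensor_lift_clinear_simps[OF cbilinear_\<Delta>_id] xy we)
      also have "\<dots> = ?c \<lhd> tensor_lift (\<lambda>a b. \<Delta> a \<otimes>\<^sub>M mult_of b) ((e (k, t) \<otimes> e (t, l)) \<lhd> \<Delta> q)"
        by (simp only: extension_ract_\<Delta>[OF F] flip: times_act)
      also have "\<dots> = ?\<Phi> ((1 \<otimes>\<^sub>M mult_of w) \<rhd> ((e (k, t) \<otimes> e (t, l)) \<lhd> \<Delta> q))"
        by (rule ract_\<Delta>_id)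
      also have "(1 \<otimes>\<^sub>M mult_of w) \<rhd> ((e (k, t) \<otimes> e (t, l)) \<lhd> \<Delta> q) = (mult_of (e (k, t)) \<otimes>\<^sub>M 1) \<rhd> rcop w q"
        by (simp add: we tensor_ract_\<Delta>(2)[symmetric] flip: T_lact_ract)
      also have "?\<Phi> \<dots> = ?\<Phi> (rcop w q)"
        unfolding tensor_map_lact[OF clinear_ract_\<Delta> clinear_ident] by (simp add: \<Delta>_mult xy lact_one_fun)
      finally have l: "?c \<lhd> F (\<Delta> q) = ?\<Phi> (rcop w q)" .
      have "?c \<lhd> G (\<Delta> q) = ?c \<lhd> tensor_lift (\<lambda>a b. mult_unassoc (mult_of a \<otimes>\<^sub>M \<Delta> b)) (e (k, u) \<otimes> e (u, l)) \<lhd> G (\<Delta> q)"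
        by (simp add: tensor_lift_clinear_simps[OF cbilinear_id_\<Delta>] mult_unassoc_act tensor_assoc_simps
            tensor_unassoc_simps yw xe)
      also have "\<dots> = ?c \<lhd> tensor_lift (\<lambda>a b. mult_unassoc (mult_of a \<otimes>\<^sub>M \<Delta> b)) ((e (k, u) \<otimes> e (u, l)) \<lhd> \<Delta> q)"
        by (simp only: extension_ract_\<Delta>[OF G] flip: times_act)
      also have "\<dots> = tensor_unassoc (?\<Psi> ((mult_of x \<otimes>\<^sub>M 1) \<rhd> ((e (k, u) \<otimes> e (u, l)) \<lhd> \<Delta> q)))"
        by (rule ract_id_\<Delta>)
      also have "(mult_of x \<otimes>\<^sub>M 1) \<rhd> ((e (k, u) \<otimes> e (u, l)) \<lhd> \<Delta> q) = (1 \<otimes>\<^sub>M mult_of (e (u, l))) \<rhd> lcop x q"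
        by (simp add: xe tensor_ract_\<Delta>(1)[symmetric] flip: T_lact_ract)
      also have "?\<Psi> \<dots> = ?\<Psi> (lcop x q)"
        unfolding tensor_map_lact[OF clinear_ident clinear_ract_\<Delta>] by (simp add: \<Delta>_mult yw lact_one_fun)
      finally show ?thesis using l FG by simp
    qed
  qed
qed

text \<open>The element \<open>(id \<otimes> \<omega>)((1 \<otimes> b)\<Delta>(q))\<close> of \<open>A\<close>, that is, the convolution of \<open>q\<close> with the functional
  \<open>\<omega>(b \<cdot>)\<close>.\<close>

definition conv :: "('a \<Rightarrow> complex) \<Rightarrow> 'a \<Rightarrow> 'a \<Rightarrow> 'a" where
  "conv \<omega> b q = slice_right \<omega> (rcop b q)"

lemma clinear_conv:
  assumes "clinear \<omega>" shows "clinear (conv \<omega> b)" "clinear (\<lambda>b. conv \<omega> b q)"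
  unfolding conv_def
  by (rule clinear_compose[OF clinear_slice_right[OF assms] clinear_rcop(1)]
      clinear_compose[OF clinear_slice_right[OF assms] clinear_rcop(2)])+

lemma slice_right_lact_left:
  "clinear \<omega> \<Longrightarrow> slice_right \<omega> ((m \<otimes>\<^sub>M 1) \<rhd> z) = m \<rhd> slice_right \<omega> z"
  using slice_right_map[of \<omega> "lact m" "lact 1" z] by (simp add: mult_tensor_act(1) clinear_lact)

lemma slice_right_lact_right:
  "clinear \<omega> \<Longrightarrow> slice_right \<omega> ((1 \<otimes>\<^sub>M m) \<rhd> z) = slice_right (\<lambda>y. \<omega> (m \<rhd> y)) z"
  using slice_right_map[of \<omega> "lact 1" "lact m" z] by (simp add: mult_tensor_act(1) clinear_lact)

lemma slice_right_ract_\<Delta>: "clinear \<omega> \<Longrightarrow> slice_right \<omega> ((y \<otimes> w) \<lhd> \<Delta> q) = y * conv \<omega> w q"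
  by (simp add: tensor_ract_\<Delta>(2) slice_right_lact_left conv_def)

text \<open>Coassociativity, with \<open>\<omega>(w \<cdot>)\<close> applied to the third leg: in terms of the canonical map
  \<open>T(x \<otimes> q) = (x \<otimes> 1)\<Delta>(q)\<close> and \<open>R(q) = (id \<otimes> \<omega>)((1 \<otimes> w)\<Delta>(q))\<close>, it says that \<open>T(id \<otimes> R) = (id \<otimes> R)T\<close>.\<close>

lemma lcop_conv:
  assumes \<omega>: "clinear \<omega>"
  shows "lcop x (conv \<omega> w q) = tensor_map (\<lambda>a. a) (conv \<omega> w) (lcop x q)"
proof -
  have comp: "(1 \<otimes>\<^sub>M mult_of y) \<rhd> lcop x (conv \<omega> w q)
      = (1 \<otimes>\<^sub>M mult_of y) \<rhd> tensor_map (\<lambda>a. a) (conv \<omega> w) (lcop x q)"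
    if x: "x \<in> A j (k, u)" and y: "y \<in> A j' (u', t)" and w: "w \<in> A j'' (t', l)" for x y w j j' j'' k l u u' t t'
  proof -
    have "(1 \<otimes>\<^sub>M mult_of y) \<rhd> lcop x (conv \<omega> w q) = (x \<otimes> y) \<lhd> \<Delta> (slice_right \<omega> (rcop w q))"
      by (simp add: tensor_ract_\<Delta>(1) conv_def)
    also have "\<dots> = slice_right \<omega> (tensor_map (\<lambda>a. (x \<otimes> y) \<lhd> \<Delta> a) (\<lambda>b. b) (rcop w q))"
      by (simp add: slice_right_map \<omega> clinear_ract_\<Delta> clinear_ident)
    also have "\<dots> = slice_right \<omega> (tensor_unassoc (tensor_map (\<lambda>a. a) (\<lambda>b. (y \<otimes> w) \<lhd> \<Delta> b) (lcop x q)))"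
      by (simp only: coassociativity_component[OF x y w])
    also have "\<dots> = (1 \<otimes>\<^sub>M mult_of y) \<rhd> tensor_map (\<lambda>a. a) (conv \<omega> w) (lcop x q)"
    proof -
      have un: "clinear (tensor_unassoc :: ('a, ('a, 'a) tensor) tensor \<Rightarrow> _)"
        by (rule clinearI) (simp_all add: tensor_unassoc_simps)
      have slice: "slice_right \<omega> (tensor_unassoc (a \<otimes> z)) = a \<otimes> slice_right \<omega> z" for a :: 'a and z :: "('a, 'a) tensor"
        by (rule tensor_clinear_ext[where x = z])
          (auto intro!: clinear_compose[OF clinear_slice_right[OF \<omega>] clinear_compose[OF un clinear_tensor_right]]
              clinear_compose[OF clinear_tensor_right clinear_slice_right[OF \<omega>]]
              simp: \<omega> slice_right_tensor tensor_unassoc_simps tensor_scaleC_right)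
      show ?thesis
        by (rule tensor_clinear_ext[where x = "lcop x q"])
          (auto intro!: clinear_compose[OF clinear_slice_right[OF \<omega>] clinear_compose[OF un clinear_tensor_map]]
              clinear_lact_compose clinear_tensor_map simp: clinear_ident clinear_ract_\<Delta> clinear_conv \<omega> tensor_map_tensor
              slice slice_right_ract_\<Delta>)
    qed
    finally show ?thesis .
  qed
  have lin_w: "clinear (\<lambda>w. tensor_map (\<lambda>a. a) (conv \<omega> w) z)" for z :: "('a, 'a) tensor"
  proof (induction z rule: tensor_induct)
    case (tensor a b)
    show ?case
      by (simp add: tensor_map_tensor clinear_ident clinear_conv \<omega> clinear_compose[OF clinear_tensor_right])
  next
    case (add x y)
    then show ?case
      by (simp add: clinear_add[OF clinear_tensor_map[OF clinear_ident clinear_conv(1)[OF \<omega>]]] clinear_fun_add)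
  qed (simp add: clinear_zero[OF clinear_tensor_map[OF clinear_ident clinear_conv(1)[OF \<omega>]]] clinear_const_zero)
  have comp1: "(1 \<otimes>\<^sub>M mult_of y) \<rhd> lcop x (conv \<omega> w q)
      = (1 \<otimes>\<^sub>M mult_of y) \<rhd> tensor_map (\<lambda>a. a) (conv \<omega> w) (lcop x q)" for x y w
  proof (rule component_eqI[where a = x])
    fix k l x assume x: "x \<in> A k l"
    show "(1 \<otimes>\<^sub>M mult_of y) \<rhd> lcop x (conv \<omega> w q) = (1 \<otimes>\<^sub>M mult_of y) \<rhd> tensor_map (\<lambda>a. a) (conv \<omega> w) (lcop x q)"
    proof (rule component_eqI[where a = w])
      fix k' l' w assume w: "w \<in> A k' l'"
      show "(1 \<otimes>\<^sub>M mult_of y) \<rhd> lcop x (conv \<omega> w q) = (1 \<otimes>\<^sub>M mult_of y) \<rhd> tensor_map (\<lambda>a. a) (conv \<omega> w) (lcop x q)"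
      proof (rule component_eqI[where a = y])
        fix k'' l'' y assume "y \<in> A k'' l''"
        then show "(1 \<otimes>\<^sub>M mult_of y) \<rhd> lcop x (conv \<omega> w q) = (1 \<otimes>\<^sub>M mult_of y) \<rhd> tensor_map (\<lambda>a. a) (conv \<omega> w) (lcop x q)"
          using comp[of x k "fst l" "snd l" y k'' "fst l''" "snd l''" w k' "fst l'" "snd l'"] x w by simp
      qed (auto intro!: clinearI simp: mult_of_add mult_of_scaleC mult_tensor_bilinear)
    qed (auto intro!: clinear_lact_compose clinear_compose[OF clinear_lcop(1)] simp: clinear_conv \<omega> lin_w)
  qed (auto intro!: clinear_lact_compose clinear_compose[OF clinear_tensor_map] simp: clinear_lcop clinear_ident clinear_conv \<omega>)
  show ?thesis
  proof (rule T_eq_right)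
    fix z show "z * lcop x (conv \<omega> w q) = z * tensor_map (\<lambda>a. a) (conv \<omega> w) (lcop x q)"
    proof (induction z rule: tensor_induct)
      case (tensor a b)
      have "mult_of (a \<otimes> b) = (mult_of a \<otimes>\<^sub>M 1) * (1 \<otimes>\<^sub>M mult_of b)"
        by (simp add: mult_of_tensor mult_tensor_mult)
      then have "(a \<otimes> b) * z = (mult_of a \<otimes>\<^sub>M 1) \<rhd> (1 \<otimes>\<^sub>M mult_of b) \<rhd> z" for z
        by (metis mult_of_act(1) times_act(1))
      then show ?case by (simp only: comp1)
    qed (simp_all add: distrib_right)
  qed
qed

lemma conv_upper: "clinear \<omega> \<Longrightarrow> diagonal D (\<lambda>k. g (fst k)) \<Longrightarrow> conv \<omega> b (D \<rhd> q) = D \<rhd> conv \<omega> b q"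
  by (simp add: conv_def rcop_upper slice_right_lact_left)

lemma conv_lower: "diagonal D (\<lambda>k. g (snd k)) \<Longrightarrow> conv \<omega> b (D \<rhd> q) = conv \<omega> (b \<lhd> D) q"
  by (simp add: conv_def rcop_lower)

lemma conv_middle: "clinear \<omega> \<Longrightarrow> conv \<omega> (b \<lhd> up t) q = lo t \<rhd> conv \<omega> b q"
  by (simp add: conv_def rcop_middle slice_right_lact_left)


section \<open>Slices of the comultiplication, the counit and the canonical map\<close>

lemma slice_right_ract_left:
  "clinear \<omega> \<Longrightarrow> slice_right \<omega> (z \<lhd> (m \<otimes>\<^sub>M 1)) = slice_right \<omega> z \<lhd> m"
  using slice_right_map[of \<omega> "\<lambda>a. a \<lhd> m" "\<lambda>b. b \<lhd> 1" z] by (simp add: mult_tensor_act(2) clinear_ract clinear_ident)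

lemma slice_left_lact_right:
  "clinear \<omega> \<Longrightarrow> slice_left \<omega> ((1 \<otimes>\<^sub>M m) \<rhd> z) = m \<rhd> slice_left \<omega> z"
  using slice_left_map[of \<omega> "lact 1" "lact m" z] by (simp add: mult_tensor_act(1) clinear_lact)

lemma slice_left_ract_right:
  "clinear \<omega> \<Longrightarrow> slice_left \<omega> (z \<lhd> (1 \<otimes>\<^sub>M m)) = slice_left \<omega> z \<lhd> m"
  using slice_left_map[of \<omega> "\<lambda>b. b \<lhd> 1" "\<lambda>a. a \<lhd> m" z] by (simp add: mult_tensor_act(2) clinear_ract clinear_ident)

lemma ract_slice_snd:
  assumes \<omega>: "clinear \<omega>"
  shows "b \<lhd> slice_snd \<omega> (\<Delta> a) = slice_right \<omega> (lcop b a)"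
proof -
  define el where "el b = elem_of (\<Delta> a * (mult_of b \<otimes>\<^sub>M 1))" for b
  have el: "mult_of (el b) = \<Delta> a * (mult_of b \<otimes>\<^sub>M 1)" for b
    using comultiplication unfolding regular_comultiplication_def el_def by (simp add: T_mult_of_elem_of)
  have "clinear el"
    by (rule clinearI; rule T_mult_of_eqD) (simp_all add: el mult_of_add mult_of_scaleC mult_tensor_bilinear distrib_left)
  then have l: "clinear (\<lambda>b. slice_right \<omega> (el b))"
    by (rule clinear_compose[OF clinear_slice_right[OF \<omega>]])
  have r: "clinear (\<lambda>b. slice_right \<omega> (lcop b a))"
    by (rule clinear_compose[OF clinear_slice_right[OF \<omega>] clinear_lcop(2)])
  have compat: "x * slice_right \<omega> (el y) = slice_right \<omega> (lcop x a) * y" for x y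
  proof -
    have "(mult_of x \<otimes>\<^sub>M 1) \<rhd> el y = lcop x a \<lhd> (mult_of y \<otimes>\<^sub>M 1)"
      by (rule T_mult_of_eqD) (simp add: el mult_of_lcop mult.assoc flip: T_mult_of_times)
    from arg_cong[OF this, of "slice_right \<omega>"] show ?thesis
      by (simp add: slice_right_lact_left slice_right_ract_left \<omega>)
  qed
  show ?thesis
    using make_multiplier_act(2)[OF l r compat]
    unfolding slice_snd_def slice_right_def el_def lcop_def .
qed

lemma ract_slice_fst:
  assumes \<omega>: "clinear \<omega>"
  shows "b \<lhd> slice_fst \<omega> (\<Delta> a) = slice_left \<omega> (rcop b a)"
proof -
  define el where "el b = elem_of (\<Delta> a * (1 \<otimes>\<^sub>M mult_of b))" for b
  have el: "mult_of (el b) = \<Delta> a * (1 \<otimes>\<^sub>M mult_of b)" for b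
    using comultiplication unfolding regular_comultiplication_def el_def by (simp add: T_mult_of_elem_of)
  have "clinear el"
    by (rule clinearI; rule T_mult_of_eqD) (simp_all add: el mult_of_add mult_of_scaleC mult_tensor_bilinear distrib_left)
  then have l: "clinear (\<lambda>b. slice_left \<omega> (el b))"
    by (rule clinear_compose[OF clinear_slice_left[OF \<omega>]])
  have r: "clinear (\<lambda>b. slice_left \<omega> (rcop b a))"
    by (rule clinear_compose[OF clinear_slice_left[OF \<omega>] clinear_rcop(2)])
  have compat: "x * slice_left \<omega> (el y) = slice_left \<omega> (rcop x a) * y" for x y
  proof -
    have "(1 \<otimes>\<^sub>M mult_of x) \<rhd> el y = rcop x a \<lhd> (1 \<otimes>\<^sub>M mult_of y)"
      by (rule T_mult_of_eqD) (simp add: el mult_of_rcop mult.assoc flip: T_mult_of_times)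
    from arg_cong[OF this, of "slice_left \<omega>"] show ?thesis
      by (simp add: slice_left_lact_right slice_left_ract_right \<omega>)
  qed
  show ?thesis
    using make_multiplier_act(2)[OF l r compat]
    unfolding slice_fst_def slice_left_def el_def rcop_def .
qed

text \<open>The counit.\<close>

definition \<epsilon> :: "'a \<Rightarrow> complex" where
  "\<epsilon> = (SOME \<epsilon>. counit A \<Delta> \<epsilon>)"

lemma counit: "counit A \<Delta> \<epsilon>"
proof -
  have "\<exists>\<epsilon>. counit A \<Delta> \<epsilon>" using bialgebra by (simp add: regular_partial_multiplier_bialgebra_def)
  then show ?thesis unfolding \<epsilon>_def by (rule someI_ex)
qed

lemma clinear_\<epsilon>: "clinear \<epsilon>"
  using counit by (simp add: counit_def)

lemma slice_\<epsilon>: "slice_right \<epsilon> (lcop p q) = p * q" "slice_left \<epsilon> (rcop p q) = p * q"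
proof -
  have "slice_snd \<epsilon> (\<Delta> q) = mult_of q" "slice_fst \<epsilon> (\<Delta> q) = mult_of q"
    using counit unfolding counit_def by blast+
  then show "slice_right \<epsilon> (lcop p q) = p * q" "slice_left \<epsilon> (rcop p q) = p * q"
    by (simp_all flip: ract_slice_snd[OF clinear_\<epsilon>] ract_slice_fst[OF clinear_\<epsilon>])
qed

lemma functional_eq_zeroI:
  assumes "clinear f" "\<And>k. f (a * e k) = 0"
  shows "f a = 0"
proof -
  obtain S where "finite S" and S: "a \<lhd> (\<Sum>k\<in>S. base_unit A k) = a"
    using local_units[of a] by blast
  have "clinear (\<lambda>m. a \<lhd> m)" by (rule clinearI) simp_all
  then have "a = (\<Sum>k\<in>S. a * e k)"
    using S by (simp add: clinear_sum flip: mult_of_act(2) mult_of_e)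
  then have "f a = (\<Sum>k\<in>S. f (a * e k))" using clinear_sum[OF assms(1), of "\<lambda>k. a * e k" S] by simp
  then show ?thesis using assms(2) by simp
qed

lemma e_diagonal_nonzero: "e (r, r) \<noteq> 0"
proof
  assume zero: "e (r, r) = 0"
  obtain a where a: "a \<lhd> lo r = a" and "\<epsilon> a \<noteq> 0"
  proof -
    have "\<exists>a\<in>right_lower A r. \<epsilon> a \<noteq> 0" using counit unfolding counit_def by blast
    then obtain b where "\<epsilon> (b \<lhd> lo r) \<noteq> 0" by (auto simp: right_lower_def)
    then show ?thesis using that[of "b \<lhd> lo r"] by simp
  qed
  have "\<epsilon> (b \<lhd> lo r) = 0" for b
  proof (rule component_eqI[where f = "\<lambda>b. \<epsilon> (b \<lhd> lo r)" and g = "\<lambda>_. 0"])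
    show "clinear (\<lambda>b. \<epsilon> (b \<lhd> lo r))" by (rule clinear_compose[OF clinear_\<epsilon> clinear_ract])
    fix k l b assume b: "b \<in> A k l"
    show "\<epsilon> (b \<lhd> lo r) = 0"
    proof (cases "l = (r, r)")
      case True
      then have "b = b * e (r, r)" using b by (simp add: e_mult)
      then show ?thesis using zero by (simp add: clinear_zero[OF clinear_\<epsilon>])
    next
      case False
      then have "\<epsilon> b = 0" if "snd l = r"
        using counit b that unfolding counit_def by (metis prod.collapse)
      then show ?thesis using b by (auto simp: lo_act clinear_zero[OF clinear_\<epsilon>])
    qed
  qed (rule clinear_const_zero)
  then show False using a \<open>\<epsilon> a \<noteq> 0\<close> by metis
qed

text \<open>The canonical map \<open>T(p \<otimes> q) = (p \<otimes> 1)\<Delta>(q)\<close>, defined on all of \<open>A \<otimes> A\<close>. It restricts to a bijection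
  from \<open>\<Oplus>\<^sub>r A\<^sup>r \<otimes> \<^sup>rA\<close> to \<open>\<Oplus>\<^sub>r A\<^sub>r \<otimes> A\<^sup>r\<close>.\<close>

definition canonical :: "('a, 'a) tensor \<Rightarrow> ('a, 'a) tensor" where
  "canonical = tensor_lift lcop"

abbreviation canonical_domain :: "('a, 'a) tensor set" where
  "canonical_domain \<equiv> tensor_sum (right_upper A) (left_upper A)"

lemma canonical_tensor: "canonical (p \<otimes> q) = lcop p q"
  by (simp add: canonical_def tensor_lift_clinear_simps cbilinear_lcop)

lemma clinear_canonical: "clinear canonical"
  unfolding canonical_def by (rule clinear_tensor_lift[OF cbilinear_lcop])

lemma bij_betw_canonical:
  "bij_betw canonical canonical_domain (tensor_sum (right_lower A) (right_upper A))"
  using Hopf unfolding regular_partial_multiplier_Hopf_algebra_def canonical_def lcop_def[abs_def] by blast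

lemma right_upper_iff: "x \<in> right_upper A r \<longleftrightarrow> x \<lhd> up r = x"
  and left_upper_iff: "x \<in> left_upper A r \<longleftrightarrow> up r \<rhd> x = x"
  and right_lower_iff: "x \<in> right_lower A r \<longleftrightarrow> x \<lhd> lo r = x"
  unfolding right_upper_def left_upper_def right_lower_def
  by (auto intro: exI[of _ x] dest: sym)

lemma canonical_surj:
  assumes "x \<lhd> lo t = x" "y \<lhd> up t = y"
  obtains z where "z \<in> canonical_domain" "canonical z = x \<otimes> y"
proof -
  have "x \<otimes> y \<in> tensor_sum (right_lower A) (right_upper A)"
    unfolding tensor_sum_def using assms by (intro cvec.span_base) (auto simp: right_upper_iff right_lower_iff)
  then show ?thesis
    using that bij_betw_canonical unfolding bij_betw_def by (metis imageE)
qed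

lemma canonical_injD:
  assumes "z \<in> canonical_domain" "canonical z = 0"
  shows "z = 0"
proof (rule inj_onD[OF bij_betw_imp_inj_on[OF bij_betw_canonical]])
  show "canonical z = canonical 0" by (simp add: assms(2) clinear_zero[OF clinear_canonical])
  show "0 \<in> canonical_domain" unfolding tensor_sum_def by (rule cvec.span_zero)
qed (rule assms(1))

lemma canonical_domain_eqI:
  assumes "z \<in> canonical_domain" "clinear f" "clinear g"
    "\<And>p q r. p \<lhd> up r = p \<Longrightarrow> up r \<rhd> q = q \<Longrightarrow> f (p \<otimes> q) = g (p \<otimes> q)"
  shows "f z = g z"
  by (rule cspan_clinear_eq[OF assms(1)[unfolded tensor_sum_def] assms(2,3)])
    (auto simp: right_upper_iff left_upper_iff assms(4))

lemma canonical_counit: "slice_right \<epsilon> (canonical z) = tensor_lift (\<lambda>p q. p * q) z"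
proof (rule tensor_clinear_ext[where x = z])
  have mult: "cbilinear (\<lambda>p q :: 'a. p * q)" by (rule cbilinearI) (simp_all add: distrib_left distrib_right)
  show "clinear (\<lambda>z. slice_right \<epsilon> (canonical z))"
    by (rule clinear_compose[OF clinear_slice_right[OF clinear_\<epsilon>] clinear_canonical])
  show "clinear (tensor_lift (\<lambda>p q :: 'a. p * q))" by (rule clinear_tensor_lift[OF mult])
  show "slice_right \<epsilon> (canonical (p \<otimes> q)) = tensor_lift (\<lambda>p q. p * q) (p \<otimes> q)" for p q
    by (simp add: canonical_tensor slice_\<epsilon> tensor_lift_clinear_simps[OF mult])
qed

lemma canonical_conv:
  "clinear \<omega> \<Longrightarrow> canonical (tensor_map (\<lambda>a. a) (conv \<omega> b) z) = tensor_map (\<lambda>a. a) (conv \<omega> b) (canonical z)"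
  by (rule tensor_clinear_ext[where x = z])
    (simp_all add: clinear_compose clinear_canonical clinear_tensor_map clinear_ident clinear_conv
      tensor_map_tensor canonical_tensor lcop_conv)

lemma conv_in_canonical_domain:
  assumes \<omega>: "clinear \<omega>" and z: "z \<in> canonical_domain"
  shows "tensor_map (\<lambda>a. a) (conv \<omega> b) z \<in> canonical_domain"
  using z unfolding tensor_sum_def
proof (induction rule: cvec.span_induct_alt)
  case base
  show ?case by (simp add: clinear_zero clinear_tensor_map clinear_ident clinear_conv \<omega> cvec.span_zero)
next
  case (step c x y)
  then obtain p q r where x: "x = p \<otimes> q" and p: "p \<in> right_upper A r" and q: "up r \<rhd> q = q"
    by (auto simp: left_upper_iff)
  have "conv \<omega> b q \<in> left_upper A r"
    using conv_upper[OF \<omega> diagonal_up, of b r q] q by (simp add: left_upper_iff)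
  then have "p \<otimes> conv \<omega> b q \<in> cspan {a \<otimes> b |a b r. a \<in> right_upper A r \<and> b \<in> left_upper A r}"
    using p by (intro cvec.span_base) blast
  then show ?case
    using step.IH by (simp add: x clinear_add clinear_scaleC clinear_tensor_map clinear_ident clinear_conv \<omega>
        tensor_map_tensor cvec.span_add cvec.span_scale)
qed

lemma \<epsilon>_conv: "clinear \<omega> \<Longrightarrow> \<epsilon> (conv \<omega> b q) = \<omega> (b * q)"
  unfolding conv_def by (simp add: slice_left_slice_right clinear_\<epsilon> slice_\<epsilon>)

section \<open>Invariant functionals\<close>

lemma diagonal_ract_up:
  assumes D: "diagonal D (\<lambda>k. c (fst k))" and "b \<lhd> up r = b"
  shows "b \<lhd> D = c r *\<^sub>C b"
proof -
  have "a \<lhd> up r \<lhd> D = c r *\<^sub>C (a \<lhd> up r)" for a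
    by (rule component_eqI[where a = a])
      (auto intro!: clinear_ract_compose clinearI simp: clinear_ract act_simps scaleC_add_right scaleC_scaleC mult.commute
        up_act diagonal_act[OF D])
  then show ?thesis using assms(2) by metis
qed

lemma diagonal_ract_lo:
  assumes D: "diagonal D (\<lambda>k. c (snd k))" and "b \<lhd> lo r = b"
  shows "b \<lhd> D = c r *\<^sub>C b"
proof -
  have "a \<lhd> lo r \<lhd> D = c r *\<^sub>C (a \<lhd> lo r)" for a
    by (rule component_eqI[where a = a])
      (auto intro!: clinear_ract_compose clinearI simp: clinear_ract act_simps scaleC_add_right scaleC_scaleC mult.commute
        lo_act diagonal_act[OF D])
  then show ?thesis using assms(2) by metis
qed

lemma diagonal_sum_up: "diagonal (strict_sum (\<lambda>r. c r *\<^sub>C up r)) (\<lambda>k. c (fst k))"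
proof -
  have D: "diagonal (c r *\<^sub>C up r) (\<lambda>k. if fst k = r then c r else 0)" for r
    by (auto simp: diagonal_def up_act)
  have "{r. (if fst k = r then c r else 0) \<noteq> 0} = (if c (fst k) = 0 then {} else {fst k})" for k :: "'i \<times> 'i"
    by auto
  from diagonal_strict_sum[of "\<lambda>r. c r *\<^sub>C up r" "\<lambda>r k. if fst k = r then c r else 0", OF D, unfolded this] show ?thesis by (simp add: diagonal_def)
qed

lemma diagonal_sum_lo: "diagonal (strict_sum (\<lambda>t. c t *\<^sub>C lo t)) (\<lambda>k. c (snd k))"
proof -
  have D: "diagonal (c t *\<^sub>C lo t) (\<lambda>k. if snd k = t then c t else 0)" for t
    by (auto simp: diagonal_def lo_act)
  have "{t. (if snd k = t then c t else 0) \<noteq> 0} = (if c (snd k) = 0 then {} else {snd k})" for k :: "'i \<times> 'i"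
    by auto
  from diagonal_strict_sum[of "\<lambda>t. c t *\<^sub>C lo t" "\<lambda>t k. if snd k = t then c t else 0", OF D, unfolded this] show ?thesis by (simp add: diagonal_def)
qed

lemma ract_sum_up: "b \<lhd> up r = b \<Longrightarrow> b \<lhd> strict_sum (\<lambda>r. c r *\<^sub>C up r) = c r *\<^sub>C b"
  by (rule diagonal_ract_up[OF diagonal_sum_up])

lemma ract_sum_lo: "b \<lhd> lo t = b \<Longrightarrow> b \<lhd> strict_sum (\<lambda>t. c t *\<^sub>C lo t) = c t *\<^sub>C b"
  by (rule diagonal_ract_lo[OF diagonal_sum_lo])

text \<open>The functional vanishes on all components \<open>A k l\<close> with \<open>k \<noteq> l\<close>; invariant functionals do by
  definition. Such functionals satisfy \<open>\<phi>(Da) = \<phi>(aD)\<close> for diagonal \<open>D\<close>.\<close>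

definition supported_on_diagonal :: "('a \<Rightarrow> complex) \<Rightarrow> bool" where
  "supported_on_diagonal \<phi> \<longleftrightarrow> (\<forall>k l. k \<noteq> l \<longrightarrow> (\<forall>a\<in>A k l. \<phi> a = 0))"

lemma supported_on_diagonalD: "supported_on_diagonal \<phi> \<Longrightarrow> a \<in> A k l \<Longrightarrow> k \<noteq> l \<Longrightarrow> \<phi> a = 0"
  unfolding supported_on_diagonal_def by blast

lemma supported_on_diagonal_iff:
  "supported_on_diagonal \<phi> \<longleftrightarrow>
     (\<forall>r s r' s'. (r', s') \<noteq> (r, s) \<longrightarrow> (\<forall>a\<in>A (r, s) (r', s'). \<phi> a = 0))"
  unfolding supported_on_diagonal_def split_paired_All by metis

lemma supported_on_diagonal_commute:
  assumes "clinear \<phi>" "supported_on_diagonal \<phi>" "diagonal D c"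
  shows "\<phi> (D \<rhd> a) = \<phi> (a \<lhd> D)"
proof (rule component_eqI[where a = a])
  fix k l a assume a: "a \<in> A k l"
  have "\<phi> a = 0" if "k \<noteq> l"
    using assms(2) a that unfolding supported_on_diagonal_def by blast
  then show "\<phi> (D \<rhd> a) = \<phi> (a \<lhd> D)"
    by (cases "k = l") (simp_all add: diagonal_act[OF assms(3) a] clinear_scaleC[OF assms(1)])
qed (rule clinear_compose[OF assms(1) clinear_lact] clinear_compose[OF assms(1) clinear_ract])+

lemma diagonal_e: "diagonal (mult_of (e k)) (\<lambda>l. if l = k then 1 else 0)"
  unfolding mult_of_e by (rule diagonal_base_unit)

lemma supported_on_diagonal_e:
  "clinear \<phi> \<Longrightarrow> supported_on_diagonal \<phi> \<Longrightarrow> \<phi> (e k * a) = \<phi> (a * e k)"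
  using supported_on_diagonal_commute[OF _ _ diagonal_e, of \<phi> k a] by simp

text \<open>Left invariance tested on elements: \<open>(id \<otimes> \<phi>)((b \<otimes> 1)\<Delta>(a)) = \<phi>(\<one>\<^sup>ra)b\<close> for \<open>b\<close> in \<open>A\<one>\<^sup>r\<close>.\<close>

lemma left_invariant_iff:
  "left_invariant A \<Delta> \<phi> \<longleftrightarrow> clinear \<phi> \<and> supported_on_diagonal \<phi> \<and>
     (\<forall>a b r. b \<lhd> up r = b \<longrightarrow> slice_right \<phi> (lcop b a) = \<phi> (up r \<rhd> a) *\<^sub>C b)"
proof -
  have "(\<forall>a. slice_snd \<phi> (\<Delta> a) = strict_sum (\<lambda>r. \<phi> (up r \<rhd> a) *\<^sub>C up r)) \<longleftrightarrow>
      (\<forall>a b r. b \<lhd> up r = b \<longrightarrow> slice_right \<phi> (lcop b a) = \<phi> (up r \<rhd> a) *\<^sub>C b)"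
    (is "?l \<longleftrightarrow> ?r") if \<phi>: "clinear \<phi>"
  proof
    assume ?l
    then show ?r
      by (auto simp: ract_sum_up simp flip: ract_slice_snd[OF \<phi>])
  next
    assume r: ?r
    show ?l
    proof
      fix a show "slice_snd \<phi> (\<Delta> a) = strict_sum (\<lambda>r. \<phi> (up r \<rhd> a) *\<^sub>C up r)"
      proof (rule A_multiplier_eqI)
        fix b show "b \<lhd> slice_snd \<phi> (\<Delta> a) = b \<lhd> strict_sum (\<lambda>r. \<phi> (up r \<rhd> a) *\<^sub>C up r)"
        proof (rule component_eqI[where a = b])
          fix k l b assume "b \<in> A k l"
          then have "b \<lhd> up (fst l) = b" by (simp add: up_act)
          then show "b \<lhd> slice_snd \<phi> (\<Delta> a) = b \<lhd> strict_sum (\<lambda>r. \<phi> (up r \<rhd> a) *\<^sub>C up r)"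
            using r by (simp add: ract_slice_snd[OF \<phi>] ract_sum_up)
        qed (rule clinear_ract)+
      qed
    qed
  qed
  then show ?thesis unfolding left_invariant_def supported_on_diagonal_iff by blast
qed

lemma right_invariantI:
  assumes \<psi>: "clinear \<psi>" "supported_on_diagonal \<psi>"
    and slice: "\<And>a b s. b \<lhd> lo s = b \<Longrightarrow> slice_left \<psi> (rcop b a) = \<psi> (lo s \<rhd> a) *\<^sub>C b"
  shows "right_invariant A \<Delta> \<psi>"
proof -
  have "slice_fst \<psi> (\<Delta> a) = strict_sum (\<lambda>s. \<psi> (lo s \<rhd> a) *\<^sub>C lo s)" for a
  proof (rule A_multiplier_eqI)
    fix b show "b \<lhd> slice_fst \<psi> (\<Delta> a) = b \<lhd> strict_sum (\<lambda>r. \<psi> (lo r \<rhd> a) *\<^sub>C lo r)"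
    proof (rule component_eqI[where a = b])
      fix k l b assume "b \<in> A k l"
      then have "b \<lhd> lo (snd l) = b" by (simp add: lo_act)
      then show "b \<lhd> slice_fst \<psi> (\<Delta> a) = b \<lhd> strict_sum (\<lambda>r. \<psi> (lo r \<rhd> a) *\<^sub>C lo r)"
        using slice by (simp add: ract_slice_fst[OF \<psi>(1)] ract_sum_lo)
    qed (rule clinear_ract)+
  qed
  then show ?thesis using \<psi> unfolding right_invariant_def supported_on_diagonal_iff by blast
qed


section \<open>Faithfulness of normalized invariant functionals\<close>

text \<open>The null space \<open>N = {n. \<phi>(bn) = 0 for all b}\<close> of a left invariant functional \<open>\<phi>\<close> is a left coideal:
  \<open>(id \<otimes> \<phi>)((x \<otimes> b)\<Delta>(n)) = 0\<close> for \<open>n\<close> in \<open>N\<close>. Indeed, by surjectivity of the canonical map, \<open>x \<otimes> b\<close> is a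
  sum of elements \<open>(p \<otimes> 1)\<Delta>(q)\<close>, and \<open>(p \<otimes> 1)\<Delta>(q)\<Delta>(n) = (p \<otimes> 1)\<Delta>(qn)\<close> is evaluated by invariance.\<close>

lemma conv_null:
  assumes inv: "left_invariant A \<Delta> \<phi>" and null: "\<And>b. \<phi> (b * n) = 0"
  shows "conv \<phi> b n = 0"
proof -
  have \<phi>: "clinear \<phi>" and slice: "\<And>a b r. b \<lhd> up r = b \<Longrightarrow> slice_right \<phi> (lcop b a) = \<phi> (up r \<rhd> a) *\<^sub>C b"
    using inv by (auto simp: left_invariant_iff)
  have component: "x * conv \<phi> b n = 0" if x: "x \<in> A j (s, t)" and b: "b \<in> A j' (t', v)" for x b j j' s t t' v
  proof (cases "t = t'")
    case False
    then show ?thesis using ract_\<Delta>_mismatch[OF x b False, of n]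
      by (simp add: clinear_zero[OF clinear_slice_right[OF \<phi>]] flip: slice_right_ract_\<Delta>[OF \<phi>])
  next
    case True
    obtain z where z: "z \<in> canonical_domain" "canonical z = x \<otimes> b"
      by (rule canonical_surj[of x t b]) (use x b True in \<open>auto simp: up_act lo_act\<close>)
    have "slice_right \<phi> (canonical z \<lhd> \<Delta> n) = 0"
    proof (rule canonical_domain_eqI[OF z(1), where g = "\<lambda>_. 0"])
      fix p q r assume pq: "p \<lhd> up r = p" "up r \<rhd> q = q"
      have "up r \<rhd> (q * n) = q * n" using pq(2) by (simp add: A_lact_mult)
      then show "slice_right \<phi> (canonical (p \<otimes> q) \<lhd> \<Delta> n) = 0"
        by (simp add: canonical_tensor lcop_ract_\<Delta> slice[OF pq(1)] null)
    qed (intro clinear_compose[OF clinear_slice_right[OF \<phi>]] clinear_ract_compose clinear_canonical clinear_const_zero)+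
    then show ?thesis by (simp add: z(2) slice_right_ract_\<Delta> \<phi>)
  qed
  show ?thesis
  proof (rule A_eq_right)
    fix x
    have "x * conv \<phi> b n = 0"
    proof (rule component_eqI[where a = x and g = "\<lambda>_. 0"])
      fix k l x assume x: "x \<in> A k l"
      show "x * conv \<phi> b n = 0"
      proof (rule component_eqI[where a = b and g = "\<lambda>_. 0"])
        show "clinear (\<lambda>b. x * conv \<phi> b n)"
          by (rule clinear_compose[OF clinear_times_left clinear_conv(2)[OF \<phi>]])
        show "x * conv \<phi> b n = 0" if "b \<in> A k' l'" for k' l' b
          using component[of x k "fst l" "snd l" b k' "fst l'" "snd l'"] x that by simp
      qed (rule clinear_const_zero)
    qed (rule clinear_times_right clinear_const_zero)+
    then show "x * conv \<phi> b n = x * 0" by simp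
  qed
qed

lemma slice_right_zero_imp_in_span:
  fixes \<phi> :: "'a \<Rightarrow> complex"
  assumes \<phi>: "clinear \<phi>" and zero: "\<And>b. slice_right (\<lambda>y. \<phi> (b * y)) z = 0"
  shows "z \<in> cspan {x \<otimes> y |x y. \<forall>b. \<phi> (b * y) = 0}"
  by (rule slices_zero_imp_in_span) (simp_all add: zero clinear_compose[OF \<phi> clinear_times_left])

text \<open>If the canonical map sends an element \<open>z\<close> of its domain to \<open>x \<otimes> n\<close> with \<open>n\<close> in \<open>N\<close>, then \<open>z\<close> lies
  in \<open>A \<otimes> N\<close>. In a Hopf algebra \<open>z\<close> would be
  \<open>xS(n\<^sub>1) \<otimes> n\<^sub>2\<close>; here injectivity of the canonical map replaces the antipode \<open>S\<close>.\<close>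

lemma canonical_preimage_null:
  assumes inv: "left_invariant A \<Delta> \<phi>" and null: "\<And>b. \<phi> (b * n) = 0"
    and z: "z \<in> canonical_domain" "canonical z = x \<otimes> n"
  shows "z \<in> cspan {x \<otimes> y |x y. \<forall>b. \<phi> (b * y) = 0}"
proof -
  have \<phi>: "clinear \<phi>" using inv by (simp add: left_invariant_iff)
  show ?thesis
  proof (rule slice_right_zero_imp_in_span[OF \<phi>])
    fix b
    have "canonical (tensor_map (\<lambda>a. a) (conv \<phi> b) z) = 0"
      by (simp add: canonical_conv \<phi> z(2) tensor_map_tensor clinear_ident clinear_conv conv_null[OF inv null])
    then have "tensor_map (\<lambda>a. a) (conv \<phi> b) z = 0"
      by (rule canonical_injD[OF conv_in_canonical_domain[OF \<phi> z(1)]])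
    then have "slice_right \<epsilon> (tensor_map (\<lambda>a. a) (conv \<phi> b) z) = 0"
      by (simp add: clinear_zero[OF clinear_slice_right[OF clinear_\<epsilon>]])
    then show "slice_right (\<lambda>y. \<phi> (b * y)) z = 0"
      by (simp add: slice_right_map clinear_\<epsilon> clinear_ident clinear_conv \<phi> \<epsilon>_conv)
  qed
qed

text \<open>The counit vanishes on \<open>N\<close>. It is enough to consider \<open>n\<close> in \<open>A\<one>\<^sup>t\<close>. Take \<open>x = \<one>(t,t)\<close> and let \<open>z\<close> be the preimage of \<open>x \<otimes> n\<close> under the canonical
  map. Its image under the multiplication map is \<open>\<epsilon>(n)x\<close>, and \<open>\<phi>\<close> vanishes on it because \<open>z\<close> lies in
  \<open>A \<otimes> N\<close>; but \<open>\<phi>(x) = 1\<close>.\<close>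

lemma counit_null:
  assumes inv: "left_invariant A \<Delta> \<phi>" and norm: "\<And>r. \<phi> (e (r, r)) = 1"
    and null: "\<And>b. \<phi> (b * n) = 0"
  shows "\<epsilon> n = 0"
proof (rule functional_eq_zeroI[OF clinear_\<epsilon>])
  fix k :: "'i \<times> 'i"
  obtain t v where k: "k = (t, v)" by (cases k)
  have \<phi>: "clinear \<phi>" "supported_on_diagonal \<phi>" using inv by (simp_all add: left_invariant_iff)
  have null_k: "\<phi> (b * (n * e k)) = 0" for b
    using supported_on_diagonal_e[OF \<phi>, of k "b * n"] null[of "e k * b"] by (simp add: mult.assoc)
  have "(n * e k) \<lhd> up t = n * e k" "e (t, t) \<lhd> lo t = e (t, t)"
    by (simp_all add: A_ract_mult up_act[OF e_in_component] lo_act[OF e_in_component] k)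
  then obtain z where z: "z \<in> canonical_domain" "canonical z = e (t, t) \<otimes> (n * e k)"
    using canonical_surj by blast
  have mult: "cbilinear (\<lambda>p q :: 'a. p * q)" by (rule cbilinearI) (simp_all add: distrib_left distrib_right)
  have "\<phi> (tensor_lift (\<lambda>p q. p * q) z) = 0"
    by (rule cspan_eq_zero[OF canonical_preimage_null[OF inv null_k z] clinear_compose[OF \<phi>(1) clinear_tensor_lift[OF mult]]])
      (auto simp: tensor_lift_clinear_simps[OF mult])
  also have "tensor_lift (\<lambda>p q. p * q) z = \<epsilon> (n * e k) *\<^sub>C e (t, t)"
    using canonical_counit[of z] by (simp add: z(2) slice_right_tensor clinear_\<epsilon>)
  finally show "\<epsilon> (n * e k) = 0"
    by (simp add: clinear_scaleC[OF \<phi>(1)] norm scaleC_complex_def)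
qed

text \<open>A left coideal on which the counit vanishes is zero.\<close>

theorem normalized_left_invariant_null:
  assumes inv: "left_invariant A \<Delta> \<phi>" and norm: "\<And>r. \<phi> (e (r, r)) = 1"
    and null: "\<And>b. \<phi> (b * n) = 0"
  shows "n = 0"
proof (rule A_eq_right)
  fix c
  have \<phi>: "clinear \<phi>" using inv by (simp add: left_invariant_iff)
  have "slice_right (\<lambda>y. \<phi> (b * y)) (lcop c n) = 0" for b
  proof -
    have "slice_right (\<lambda>y. \<phi> (b * y)) (lcop c n) = slice_right \<phi> ((1 \<otimes>\<^sub>M mult_of b) \<rhd> lcop c n)"
      by (simp add: slice_right_lact_right \<phi>)
    also have "\<dots> = c * conv \<phi> b n"
      by (simp add: slice_right_ract_\<Delta> \<phi> flip: tensor_ract_\<Delta>(1))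
    finally show ?thesis by (simp add: conv_null[OF inv null])
  qed
  then have "lcop c n \<in> cspan {x \<otimes> y |x y. \<forall>b. \<phi> (b * y) = 0}"
    by (rule slice_right_zero_imp_in_span[OF \<phi>])
  then have "slice_right \<epsilon> (lcop c n) = 0"
    by (rule cspan_eq_zero[OF _ clinear_slice_right[OF clinear_\<epsilon>]])
      (auto simp: slice_right_tensor clinear_\<epsilon> counit_null[OF inv norm])
  then show "c * n = c * 0" by (simp add: slice_\<epsilon>)
qed

section \<open>Right invariance of faithful left invariant functionals\<close>

lemma lcop_e: "lcop (e (k, t)) (e (k, l)) = e (k, t) \<otimes> e (t, l)"
proof -
  have "(e (k, t) \<otimes> e (t, l)) \<lhd> \<Delta> (e (k, l)) = e (k, t) \<otimes> e (t, l)"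
    using ract_\<Delta>_e[OF e_in_component e_in_component] by simp
  then have *: "(1 \<otimes>\<^sub>M mult_of (e (t, l))) \<rhd> lcop (e (k, t)) (e (k, l)) = e (k, t) \<otimes> e (t, l)"
    by (simp add: tensor_ract_\<Delta>(1))
  have "e (k, l) = lo l \<rhd> e (k, l)" "e (k, t) = e (k, t) \<lhd> lo t"
    by (simp_all add: lo_act[OF e_in_component])
  then have "lcop (e (k, t)) (e (k, l)) = (1 \<otimes>\<^sub>M up t) \<rhd> (1 \<otimes>\<^sub>M lo l) \<rhd> lcop (e (k, t)) (e (k, l))"
    using lcop_middle[of "e (k, t)" t "e (k, l)"] lcop_lower[OF diagonal_lo, of "e (k, t)" l "e (k, l)"] by simp
  also have "\<dots> = (1 \<otimes>\<^sub>M mult_of (e (t, l))) \<rhd> lcop (e (k, t)) (e (k, l))"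
    by (simp add: mult_tensor_mult up_mult_lo flip: times_act)
  finally show ?thesis using * by simp
qed

text \<open>Left invariance at \<open>\<one>(r,s)\<close>, whose coproduct has the components \<open>\<one>(r,t) \<otimes> \<one>(t,s)\<close>. Some base units
  \<open>\<one>(r,t)\<close> may be zero.\<close>

lemma left_invariant_e:
  assumes inv: "left_invariant A \<Delta> h" and "e (r, t) \<noteq> 0"
  shows "h (e (t, s)) = h (e (r, s))"
proof -
  have h: "clinear h" and slice: "\<And>a b r. b \<lhd> up r = b \<Longrightarrow> slice_right h (lcop b a) = h (up r \<rhd> a) *\<^sub>C b"
    using inv by (auto simp: left_invariant_iff)
  have "h (e (t, s)) *\<^sub>C e (r, t) = h (e (r, s)) *\<^sub>C e (r, t)"
    using slice[of "e (r, t)" r "e (r, s)"]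
    by (simp add: lcop_e slice_right_tensor h up_act[OF e_in_component])
  then have "(h (e (t, s)) - h (e (r, s))) *\<^sub>C e (r, t) = 0" by (simp add: cvec.scale_left_diff_distrib)
  then show ?thesis using assms(2) by simp
qed

text \<open>If \<open>h\<close> is left invariant, then the left invariance identity also holds for the convolution
  \<open>\<psi>(a) = (h \<otimes> h)((1 \<otimes> b)\<Delta>(a))\<close> of \<open>h\<close> and \<open>h(b \<cdot>)\<close>.\<close>

lemma left_invariant_convolution:
  assumes inv: "left_invariant A \<Delta> h" and x: "x \<lhd> up k = x"
  shows "slice_right (\<lambda>a. h (conv h b a)) (lcop x a) = h (conv h b (up k \<rhd> a)) *\<^sub>C x"
proof -
  have h: "clinear h" and slice: "\<And>a b r. b \<lhd> up r = b \<Longrightarrow> slice_right h (lcop b a) = h (up r \<rhd> a) *\<^sub>C b"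
    using inv by (auto simp: left_invariant_iff)
  have "slice_right (\<lambda>a. h (conv h b a)) (lcop x a) = slice_right h (lcop x (conv h b a))"
    by (simp add: lcop_conv slice_right_map h clinear_conv clinear_ident)
  then show ?thesis by (simp add: slice[OF x] conv_upper[OF h diagonal_up])
qed

text \<open>If \<open>h\<close> is moreover faithful, then \<open>\<psi>\<close> is a multiple of \<open>h\<close> on each \<open>A\<one>\<^sub>n\<close>. First, \<open>\<psi>(\<one>\<^sup>ka) = h(f\<^sub>ka)\<close> for
  elements \<open>f\<^sub>k\<close> obtained from a preimage of \<open>\<one>(k,t) \<otimes> b\<close> under the canonical map \<open>T\<close>. By left invariance of
  \<open>\<psi>\<close> and faithfulness, \<open>T(\<one>(k,u) \<otimes> f\<^sub>k) = \<one>(k,u) \<otimes> f\<^sub>u\<close>, and the counit turns this into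
  \<open>\<one>(k,u)f\<^sub>k = \<epsilon>(f\<^sub>u)\<one>(k,u)\<close>. If \<open>I\<close> is a point, this says that \<open>f\<close> is a scalar.\<close>

lemma convolution_eq_scaled:
  assumes inv: "left_invariant A \<Delta> h" and faithful: "\<And>y. (\<And>a. h (y * a) = 0) \<Longrightarrow> y = 0"
    and b: "b \<in> A j (t, v)"
  shows "\<exists>\<mu>. \<forall>k l m n. \<forall>a\<in>A (k, l) (m, n). h (conv h b a) = \<mu> n * h a"
proof -
  have h: "clinear h" "supported_on_diagonal h"
    and slice: "\<And>a b r. b \<lhd> up r = b \<Longrightarrow> slice_right h (lcop b a) = h (up r \<rhd> a) *\<^sub>C b"
    using inv by (auto simp: left_invariant_iff)
  define \<psi> where "\<psi> a = h (conv h b a)" for a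
  have \<psi>: "clinear \<psi>" unfolding \<psi>_def by (rule clinear_compose[OF h(1) clinear_conv(1)[OF h(1)]])
  have h_right: "clinear (\<lambda>q. h (q * a))" for a by (rule clinear_compose[OF h(1) clinear_times_right])
  have h_up: "clinear (\<lambda>p. h (up k \<rhd> p))" for k by (rule clinear_compose[OF h(1) clinear_lact])
  have slice_canonical: "slice_right h (canonical z \<lhd> \<Delta> a) = slice_right (\<lambda>q. h (q * a)) z"
    if "z \<in> canonical_domain" for z a
  proof (rule canonical_domain_eqI[OF that])
    fix p q r assume pq: "p \<lhd> up r = p" "up r \<rhd> q = q"
    have "up r \<rhd> (q * a) = q * a" using pq(2) by (simp add: A_lact_mult)
    then show "slice_right h (canonical (p \<otimes> q) \<lhd> \<Delta> a) = slice_right (\<lambda>q. h (q * a)) (p \<otimes> q)"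
      by (simp add: canonical_tensor lcop_ract_\<Delta> slice[OF pq(1)] slice_right_tensor h_right)
  qed (intro clinear_compose[OF clinear_slice_right[OF h(1)]] clinear_ract_compose clinear_canonical
      clinear_slice_right h_right)+
  \<comment> \<open>On \<open>\<one>\<^sup>kA\<close> the functional \<open>\<psi>\<close> is \<open>h(f \<cdot>)\<close>, where \<open>f = (h(\<one>\<^sup>k \<cdot>) \<otimes> id)(z)\<close>. The factor \<open>\<one>\<^sup>k\<close> only
    serves to give \<open>f\<close> the left upper index \<open>k\<close>.\<close>
  have "\<exists>f. (\<forall>a. h (f * a) = \<psi> (up k \<rhd> a)) \<and> up k \<rhd> f = f" for k
  proof -
    obtain z where z: "z \<in> canonical_domain" "canonical z = e (k, t) \<otimes> b"
      by (rule canonical_surj[of "e (k, t)" t b]) (use b in \<open>auto simp: up_act lo_act[OF e_in_component]\<close>)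
    define f where "f = slice_left (\<lambda>p. h (up k \<rhd> p)) z"
    have "h (f * a) = \<psi> (up k \<rhd> a)" for a
    proof -
      have "h (f * a) = h (up k \<rhd> slice_right (\<lambda>q. h (q * a)) z)"
        unfolding f_def by (rule slice_left_slice_right[symmetric, OF h_up h_right])
      also have "\<dots> = h (up k \<rhd> (e (k, t) * conv h b a))"
        by (simp add: z(2) slice_right_ract_\<Delta> h(1) flip: slice_canonical[OF z(1)])
      also have "up k \<rhd> (e (k, t) * conv h b a) = up k \<rhd> lo t \<rhd> conv h b a"
        by (simp add: up_lo_act A_lact_mult up_act[OF e_in_component])
      also have "lo t \<rhd> conv h b a = conv h b a"
        using conv_middle[OF h(1), of b t a] b by (simp add: up_act)
      finally show ?thesis by (simp add: \<psi>_def conv_upper[OF h(1) diagonal_up])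
    qed
    moreover have "up k \<rhd> f = f"
      unfolding f_def
    proof (rule canonical_domain_eqI[OF z(1)])
      fix p q r assume pq: "p \<lhd> up r = p" "up r \<rhd> q = q"
      show "up k \<rhd> slice_left (\<lambda>p. h (up k \<rhd> p)) (p \<otimes> q) = slice_left (\<lambda>p. h (up k \<rhd> p)) (p \<otimes> q)"
      proof (cases "r = k")
        case True
        then show ?thesis using pq by (simp add: slice_left_tensor h_up act_simps)
      next
        case False
        have "a \<lhd> up r \<lhd> up k = 0" for a
          by (rule component_eqI[where a = a and g = "\<lambda>_. 0"])
            (use False in \<open>auto simp: clinear_ract_compose[OF clinear_ract] clinear_const_zero up_act\<close>)
        then have "p \<lhd> up k = 0" using pq(1) by metis
        then have "h (up k \<rhd> p) = 0"
          by (simp add: supported_on_diagonal_commute[OF h diagonal_up] clinear_zero[OF h(1)])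
        then show ?thesis by (simp add: slice_left_tensor h_up)
      qed
    qed (intro clinear_lact_compose clinear_slice_left h_up)+
    ultimately show ?thesis by blast
  qed
  then obtain f where f: "\<And>k a. h (f k * a) = \<psi> (up k \<rhd> a)" and up_f: "\<And>k. up k \<rhd> f k = f k" by metis
  have faithful_eq: "y = y'" if "\<And>a. h (y * a) = h (y' * a)" for y y'
    using faithful[of "y - y'"] that by (simp add: left_diff_distrib clinear_diff[OF h(1)])
  have f_up: "f k \<lhd> up k = f k" for k
    by (rule faithful_eq) (simp add: f flip: multiplier_compatible)
  have f_e: "e (k, u) * f k = \<epsilon> (f u) *\<^sub>C e (k, u)" for k u
  proof -
    obtain z where z: "z \<in> canonical_domain" "canonical z = e (k, u) \<otimes> f u"
      by (rule canonical_surj[of "e (k, u)" u "f u"]) (auto simp: f_up lo_act[OF e_in_component])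
    \<comment> \<open>Faithfulness of \<open>h\<close> identifies \<open>z\<close> with \<open>\<one>(k,u) \<otimes> f\<^sub>k\<close>, as both have the same slices by \<open>h(\<cdot> a)\<close>.\<close>
    have "slice_right (\<lambda>q. h (q * a)) z = slice_right (\<lambda>q. h (q * a)) (e (k, u) \<otimes> f k)" for a
    proof -
      have "slice_right (\<lambda>q. h (q * a)) z = slice_right h ((1 \<otimes>\<^sub>M mult_of (f u)) \<rhd> lcop (e (k, u)) a)"
        by (simp only: slice_canonical[OF z(1), symmetric] z(2) tensor_ract_\<Delta>(1))
      also have "\<dots> = slice_right \<psi> ((1 \<otimes>\<^sub>M up u) \<rhd> lcop (e (k, u)) a)"
        by (simp add: slice_right_lact_right h(1) \<psi> f)
      also have "(1 \<otimes>\<^sub>M up u) \<rhd> lcop (e (k, u)) a = lcop (e (k, u)) a"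
        using lcop_middle[of "e (k, u)" u a] by (simp add: lo_act[OF e_in_component])
      also have "slice_right \<psi> \<dots> = \<psi> (up k \<rhd> a) *\<^sub>C e (k, u)"
        unfolding \<psi>_def by (rule left_invariant_convolution[OF inv]) (simp add: up_act[OF e_in_component])
      finally show ?thesis by (simp add: slice_right_tensor h_right f)
    qed
    then have "slice_right (\<lambda>q. h (q * a)) (z - e (k, u) \<otimes> f k) = 0" for a
      by (simp add: clinear_diff[OF clinear_slice_right[OF h_right]])
    then have "z - e (k, u) \<otimes> f k \<in> cspan {x \<otimes> y |x y. \<forall>a. h (y * a) = 0}"
      by (rule slices_zero_imp_in_span[OF h_right])
    moreover have "{x \<otimes> y |(x::'a) y. \<forall>a. h (y * a) = 0} \<subseteq> {0}" using faithful by force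
    ultimately have "z - e (k, u) \<otimes> f k = 0"
      using cspan_eq_zero[OF _ clinear_ident, of _ "{x \<otimes> y |(x::'a) y. \<forall>a. h (y * a) = 0}"] by blast
    then have "lcop (e (k, u)) (f k) = e (k, u) \<otimes> f u"
      using z(2) by (simp add: canonical_tensor)
    from arg_cong[OF this, of "slice_right \<epsilon>"] show ?thesis
      by (simp add: slice_\<epsilon> slice_right_tensor clinear_\<epsilon>)
  qed
  have "h (conv h b a) = \<epsilon> (f n) * h a" if a: "a \<in> A (k, l) (m, n)" for k l m n a
  proof -
    have up_a: "up k \<rhd> a = a" and a_e: "a * e (m, n) = a" using a by (simp_all add: up_act e_mult)
    have "h (conv h b a) = h (f k * a)" by (simp add: f up_a \<psi>_def)
    also have "\<dots> = h (e (m, n) * f k * a)"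
      using supported_on_diagonal_e[OF h, of "(m, n)" "f k * a"] by (simp add: mult.assoc a_e)
    also have "\<dots> = \<epsilon> (f n) * h a"
    proof (cases "m = k")
      case True
      have "h (e (k, n) * a) = h a"
        using supported_on_diagonal_e[OF h, of "(k, n)" a] a_e True by simp
      then show ?thesis by (simp add: True f_e clinear_scaleC[OF h(1)] scaleC_complex_def)
    next
      case False
      have "e (m, n) * (up k \<rhd> f k) = 0"
        using False by (simp add: multiplier_compatible up_act[OF e_in_component])
      then have "e (m, n) * f k = 0" by (simp add: up_f)
      moreover have "h a = 0" using supported_on_diagonalD[OF h(2) a] False by simp
      ultimately show ?thesis by (simp add: clinear_zero[OF h(1)])
    qed
    finally show ?thesis .
  qed
  then show ?thesis by (intro exI[of _ "\<lambda>n. \<epsilon> (f n)"] allI ballI)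
qed

lemma conv_e:
  assumes h: "clinear h" and b: "b \<in> A j (t, v)"
  shows "conv h b (e (k, v)) = h b *\<^sub>C e (k, t)"
proof -
  have "x * conv h b (e (k, v)) = x * (h b *\<^sub>C e (k, t))" if x: "x \<in> A k' l'" for x k' l'
  proof -
    have "x * conv h b (e (k, v)) = slice_right h ((x \<otimes> b) \<lhd> \<Delta> (e (k, v)))"
      by (simp add: slice_right_ract_\<Delta> h)
    also have "\<dots> = x * (h b *\<^sub>C e (k, t))"
      using ract_\<Delta>_e[of x k' "fst l'" "snd l'" b j t v "(k, v)"] x b
      by (cases l') (auto simp: e_mult slice_right_tensor h clinear_zero[OF clinear_slice_right[OF h]])
    finally show ?thesis .
  qed
  from component_eqI[OF clinear_times_right clinear_times_right this] show ?thesis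
    by (rule A_eq_right)
qed

text \<open>The scalars of the previous lemma are found by evaluating at \<open>a = \<one>(k,v)\<close>, which gives
  \<open>(h \<otimes> h)((1 \<otimes> b)\<Delta>(a)) = h(b)h(\<one>\<^sub>va)\<close> for \<open>b\<close> in \<open>A\<one>\<^sub>v\<close>. With \<open>cb\<close> in place of \<open>b\<close> this says
  \<open>h(c y) = 0\<close> for all \<open>c\<close>, where \<open>y = (h \<otimes> id)((1 \<otimes> b)\<Delta>(a)) - h(\<one>\<^sub>va)b\<close>; so \<open>y = 0\<close> by faithfulness.\<close>

theorem normalized_faithful_left_invariant_imp_right_invariant:
  assumes inv: "left_invariant A \<Delta> h" and norm: "\<And>r. h (e (r, r)) = 1"
    and faithful: "faithful_functional h"
  shows "right_invariant A \<Delta> h"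
proof -
  have h: "clinear h" "supported_on_diagonal h" using inv by (auto simp: left_invariant_iff)
  have faithful_left: "y = 0" if "\<And>a. h (y * a) = 0" for y
    using faithful that unfolding faithful_functional_def by blast
  have faithful_right: "y = 0" if "\<And>a. h (a * y) = 0" for y
    using faithful that unfolding faithful_functional_def by blast
  have component: "h (conv h b a) = h b * h (lo v \<rhd> a)"
    if b: "b \<in> A j (t, v)" and a: "a \<in> A (k, l) (m, n)" for a b j t v k l m n
  proof (cases "l = v")
    case False
    have "conv h b (lo l \<rhd> a) = conv h (b \<lhd> lo l) a" by (rule conv_lower[OF diagonal_lo])
    then have "conv h b a = 0"
      using a b False by (simp add: lo_act clinear_zero[OF clinear_conv(2)[OF h(1)]])
    then show ?thesis using a False by (simp add: lo_act clinear_zero[OF h(1)])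
  next
    case l: True
    obtain \<mu> where \<mu>: "\<And>k l m n a. a \<in> A (k, l) (m, n) \<Longrightarrow> h (conv h b a) = \<mu> n * h a"
      using convolution_eq_scaled[OF inv faithful_left b] by blast
    show ?thesis
    proof (cases "h a = 0")
      case True
      then show ?thesis using \<mu>[OF a] a l by (simp add: lo_act)
    next
      case False
      then have mn: "m = k" "n = v" using supported_on_diagonalD[OF h(2) a] l by auto
      have e_kv: "e (k, v) \<noteq> 0"
        using False a l clinear_zero[OF h(1)] by (metis component_iff mult_zero_left)
      have "h (e (k, v)) = 1" using left_invariant_e[OF inv e_kv, of v] norm by simp
      \<comment> \<open>Evaluate at \<open>\<one>(k,v)\<close>, which is nonzero because \<open>a\<close> is.\<close>
      then have "\<mu> v = h b * h (e (k, t))"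
        using \<mu>[OF e_in_component, of k v] by (simp add: conv_e[OF h(1) b] clinear_scaleC[OF h(1)] scaleC_complex_def)
      also have "\<dots> = h b"
      proof (cases "h b = 0")
        case False
        then have "j = (t, v)" using supported_on_diagonalD[OF h(2) b] by blast
        then have "e (t, v) \<noteq> 0"
          using False b clinear_zero[OF h(1)] by (metis component_iff mult_zero_left)
        then have "h (e (k, t)) = h (e (t, t))"
          using left_invariant_e[OF inv e_kv, of t] left_invariant_e[OF inv, of t v t] by simp
        then show ?thesis using norm by simp
      qed simp
      finally show ?thesis using \<mu>[OF a] a l mn by (simp add: lo_act)
    qed
  qed
  have conv: "h (conv h b a) = h b * h (lo v \<rhd> a)" if b: "b \<lhd> lo v = b" for a b v
  proof -
    have "h (conv h (b \<lhd> lo v) a) = h (b \<lhd> lo v) * h (lo v \<rhd> a)"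
    proof (rule component_eqI[where a = a])
      show "clinear (\<lambda>a. h (b \<lhd> lo v) * h (lo v \<rhd> a))"
        by (rule clinearI) (simp_all add: act_simps clinear_add[OF h(1)] clinear_scaleC[OF h(1)] distrib_left scaleC_complex_def)
      fix k l a assume a: "a \<in> A k l"
      show "h (conv h (b \<lhd> lo v) a) = h (b \<lhd> lo v) * h (lo v \<rhd> a)"
      proof (rule component_eqI[where a = b])
        show "clinear (\<lambda>b. h (conv h (b \<lhd> lo v) a))"
          by (rule clinear_compose[OF h(1) clinear_compose[OF clinear_conv(2)[OF h(1)] clinear_ract]])
        show "clinear (\<lambda>b. h (b \<lhd> lo v) * h (lo v \<rhd> a))"
          by (rule clinearI) (simp_all add: act_simps clinear_add[OF h(1)] clinear_scaleC[OF h(1)] distrib_right scaleC_complex_def)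
        fix k' l' b assume b: "b \<in> A k' l'"
        show "h (conv h (b \<lhd> lo v) a) = h (b \<lhd> lo v) * h (lo v \<rhd> a)"
        proof (cases "snd l' = v")
          case True
          then have "b \<lhd> lo v = b" using b by (simp add: lo_act)
          moreover have "h (conv h b a) = h b * h (lo v \<rhd> a)"
            by (rule component[of b k' "fst l'" v a "fst k" "snd k" "fst l" "snd l"]) (use True a b in auto)
          ultimately show ?thesis by simp
        next
          case False
          then have "b \<lhd> lo v = 0" using b by (simp add: lo_act)
          then show ?thesis by (simp add: clinear_zero[OF clinear_conv(2)[OF h(1)]] clinear_zero[OF h(1)])
        qed
      qed
    qed (rule clinear_compose[OF h(1) clinear_conv(1)[OF h(1)]])
    then show ?thesis using b by simp
  qed
  show ?thesis
  proof (rule right_invariantI[OF h])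
    fix a b s assume b: "b \<lhd> lo s = b"
    have "h (c * (slice_left h (rcop b a) - h (lo s \<rhd> a) *\<^sub>C b)) = 0" for c
    proof -
      have cb: "(c * b) \<lhd> lo s = c * b" using b by (simp add: A_ract_mult)
      have "h (c * slice_left h (rcop b a)) = h (slice_left h (rcop (c * b) a))"
        using lact_rcop[of "mult_of c" b a] slice_left_lact_right[OF h(1), of "mult_of c" "rcop b a"] by simp
      also have "\<dots> = h (conv h (c * b) a)"
        unfolding conv_def by (rule slice_left_slice_right[symmetric, OF h(1) h(1)])
      finally show ?thesis
        by (simp add: conv[OF cb] right_diff_distrib clinear_diff[OF h(1)] clinear_scaleC[OF h(1)] scaleC_complex_def)
    qed
    then have "slice_left h (rcop b a) - h (lo s \<rhd> a) *\<^sub>C b = 0" by (rule faithful_right)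
    then show "slice_left h (rcop b a) = h (lo s \<rhd> a) *\<^sub>C b" by simp
  qed
qed

end

section \<open>Positive functionals\<close>

lemma positive_functional_hermitian:
  fixes \<phi> :: "'a::complex_star_algebra \<Rightarrow> complex"
  assumes "positive_functional \<phi>"
  shows "\<phi> (adj y * x) = cnj (\<phi> (adj x * y))"
proof -
  have \<phi>: "clinear \<phi>" and real: "\<And>a. Im (\<phi> (adj a * a)) = 0"
    using assms by (auto simp: positive_functional_def complex_is_Real_iff)
  note lin = clinear_add[OF \<phi>] clinear_scaleC[OF \<phi>] scaleC_complex_def
  have "Im (\<phi> (adj y * x) + \<phi> (adj x * y)) = 0"
    using real[of "x + y"] by (simp add: adj_add distrib_left distrib_right lin real)
  moreover have "Re (\<phi> (adj y * x) - \<phi> (adj x * y)) = 0"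
    using real[of "x + \<i> *\<^sub>C y"] by (simp add: adj_add adj_scaleC distrib_left distrib_right left_diff_distrib clinear_diff[OF \<phi>] lin real)
  ultimately show ?thesis by (simp add: complex_eq_iff)
qed

text \<open>The degenerate case of the Cauchy-Schwarz inequality.\<close>

lemma positive_functional_null:
  fixes \<phi> :: "'a::complex_star_algebra \<Rightarrow> complex"
  assumes pos: "positive_functional \<phi>" and null: "\<phi> (adj x * x) = 0"
  shows "\<phi> (adj y * x) = 0"
proof -
  have \<phi>: "clinear \<phi>" and nonneg: "\<And>a. 0 \<le> Re (\<phi> (adj a * a))"
    using pos by (auto simp: positive_functional_def)
  note lin = clinear_add[OF \<phi>] clinear_scaleC[OF \<phi>] scaleC_complex_def
  define s where "s = \<phi> (adj y * x)"
  have s': "\<phi> (adj x * y) = cnj s"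
    unfolding s_def by (rule positive_functional_hermitian[OF pos])
  define q where "q = Re (\<phi> (adj y * y))"
  have bound: "2 * t * (cmod s)\<^sup>2 \<le> q" for t :: real
  proof -
    define c where "c = - (complex_of_real t * cnj s)"
    have "\<phi> (adj (y + c *\<^sub>C x) * (y + c *\<^sub>C x)) = \<phi> (adj y * y) + c * s + cnj c * cnj s"
      by (simp add: adj_add adj_scaleC distrib_left distrib_right lin null s' flip: s_def)
    also have "c * s + cnj c * cnj s = - complex_of_real (2 * t * (cmod s)\<^sup>2)"
      by (simp add: c_def complex_norm_square[unfolded of_real_power] algebra_simps)
    then have "\<phi> (adj y * y) + c * s + cnj c * cnj s = \<phi> (adj y * y) - complex_of_real (2 * t * (cmod s)\<^sup>2)"
      by (simp add: add.assoc)
    finally show ?thesis using nonneg[of "y + c *\<^sub>C x"] by (simp add: q_def)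
  qed
  have "s = 0"
  proof (rule ccontr)
    assume "s \<noteq> 0"
    then show False using bound[of "(q + 1) / (2 * (cmod s)\<^sup>2)"] by simp
  qed
  then show ?thesis by (simp add: s_def)
qed

section \<open>Partial Hopf \<open>*\<close>-algebras\<close>

text \<open>A partial Hopf algebra on a \<open>*\<close>-algebra whose involution reverses the grading.\<close>

locale partial_Hopf_algebra_with_involution = partial_Hopf_algebra A \<Delta>
  for A :: "('i, 'a::complex_star_algebra) bigrading" and \<Delta> +
  assumes adj_component: "\<And>k l. adj ` A k l = A l k"
begin

lemma adj_e: "adj (e k) = e k"
proof -
  have "adj (e k) \<in> A k k" using adj_component[of k k] e_in_component[of k] by blast
  then have "e k * adj (e k) = adj (e k)" by (simp add: e_mult)
  then show ?thesis by (metis adj_adj adj_mult)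
qed

lemma adj_diagonal:
  assumes D: "diagonal D c" and real: "\<And>k. cnj (c k) = c k"
  shows "adj D = D"
proof (rule component_multiplier_eqI)
  fix k l a assume a: "a \<in> A k l"
  then have "adj a \<in> A l k" using adj_component[of k l] by blast
  then show "adj D \<rhd> a = D \<rhd> a" "a \<lhd> adj D = a \<lhd> D"
    by (simp_all add: diagonal_act[OF D] diagonal_act[OF D a] adj_scaleC real)
qed

lemma normalized_positive_left_invariant_faithful:
  assumes pos: "positive_functional \<phi>" and inv: "left_invariant A \<Delta> \<phi>" and norm: "\<And>r. \<phi> (e (r, r)) = 1"
  shows "faithful_functional \<phi>"
  unfolding faithful_functional_def
proof (intro allI impI)
  fix a assume "(\<forall>b. \<phi> (a * b) = 0) \<or> (\<forall>b. \<phi> (b * a) = 0)"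
  then show "a = 0"
  proof
    assume null: "\<forall>b. \<phi> (a * b) = 0"
    have "\<phi> (b * adj a) = 0" for b
      using positive_functional_hermitian[OF pos, of "adj b" "adj a"] null by simp
    then have "adj a = 0" by (rule normalized_left_invariant_null[OF inv norm])
    then have "a = adj 0" by (metis adj_adj)
    then show "a = 0" using adj_add[of "0::'a" 0] by simp
  qed (rule normalized_left_invariant_null[OF inv norm], simp)
qed

text \<open>Rescaling a left invariant functional on each \<open>\<one>\<^sub>tA\<close> preserves left invariance, since the left lower
  index of \<open>a\<close> is that of the second leg of \<open>\<Delta>(a)\<close>. It preserves positivity because the rescaling is by
  \<open>d = g\<^sup>2\<close> with \<open>g\<close> a selfadjoint diagonal multiplier, so that \<open>\<phi>(da\<^sup>*a) = \<phi>((ag)\<^sup>*(ag))\<close>.\<close>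

lemma normalize_left_invariant:
  assumes pos: "positive_functional \<phi>" and faithful: "faithful_functional \<phi>" and inv: "left_invariant A \<Delta> \<phi>"
  obtains h where "positive_functional h" "left_invariant A \<Delta> h" "\<And>r. h (e (r, r)) = 1"
proof -
  have \<phi>: "clinear \<phi>" "supported_on_diagonal \<phi>"
    and slice: "\<And>a b r. b \<lhd> up r = b \<Longrightarrow> slice_right \<phi> (lcop b a) = \<phi> (up r \<rhd> a) *\<^sub>C b"
    using inv by (auto simp: left_invariant_iff)
  define s where "s t = Re (\<phi> (e (t, t)))" for t
  have e_sq: "adj (e k) * e k = e k" for k by (simp add: adj_e e_idem)
  have \<phi>_e: "\<phi> (e (t, t)) = complex_of_real (s t)" and s_pos: "0 < s t" for t
  proof -
    have "\<phi> (e (t, t)) \<in> \<real>" "0 \<le> s t"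
      using pos e_sq[of "(t, t)"] unfolding positive_functional_def s_def by metis+
    then show eq: "\<phi> (e (t, t)) = complex_of_real (s t)" by (simp add: s_def of_real_Re)
    have "s t \<noteq> 0"
    proof
      assume "s t = 0"
      then have null: "\<phi> (adj (e (t, t)) * e (t, t)) = 0" using eq by (simp add: e_sq)
      have "\<phi> (b * e (t, t)) = 0" for b
        using positive_functional_null[OF pos null, of "adj b"] by simp
      then show False using faithful e_diagonal_nonzero[of t] unfolding faithful_functional_def by blast
    qed
    then show "0 < s t" using \<open>0 \<le> s t\<close> by simp
  qed
  define g where "g = strict_sum (\<lambda>t. complex_of_real (sqrt (1 / s t)) *\<^sub>C lo t)"
  define d where "d = g * g"
  have g: "diagonal g (\<lambda>k. complex_of_real (sqrt (1 / s (snd k))))"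
    unfolding g_def by (rule diagonal_sum_lo)
  have d: "diagonal d (\<lambda>k. complex_of_real (1 / s (snd k)))"
    unfolding diagonal_def d_def
  proof (intro allI ballI conjI)
    fix k l a assume a: "a \<in> A k l"
    have "complex_of_real (sqrt (1 / s t)) * complex_of_real (sqrt (1 / s t)) = complex_of_real (1 / s t)" for t
      using s_pos[of t] by (simp flip: of_real_mult)
    then show "(g * g) \<rhd> a = complex_of_real (1 / s (snd k)) *\<^sub>C a" "a \<lhd> (g * g) = complex_of_real (1 / s (snd l)) *\<^sub>C a"
      by (simp_all only: times_act diagonal_act[OF g a] act_simps scaleC_scaleC)
  qed
  define h where "h a = \<phi> (d \<rhd> a)" for a
  have h: "clinear h" unfolding h_def by (rule clinear_compose[OF \<phi>(1) clinear_lact])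
  show ?thesis
  proof
    show "positive_functional h"
      unfolding positive_functional_def
    proof (intro conjI allI h)
      fix a
      have "h (adj a * a) = \<phi> ((g \<rhd> (adj a * a)) \<lhd> g)"
        using supported_on_diagonal_commute[OF \<phi> g, of "g \<rhd> (adj a * a)"] by (simp add: h_def d_def)
      also have "(g \<rhd> (adj a * a)) \<lhd> g = (g \<rhd> adj a) * (a \<lhd> g)"
        by (simp add: A_lact_mult A_ract_mult)
      also have "g \<rhd> adj a = adj (a \<lhd> g)"
        using adj_act(1)[of g "adj a"] adj_diagonal[OF g] by simp
      finally show "h (adj a * a) \<in> \<real>" "0 \<le> Re (h (adj a * a))"
        using pos by (simp_all add: positive_functional_def)
    qed
    show "left_invariant A \<Delta> h"
      unfolding left_invariant_iff
    proof (intro conjI allI impI h)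
      show "supported_on_diagonal h"
        using \<phi>(2) by (auto simp: supported_on_diagonal_def h_def diagonal_act[OF d] clinear_scaleC[OF \<phi>(1)])
      fix a b r assume b: "b \<lhd> up r = b"
      have "slice_right h (lcop b a) = slice_right \<phi> (lcop b (d \<rhd> a))"
        unfolding h_def by (simp add: lcop_lower[OF d] slice_right_lact_right \<phi>(1))
      also have "\<dots> = \<phi> (up r \<rhd> d \<rhd> a) *\<^sub>C b" by (rule slice[OF b])
      also have "up r \<rhd> d \<rhd> a = d \<rhd> up r \<rhd> a"
        by (simp add: diagonal_commute[OF diagonal_up d] flip: times_act)
      finally show "slice_right h (lcop b a) = h (up r \<rhd> a) *\<^sub>C b" by (simp add: h_def[abs_def])
    qed
    show "h (e (r, r)) = 1" for r
      using s_pos[of r] by (simp add: h_def diagonal_act[OF d e_in_component] clinear_scaleC[OF \<phi>(1)] \<phi>_e scaleC_complex_def)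
  qed
qed

end

section \<open>Compact type and partial compact quantum groups\<close>

theorem proposition3p2:
  fixes A :: "('i, 'a::complex_star_algebra) bigrading"
    and \<Delta> :: "'a \<Rightarrow> ('a, 'a) tensor multiplier"
  assumes "partial_multiplier_Hopf_star_algebra A \<Delta>"
  shows "partial_star_algebraic_quantum_group_of_compact_type A \<Delta> \<longleftrightarrow> partial_compact_quantum_group A \<Delta>"
proof (cases "partial_Hopf_star_algebra A \<Delta>")
  case False
  then show ?thesis
    by (simp add: partial_star_algebraic_quantum_group_of_compact_type_def partial_compact_quantum_group_def)
next
  case True
  then interpret partial_Hopf_algebra_with_involution A \<Delta>
  proof unfold_locales
    show "regular_partial_multiplier_Hopf_algebra A \<Delta>"
      using True by (simp add: partial_Hopf_star_algebra_def partial_multiplier_Hopf_star_algebra_def)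
    show "base_unit A k \<in> range mult_of" for k
      using True unfolding partial_Hopf_star_algebra_def by (cases k) blast
    show "adj ` A k l = A l k" for k l
      using True unfolding partial_Hopf_star_algebra_def partial_multiplier_Hopf_star_algebra_def
      by (cases k, cases l) blast
  qed
  show ?thesis
  proof
    assume "partial_star_algebraic_quantum_group_of_compact_type A \<Delta>"
    then obtain \<phi> where \<phi>: "positive_functional \<phi>" "faithful_functional \<phi>" "left_invariant A \<Delta> \<phi>"
      by (auto simp: partial_star_algebraic_quantum_group_of_compact_type_def partial_star_algebraic_quantum_group_def)
    obtain h where h: "positive_functional h" "left_invariant A \<Delta> h" "\<And>r. h (e (r, r)) = 1"
      using normalize_left_invariant[OF \<phi>] by blast
    have "right_invariant A \<Delta> h"
      by (rule normalized_faithful_left_invariant_imp_right_invariant[OF h(2,3)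
            normalized_positive_left_invariant_faithful[OF h]])
    then show "partial_compact_quantum_group A \<Delta>"
      using True h unfolding partial_compact_quantum_group_def e_def by blast
  next
    assume "partial_compact_quantum_group A \<Delta>"
    then obtain \<phi> where \<phi>: "positive_functional \<phi>" "left_invariant A \<Delta> \<phi>" "\<And>r. \<phi> (e (r, r)) = 1"
      by (auto simp: partial_compact_quantum_group_def e_def)
    then have "faithful_functional \<phi>" by (rule normalized_positive_left_invariant_faithful)
    then show "partial_star_algebraic_quantum_group_of_compact_type A \<Delta>"
      using True assms \<phi> by (auto simp: partial_star_algebraic_quantum_group_of_compact_type_def
          partial_star_algebraic_quantum_group_def)
  qed
qed

end
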